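(* Let $D=D_h\#\cdots\#D_h$ be the connected sum of $n$ copies of the Hopf link diagram $D_h$. Then the Khovanov homology $H_{*,*}(D)$ is a free abelian group with generating polynomial $$h(a,b)(D)=\sum_{i,j}\mathrm{rank}\,H_{i,j}(D)\,b^ia^j=(a^2+a^{-2})(a^4b^2+a^{-4}b^{-2})^n .$$
   Context: Diagrams: $D$ is a diagram in the plane (disc) of an unoriented framed link, with ordered crossings. $D_h$ is the standard two-crossing diagram of the Hopf link. At each crossing there are two smoothings: the positive-marker smoothing ($A$-smoothing) joins the two local regions swept out when the overcrossing arc is rotated counterclockwise until it meets the undercrossing arc; the negative-marker smoothing joins the other two regions. A Kauffman state $s$ assigns $+1$ or $-1$ (a positive or negative marker) to each crossing; $D_s$ is the system of circles obtained by smoothing all crossings according to $s$, and $\sigma(s)$ is the number of positive minus the number of negative markers. Khovanov homology: an enhanced state $S$ is a Kauffman state $s$ with a sign $+$ or $-$ on each circle of $D_s$; put $\sigma(S)=\sigma(s)$ and $\tau(S)=\#\{\text{positive circles}\}-\#\{\text{negative circles}\}$. $\mathcal{C}_{i,j}(D)$ is the free abelian group on enhanced states with $\sigma(S)=i$ and $\sigma(S)+2\tau(S)=j$. The differential $d_{i,j}:\mathcal{C}_{i,j}(D)\to\mathcal{C}_{i-2,j}(D)$ is $d(S)=\sum_{S'}(-1)^{t(S:S')}[S:S']S'$, the sum over enhanced states $S'$ generating $\mathcal C_{i-2,j}(D)$, where $[S:S']=1$ if the markers of $S$ and $S'$ differ at exactly one crossing $v$ and all circles not touching $v$ have the same sign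 in $S$ and $S'$, and $[S:S']=0$ otherwise; $t(S:S')$ is the number of negative markers of $S$ at crossings bigger than $v$ in the ordering. $H_{i,j}(D)=\ker(d_{i,j})/\mathrm{im}(d_{i+2,j})$. *)

theory Defs
  imports
    "HOL-Algebra.Free_Abelian_Groups"
    "HOL-Library.Poly_Mapping"
    "HOL-Library.Product_Plus"
    "HOL-Library.FuncSet"
    "HOL-Combinatorics.Transposition"
begin

section \<open>Diagrams of unoriented framed links\<close>

text \<open>
  A diagram is given by its planar diagram (PD) code. The four positions 0, 1, 2, 3 at a crossing
  are numbered counterclockwise, so that 0 and 2 lie on the undercrossing strand and 1 and 3 on
  the overcrossing strand; \<open>edge D (c, k)\<close> is the arc (edge of the underlying four-valent graph)
  that arrives at position \<open>k\<close> of crossing \<open>c\<close>. Every arc occurs at exactly two positions, except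
  for components without crossings: such a component is an arc that occurs at no position.
  Crossings are natural numbers, and their ordering is that of the natural numbers.
\<close>

record diagram =
  crossings :: "nat set"
  arcs :: "nat set"
  edge :: "nat \<times> nat \<Rightarrow> nat"

definition slots :: "diagram \<Rightarrow> (nat \<times> nat) set" where
  "slots D = crossings D \<times> {..<4}"

text \<open>
  The standard diagram of the Hopf link has PD code \<open>X[4,1,3,2] X[2,3,1,4]\<close>. Up to isotopy in
  the sphere there is only one such diagram: it agrees with its mirror image.
\<close>

definition is_hopf_diagram :: "diagram \<Rightarrow> bool" where
  "is_hopf_diagram D \<longleftrightarrow>
     (\<exists>p q w x y z. p \<noteq> q \<and> distinct [w, x, y, z] \<and>
        crossings D = {p, q} \<and> arcs D = {w, x, y, z} \<and>
        edge D (p, 0) = w \<and> edge D (p, 1) = x \<and> edge D (p, 2) = y \<and> edge D (p, 3) = z \<and>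
        edge D (q, 0) = z \<and> edge D (q, 1) = y \<and> edge D (q, 2) = x \<and> edge D (q, 3) = w)"

text \<open>
  Connected sum of two disjoint diagrams. Cut an arc of \<open>D1\<close> and an arc of \<open>D2\<close>, and join the
  loose ends in pairs: if \<open>u\<close> and \<open>v\<close> are the positions of one end of either arc, this amounts to
  exchanging the labels at \<open>u\<close> and \<open>v\<close>. (Both ways of joining the ends are realised by planar
  diagrams, because an arc can be approached from the region on either side of it.) Summing along
  a component without crossings absorbs that component. No relation between the order of the
  crossings of \<open>D1\<close> and those of \<open>D2\<close> is imposed.
\<close>

definition disjoint_union_edge :: "diagram \<Rightarrow> diagram \<Rightarrow> nat \<times> nat \<Rightarrow> nat" where
  "disjoint_union_edge D1 D2 u = (if u \<in> slots D1 then edge D1 u else edge D2 u)"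

definition is_connected_sum :: "diagram \<Rightarrow> diagram \<Rightarrow> diagram \<Rightarrow> bool" where
  "is_connected_sum D1 D2 D \<longleftrightarrow>
     crossings D1 \<inter> crossings D2 = {} \<and> arcs D1 \<inter> arcs D2 = {} \<and>
     crossings D = crossings D1 \<union> crossings D2 \<and>
     ((\<exists>u\<in>slots D1. \<exists>v\<in>slots D2.
         arcs D = arcs D1 \<union> arcs D2 \<and>
         (\<forall>w\<in>slots D. edge D w = disjoint_union_edge D1 D2 (transpose u v w))) \<or>
      (\<exists>e\<in>arcs D1 - edge D1 ` slots D1.
         arcs D = (arcs D1 - {e}) \<union> arcs D2 \<and>
         (\<forall>w\<in>slots D. edge D w = disjoint_union_edge D1 D2 w)) \<or>
      (\<exists>e\<in>arcs D2 - edge D2 ` slots D2.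
         arcs D = arcs D1 \<union> (arcs D2 - {e}) \<and>
         (\<forall>w\<in>slots D. edge D w = disjoint_union_edge D1 D2 w)))"

inductive is_hopf_sum :: "nat \<Rightarrow> diagram \<Rightarrow> bool" where
  one: "is_hopf_diagram D \<Longrightarrow> is_hopf_sum 1 D"
| step: "is_hopf_sum n D1 \<Longrightarrow> is_hopf_diagram D2 \<Longrightarrow> is_connected_sum D1 D2 D
    \<Longrightarrow> is_hopf_sum (Suc n) D"


section \<open>Kauffman states\<close>

definition kauffman_states :: "diagram \<Rightarrow> (nat \<Rightarrow> int) set" where
  "kauffman_states D = crossings D \<rightarrow>\<^sub>E {1, -1}"

text \<open>
  Turning the overcrossing strand 1-3 counterclockwise onto the undercrossing strand sweeps out the
  regions between positions 1, 2 and between positions 3, 0. Joining these two regions leaves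
  position 0 connected to 1, and 2 connected to 3.
\<close>

definition smoothing :: "int \<Rightarrow> (nat \<times> nat) set" where
  "smoothing m = (if m = 1 then {(0, 1), (2, 3)} else {(1, 2), (3, 0)})"

definition smoothing_rel :: "diagram \<Rightarrow> (nat \<Rightarrow> int) \<Rightarrow> (nat \<times> nat) set" where
  "smoothing_rel D s =
     {(edge D (c, k), edge D (c, l)) | c k l. c \<in> crossings D \<and> (k, l) \<in> smoothing (s c)}"

text \<open>A circle of the smoothed diagram is represented by the set of arcs that it runs through.\<close>

definition circles :: "diagram \<Rightarrow> (nat \<Rightarrow> int) \<Rightarrow> nat set set" where
  "circles D s = arcs D // (smoothing_rel D s \<union> (smoothing_rel D s)\<inverse>)\<^sup>*"

definition touches :: "diagram \<Rightarrow> nat set \<Rightarrow> nat \<Rightarrow> bool" where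
  "touches D C v \<longleftrightarrow> (\<exists>k<4. edge D (v, k) \<in> C)"


section \<open>The Khovanov chain complex\<close>

text \<open>An enhanced state is a pair of a Kauffman state and a choice of signs of its circles.\<close>

type_synonym enhanced_state = "(nat \<Rightarrow> int) \<times> (nat set \<Rightarrow> int)"

definition enhanced_states :: "diagram \<Rightarrow> enhanced_state set" where
  "enhanced_states D = (SIGMA s : kauffman_states D. circles D s \<rightarrow>\<^sub>E {1, -1})"

definition sigma :: "diagram \<Rightarrow> enhanced_state \<Rightarrow> int" where
  "sigma D S = (\<Sum>c\<in>crossings D. fst S c)"

definition tau :: "diagram \<Rightarrow> enhanced_state \<Rightarrow> int" where
  "tau D S = (\<Sum>C\<in>circles D (fst S). snd S C)"

definition generators :: "diagram \<Rightarrow> int \<Rightarrow> int \<Rightarrow> enhanced_state set" where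
  "generators D i j = {S \<in> enhanced_states D. sigma D S = i \<and> sigma D S + 2 * tau D S = j}"

definition chain_group :: "diagram \<Rightarrow> int \<Rightarrow> int \<Rightarrow> (enhanced_state \<Rightarrow>\<^sub>0 int) monoid" where
  "chain_group D i j = free_Abelian_group (generators D i j)"

definition differ_exactly_at :: "diagram \<Rightarrow> enhanced_state \<Rightarrow> enhanced_state \<Rightarrow> nat \<Rightarrow> bool" where
  "differ_exactly_at D S S' v \<longleftrightarrow> {c \<in> crossings D. fst S c \<noteq> fst S' c} = {v}"

text \<open>If the markers differ only at \<open>v\<close>, the circles not touching \<open>v\<close> are the same in both states.\<close>

definition incidence :: "diagram \<Rightarrow> enhanced_state \<Rightarrow> enhanced_state \<Rightarrow> int" where
  "incidence D S S' =
     (if \<exists>v. differ_exactly_at D S S' v \<and>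
             (\<forall>C\<in>circles D (fst S). \<not> touches D C v \<longrightarrow> snd S C = snd S' C)
      then 1 else 0)"

definition sign_exponent :: "diagram \<Rightarrow> enhanced_state \<Rightarrow> enhanced_state \<Rightarrow> nat" where
  "sign_exponent D S S' =
     card {c \<in> crossings D. fst S c = -1 \<and> (THE v. differ_exactly_at D S S' v) < c}"

definition differential ::
    "diagram \<Rightarrow> int \<Rightarrow> int \<Rightarrow> (enhanced_state \<Rightarrow>\<^sub>0 int) \<Rightarrow> (enhanced_state \<Rightarrow>\<^sub>0 int)" where
  "differential D i j = frag_extend (\<lambda>S. \<Sum>S'\<in>generators D (i - 2) j.
     frag_cmul ((-1) ^ sign_exponent D S S' * incidence D S S') (frag_of S'))"

definition khovanov_homology ::
    "diagram \<Rightarrow> int \<Rightarrow> int \<Rightarrow> (enhanced_state \<Rightarrow>\<^sub>0 int) set monoid" where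
  "khovanov_homology D i j =
     subgroup_generated (chain_group D i j)
       (kernel (chain_group D i j) (chain_group D (i - 2) j) (differential D i j))
     Mod (differential D (i + 2) j ` carrier (chain_group D (i + 2) j))"


section \<open>Rank and generating polynomial\<close>

definition is_free_abelian :: "('a, 'm) monoid_scheme \<Rightarrow> bool" where
  "is_free_abelian G \<longleftrightarrow> (\<exists>B :: 'a set. G \<cong> free_Abelian_group B)"

definition int_independent :: "('a, 'm) monoid_scheme \<Rightarrow> 'a set \<Rightarrow> bool" where
  "int_independent G B \<longleftrightarrow> B \<subseteq> carrier G \<and>
     (\<forall>c :: 'a \<Rightarrow> int. finprod G (\<lambda>x. x [^]\<^bsub>G\<^esub> c x) B = \<one>\<^bsub>G\<^esub> \<longrightarrow> (\<forall>x\<in>B. c x = 0))"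

text \<open>Only meaningful for groups of finite rank, such as the finitely generated ones.\<close>

definition abelian_rank :: "('a, 'm) monoid_scheme \<Rightarrow> nat" where
  "abelian_rank G = Sup {card B | B. finite B \<and> int_independent G B}"

text \<open>
  Laurent polynomials in \<open>a\<close> and \<open>b\<close> over the integers are finitely supported functions of the
  pair of exponents, with convolution as product; \<open>laurent_monom i j\<close> stands for \<open>b\<^sup>i a\<^sup>j\<close>.
\<close>

type_synonym laurent = "int \<times> int \<Rightarrow>\<^sub>0 int"

definition laurent_monom :: "int \<Rightarrow> int \<Rightarrow> laurent" where
  "laurent_monom i j = Poly_Mapping.single (i, j) 1"

definition khovanov_polynomial :: "diagram \<Rightarrow> laurent" where
  "khovanov_polynomial D =
     (\<Sum>(i, j) | abelian_rank (khovanov_homology D i j) \<noteq> 0.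
        of_nat (abelian_rank (khovanov_homology D i j)) * laurent_monom i j)"

end

theory Submission
  imports Defs
begin

text \<open>
  Read signs of circles as elements of \<open>A = \<int>[x]/x\<^sup>2\<close>, with \<open>1 = -\<close> and \<open>x = +\<close>, and let \<open>D\<close> be the connected
  sum of \<open>D\<^sub>1\<close> with a Hopf link along an arc \<open>e\<close> of \<open>D\<^sub>1\<close>. The four smoothings of the two new crossings
  exhibit the complex \<open>C(D)\<close> as a square \<open>C(D\<^sub>1) \<otimes> A \<rightarrow> C(D\<^sub>1) \<oplus> C(D\<^sub>1) \<rightarrow> C(D\<^sub>1) \<otimes> A\<close>, whose maps
  are the multiplication \<open>c \<otimes> a \<mapsto> a c\<close> and the comultiplication \<open>c \<mapsto> x c \<otimes> 1 + c \<otimes> x\<close>; here \<open>x\<close> acts on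
  \<open>C(D\<^sub>1)\<close> at the circle through \<open>e\<close>. The first map is onto the diagonal with kernel
  \<open>{c \<otimes> x - x c \<otimes> 1}\<close>, and the second is injective modulo the diagonal with cokernel represented by
  \<open>c \<otimes> 1\<close>. Both representatives are subcomplexes isomorphic to \<open>C(D\<^sub>1)\<close>, and the rest of \<open>C(D)\<close>
  is acyclic, so \<open>H(D)\<close> is the sum of two shifted copies of \<open>H(D\<^sub>1)\<close>. The induction also carries the
  facts \<open>d\<^sup>2 = 0\<close> and \<open>d x = x d\<close> for every arc, and starts with the crossingless circle.
\<close>

section \<open>Abelian groups with a basis modulo boundaries\<close>

text \<open>The exponents in the factor are the degree shifts of the two surviving representatives:
  two positive markers and a free circle labelled \<open>x\<close> raise sigma by 2 and
  \<open>sigma + 2 tau\<close> by 4; two negative markers and the label \<open>1\<close> do the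
  opposite. The map \<open>c \<mapsto> c \<otimes> x - x c \<otimes> 1\<close> is a chain map only
  if \<open>x\<close> at \<open>e\<close> commutes with \<open>d\<close>. The next Hopf link may be
  attached at any arc, old or new, so this has to be carried along for all arcs. Planarity is not
  part of a PD code, and for non-planar codes a marker change can keep the number of circles and
  spoil \<open>d\<^sup>2 = 0\<close>; this identity is therefore inherited from the explicit square
  instead of being proved for all diagrams. Two obstacles shape the bookkeeping. Circles are sets of
  arcs, so those of \<open>D\<close> and \<open>D\<^sub>1\<close> are different sets; they are
  compared by gluing, by intersecting with \<open>arcs D1\<close>, and through Boolean labellings of
  arcs. And the new crossings may stand anywhere in the ordering, so \<open>C(D\<^sub>1)\<close>
  embeds with the expected signs only after a correction that depends on the state.\<close>

lemma integer_vectors_dependent: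
  fixes v :: "'a \<Rightarrow> nat \<Rightarrow> int"
  assumes "finite B" "N < card B"
  shows "\<exists>c. (\<exists>x\<in>B. c x \<noteq> 0) \<and> (\<forall>k<N. (\<Sum>x\<in>B. c x * v x k) = 0)"
  using assms
proof (induction N arbitrary: B v)
  case 0
  then obtain x where "x \<in> B" by fastforce
  then show ?case by (intro exI[of _ "\<lambda>_. 1"]) auto
next
  case (Suc N)
  show ?case
  proof (cases "\<forall>x\<in>B. v x N = 0")
    case True
    from Suc.IH[of B v] Suc.prems obtain c where
      c: "\<exists>x\<in>B. c x \<noteq> 0" "\<forall>k<N. (\<Sum>x\<in>B. c x * v x k) = 0" by auto
    with True have "\<forall>k<Suc N. (\<Sum>x\<in>B. c x * v x k) = 0"
      by (auto simp: less_Suc_eq)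
    with c show ?thesis by blast
  next
    case False
    then obtain x0 where x0: "x0 \<in> B" "v x0 N \<noteq> 0" by blast
    define B' where "B' = B - {x0}"
    \<comment> \<open>Elimination without division: cross-multiplying with the pivot
      \<open>v x0 N\<close> kills coordinate \<open>N\<close> and stays in the integers.\<close>
    define w where "w x k = v x0 N * v x k - v x N * v x0 k" for x k
    have fin: "finite B'" and "N < card B'" and B: "B = insert x0 B'" "x0 \<notin> B'"
      using Suc.prems x0 by (auto simp: B'_def)
    then obtain c where c: "\<exists>x\<in>B'. c x \<noteq> 0" "\<forall>k<N. (\<Sum>x\<in>B'. c x * w x k) = 0"
      using Suc.IH[of B' w] by auto
    define c' where "c' x = (if x = x0 then - (\<Sum>x\<in>B'. c x * v x N) else v x0 N * c x)" for x
    have "(\<Sum>x\<in>B. c' x * v x k) = (\<Sum>x\<in>B'. c x * w x k)" for k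
    proof -
      have "(\<Sum>x\<in>B. c' x * v x k) = c' x0 * v x0 k + (\<Sum>x\<in>B'. c' x * v x k)"
        using fin B by simp
      also have "(\<Sum>x\<in>B'. c' x * v x k) = (\<Sum>x\<in>B'. v x0 N * c x * v x k)"
        using B by (intro sum.cong) (auto simp: c'_def)
      also have "c' x0 * v x0 k = - (\<Sum>x\<in>B'. c x * v x N * v x0 k)"
        by (simp add: c'_def sum_distrib_right)
      finally show ?thesis
        by (simp add: w_def sum_negf[symmetric] sum.distrib[symmetric] algebra_simps)
    qed
    moreover have "(\<Sum>x\<in>B'. c x * w x N) = 0"
      by (simp add: w_def)
    ultimately have "\<forall>k<Suc N. (\<Sum>x\<in>B. c' x * v x k) = 0"
      using c by (auto simp: less_Suc_eq)
    moreover have "\<exists>x\<in>B. c' x \<noteq> 0"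
      using c(1) x0 B by (auto simp: c'_def)
    ultimately show ?thesis by blast
  qed
qed

lemma keys_sum_frag_cmul:
  assumes "\<And>k. k \<in> I \<Longrightarrow> Poly_Mapping.keys (b k) \<subseteq> S"
  shows "Poly_Mapping.keys (\<Sum>k\<in>I. frag_cmul (c k) (b k)) \<subseteq> S"
  by (intro order_trans[OF keys_sum] UN_least order_trans[OF keys_cmul] assms)

lemma finprod_free_Abelian_group:
  assumes "finite B" "\<And>x. x \<in> B \<Longrightarrow> Poly_Mapping.keys (f x) \<subseteq> S"
  shows "finprod (free_Abelian_group S) f B = sum f B"
proof -
  interpret comm_group "free_Abelian_group S" by (rule abelian_free_Abelian_group)
  show ?thesis
    using assms by (induction B) (auto simp: finprod_insert Pi_def)
qed

text \<open>The rank is a supremum of natural numbers, so it needs an upper bound that is attained.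
  The isomorphism turns independence into linear independence of integer vectors with
  \<open>N\<close> coordinates: more than \<open>N\<close> of them are dependent, and the preimages
  of the unit vectors reach \<open>N\<close>.\<close>

lemma abelian_rank_free:
  assumes "comm_group G" and iso: "G \<cong> free_Abelian_group {..<N::nat}"
  shows "abelian_rank G = N"
proof -
  let ?F = "free_Abelian_group {..<N}"
  interpret G: comm_group G by fact
  interpret F: comm_group ?F by (rule abelian_free_Abelian_group)
  from iso obtain h where h: "h \<in> iso G ?F" by (auto simp: is_iso_def)
  then have hom: "h \<in> hom G ?F" and bij: "bij_betw h (carrier G) (carrier ?F)"
    by (auto simp: iso_def)
  interpret h: group_hom G ?F h
    using hom by (simp add: group_hom_def group_hom_axioms_def)
  have h1: "h x = 0 \<longleftrightarrow> x = \<one>\<^bsub>G\<^esub>" if "x \<in> carrier G" for x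
    using that h.hom_one inj_onD[OF bij_betw_imp_inj_on[OF bij], of x "\<one>\<^bsub>G\<^esub>"] by auto
  have hsum: "h (finprod G (\<lambda>x. x [^]\<^bsub>G\<^esub> c x) B) = (\<Sum>x\<in>B. frag_cmul (c x) (h x))"
    if "finite B" "B \<subseteq> carrier G" for B and c :: "'a \<Rightarrow> int"
  proof -
    have "h (finprod G (\<lambda>x. x [^]\<^bsub>G\<^esub> c x) B) = finprod ?F (\<lambda>x. h (x [^]\<^bsub>G\<^esub> c x)) B"
      using that
    proof (induction B)
      case (insert x B)
      then have cl: "x [^]\<^bsub>G\<^esub> c x \<in> carrier G" "(\<lambda>x. x [^]\<^bsub>G\<^esub> c x) \<in> B \<rightarrow> carrier G" by auto
      then have "(\<lambda>x. h (x [^]\<^bsub>G\<^esub> c x)) \<in> B \<rightarrow> carrier ?F" "h (x [^]\<^bsub>G\<^esub> c x) \<in> carrier ?F"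
        using h.hom_closed by blast+
      with cl insert show ?case
        by (simp add: G.finprod_insert F.finprod_insert h.hom_mult del: carrier_free_Abelian_group_iff)
    qed simp
    also have "\<dots> = (\<Sum>x\<in>B. h (x [^]\<^bsub>G\<^esub> c x))"
      using that h.hom_closed G.int_pow_closed
      by (intro finprod_free_Abelian_group) (auto simp del: carrier_free_Abelian_group_iff
          simp flip: carrier_free_Abelian_group_iff)
    also have "\<dots> = (\<Sum>x\<in>B. frag_cmul (c x) (h x))"
    proof (intro sum.cong refl)
      fix x assume "x \<in> B"
      then have "x \<in> carrier G" using that by auto
      moreover from this have "Poly_Mapping.keys (h x) \<subseteq> {..<N}"
        using h.hom_closed by (metis carrier_free_Abelian_group_iff)
      ultimately show "h (x [^]\<^bsub>G\<^esub> c x) = frag_cmul (c x) (h x)"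
        by (subst h.hom_int_pow) simp_all
    qed
    finally show ?thesis .
  qed
  have independent: "int_independent G B \<longleftrightarrow> B \<subseteq> carrier G \<and>
      (\<forall>c. (\<Sum>x\<in>B. frag_cmul (c x) (h x)) = 0 \<longrightarrow> (\<forall>x\<in>B. c x = 0))" if "finite B" for B
  proof -
    have "finprod G (\<lambda>x. x [^]\<^bsub>G\<^esub> c x) B \<in> carrier G" if "B \<subseteq> carrier G" for c :: "'a \<Rightarrow> int"
      using that by (intro G.finprod_closed) auto
    then show ?thesis
      using hsum[OF that] h1 unfolding int_independent_def by metis
  qed
  have "card B \<le> N" if B: "finite B" "int_independent G B" for B
  proof (rule ccontr)
    assume "\<not> card B \<le> N"
    then obtain c where c: "\<exists>x\<in>B. c x \<noteq> 0"
      "\<forall>k<N. (\<Sum>x\<in>B. c x * Poly_Mapping.lookup (h x) k) = 0"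
      using integer_vectors_dependent[of B N "\<lambda>x. Poly_Mapping.lookup (h x)"] B by auto
    have keys: "Poly_Mapping.keys (h x) \<subseteq> {..<N}" if "x \<in> B" for x
      using B that h.hom_closed independent by (metis carrier_free_Abelian_group_iff in_mono)
    have "(\<Sum>x\<in>B. frag_cmul (c x) (h x)) = 0"
    proof (rule poly_mapping_eqI)
      fix k
      show "Poly_Mapping.lookup (\<Sum>x\<in>B. frag_cmul (c x) (h x)) k = Poly_Mapping.lookup 0 k"
      proof (cases "k < N")
        case True
        with c show ?thesis by (simp add: lookup_sum)
      next
        case False
        then have "Poly_Mapping.lookup (h x) k = 0" if "x \<in> B" for x
          using keys[OF that] by (metis in_keys_iff lessThan_iff subsetD)
        then show ?thesis by (simp add: lookup_sum)
      qed
    qed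
    with c B independent show False by blast
  qed
  moreover have "\<exists>B. finite B \<and> int_independent G B \<and> card B = N"
  proof -
    define g where "g k = inv_into (carrier G) h (frag_of k)" for k
    have g: "g k \<in> carrier G" "h (g k) = frag_of k" if "k < N" for k
    proof -
      have "frag_of k \<in> h ` carrier G"
        using that bij by (simp add: bij_betw_def)
      then show "g k \<in> carrier G" "h (g k) = frag_of k"
        by (auto simp: g_def inv_into_into f_inv_into_f)
    qed
    have inj: "inj_on g {..<N}"
      using g by (metis frag_of_eq inj_onI lessThan_iff)
    have "int_independent G (g ` {..<N})"
      unfolding independent[OF finite_imageI[OF finite_lessThan]]
    proof (intro conjI allI impI)
      fix c assume "(\<Sum>x\<in>g ` {..<N}. frag_cmul (c x) (h x)) = 0"
      then have "(\<Sum>k<N. frag_cmul (c (g k)) (frag_of k)) = 0"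
        using g by (simp add: sum.reindex[OF inj])
      then have 0: "Poly_Mapping.lookup (\<Sum>k<N. frag_cmul (c (g k)) (frag_of k)) m = 0" for m
        by simp
      have "c (g m) = 0" if "m < N" for m
        using 0[of m] that by (simp add: lookup_sum if_distrib[of "(*) _"] cong: if_cong)
      then show "\<forall>x\<in>g ` {..<N}. c x = 0" by auto
    qed (use g in auto)
    then show ?thesis
      using card_image[OF inj] by (intro exI[of _ "g ` {..<N}"]) auto
  qed
  ultimately show ?thesis
    unfolding abelian_rank_def by (intro cSup_eq_maximum) auto
qed

text \<open>The classes of \<open>b\<close> are a basis of \<open>Z\<close> modulo \<open>B\<close>.
  The phrasing on chains lets the induction push bases through additive maps without handling
  cosets.\<close>

definition homology_basis ::
    "('a \<Rightarrow>\<^sub>0 int) set \<Rightarrow> ('a \<Rightarrow>\<^sub>0 int) set \<Rightarrow> nat \<Rightarrow> (nat \<Rightarrow> 'a \<Rightarrow>\<^sub>0 int) \<Rightarrow> bool" where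
  "homology_basis Z B N b \<longleftrightarrow> b ` {..<N} \<subseteq> Z \<and>
     (\<forall>z\<in>Z. \<exists>c. z - (\<Sum>k<N. frag_cmul (c k) (b k)) \<in> B) \<and>
     (\<forall>c. (\<Sum>k<N. frag_cmul (c k) (b k)) \<in> B \<longrightarrow> (\<forall>k<N. c k = 0))"

text \<open>The last two clauses of \<open>homology_basis\<close> are surjectivity and injectivity
  of the map that sends an integer combination of the \<open>b k\<close> to its coset.\<close>

lemma homology_basis_iso:
  assumes Z: "subgroup Z (free_Abelian_group S)" and B: "subgroup B (free_Abelian_group S)"
    and BZ: "B \<subseteq> Z" and basis: "homology_basis Z B N b"
  defines "H \<equiv> subgroup_generated (free_Abelian_group S) Z Mod B"
  shows "comm_group H" "H \<cong> free_Abelian_group {..<N}"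
proof -
  let ?G = "free_Abelian_group S" and ?F = "free_Abelian_group {..<N}"
  define GZ where "GZ = subgroup_generated ?G Z"
  interpret G: comm_group ?G by (rule abelian_free_Abelian_group)
  interpret GZ: comm_group GZ unfolding GZ_def by (rule G.abelian_subgroup_generated[OF G.comm_group_axioms])
  have carr: "carrier GZ = Z"
    unfolding GZ_def using Z by (rule subgroup.carrier_subgroup_generated_subgroup)
  have mult: "x \<otimes>\<^bsub>GZ\<^esub> y = x + y" for x y
    by (simp add: GZ_def)
  have "subgroup B GZ"
    unfolding GZ_def using B BZ Z by (simp add: G.subgroup_subgroup_generated_iff
        subgroup.carrier_subgroup_generated_subgroup)
  then interpret normal B GZ
    by (rule GZ.subgroup_imp_normal)
  show "comm_group H"
    unfolding H_def GZ_def[symmetric] using \<open>subgroup B GZ\<close> by (rule GZ.abelian_FactGroup)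
  interpret H: comm_group H by fact
  define \<Phi> where "\<Phi> c = B #>\<^bsub>GZ\<^esub> frag_extend b c" for c
  have ext: "frag_extend b c = (\<Sum>k<N. frag_cmul (Poly_Mapping.lookup c k) (b k))"
    if "Poly_Mapping.keys c \<subseteq> {..<N}" for c
    unfolding frag_extend_def using that
    by (intro sum.mono_neutral_left) (auto simp: in_keys_iff)
  have Z0: "0 \<in> Z" and ZD: "x \<in> Z \<Longrightarrow> y \<in> Z \<Longrightarrow> x + y \<in> Z" and ZM: "x \<in> Z \<Longrightarrow> - x \<in> Z" for x y
    using subgroup.one_closed[OF Z] subgroup.m_closed[OF Z, of x y]
      subgroup.m_inv_closed[OF Z, of x] subgroup.subset[OF Z] by auto
  have Zcm: "frag_cmul m x \<in> Z" if "x \<in> Z" for m x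
    using G.subgroup_int_pow_closed[OF Z that, of m] subgroup.subset[OF Z] that by auto
  have Zb: "b k \<in> Z" if "k < N" for k
    using basis that by (auto simp: homology_basis_def)
  have extZ: "frag_extend b c \<in> Z" if "Poly_Mapping.keys c \<subseteq> {..<N}" for c
  proof -
    have "(\<Sum>k\<in>I. frag_cmul (Poly_Mapping.lookup c k) (b k)) \<in> Z" if "I \<subseteq> {..<N}" for I
      using finite_subset[OF that finite_lessThan] that
      by (induction I) (auto intro!: Z0 ZD Zcm Zb)
    then show ?thesis using ext[OF that] by auto
  qed
  have rcos: "B #>\<^bsub>GZ\<^esub> x = B #>\<^bsub>GZ\<^esub> y \<longleftrightarrow> x - y \<in> B" if "x \<in> Z" "y \<in> Z" for x y
  proof
    assume "B #>\<^bsub>GZ\<^esub> x = B #>\<^bsub>GZ\<^esub> y"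
    moreover have "x \<in> B #>\<^bsub>GZ\<^esub> x"
      using subgroup.one_closed[OF B] by (force simp: r_coset_def mult)
    ultimately show "x - y \<in> B" by (auto simp: r_coset_def mult)
  next
    assume xy: "x - y \<in> B"
    then have "x \<in> B #>\<^bsub>GZ\<^esub> y" by (force simp: r_coset_def mult)
    then show "B #>\<^bsub>GZ\<^esub> x = B #>\<^bsub>GZ\<^esub> y"
      using that carr \<open>subgroup B GZ\<close> GZ.repr_independence by metis
  qed
  have hom: "\<Phi> \<in> hom ?F H"
  proof (rule homI)
    fix c assume "c \<in> carrier ?F"
    then show "\<Phi> c \<in> carrier H"
      using extZ carr by (auto simp: H_def GZ_def[symmetric] \<Phi>_def carrier_FactGroup)
  next
    fix c c' assume "c \<in> carrier ?F" "c' \<in> carrier ?F"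
    then show "\<Phi> (c \<otimes>\<^bsub>?F\<^esub> c') = \<Phi> c \<otimes>\<^bsub>H\<^esub> \<Phi> c'"
      using extZ[of c] extZ[of c'] carr rcos_sum[of "frag_extend b c" "frag_extend b c'"]
      by (simp add: \<Phi>_def H_def GZ_def[symmetric] frag_extend_add mult)
  qed
  have "inj_on \<Phi> (carrier ?F)"
  proof (rule inj_onI)
    fix c c' assume c: "c \<in> carrier ?F" "c' \<in> carrier ?F" and "\<Phi> c = \<Phi> c'"
    then have "frag_extend b (c - c') \<in> B"
      using rcos extZ by (auto simp: \<Phi>_def frag_extend_diff)
    moreover have keys: "Poly_Mapping.keys (c - c') \<subseteq> {..<N}"
      using c keys_diff[of c c'] by auto
    ultimately have "Poly_Mapping.lookup (c - c') k = 0" if "k < N" for k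
      using basis that ext[OF keys] by (auto simp: homology_basis_def)
    then have "Poly_Mapping.lookup (c - c') k = 0" for k
      using keys by (metis in_keys_iff lessThan_iff subsetD)
    then have "c - c' = 0" by (intro poly_mapping_eqI) auto
    then show "c = c'" by simp
  qed
  moreover have "\<Phi> ` carrier ?F = carrier H"
  proof (intro equalityI)
    show "\<Phi> ` carrier ?F \<subseteq> carrier H" using hom by (auto simp: hom_def)
    show "carrier H \<subseteq> \<Phi> ` carrier ?F"
    proof
      fix A assume "A \<in> carrier H"
      then obtain z where z: "z \<in> Z" "A = B #>\<^bsub>GZ\<^esub> z"
        using carr by (auto simp: H_def GZ_def[symmetric] carrier_FactGroup)
      then obtain c where c: "z - (\<Sum>k<N. frag_cmul (c k) (b k)) \<in> B"
        using basis by (auto simp: homology_basis_def)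
      define c' where "c' = (\<Sum>k<N. frag_cmul (c k) (frag_of k))"
      have keys: "Poly_Mapping.keys c' \<subseteq> {..<N}"
        unfolding c'_def by (rule keys_sum_frag_cmul) auto
      have "frag_extend b c' = (\<Sum>k<N. frag_cmul (c k) (b k))"
        by (simp add: c'_def frag_extend_sum frag_extend_cmul)
      then have "\<Phi> c' = A"
        using z c rcos[OF z(1) extZ[OF keys]] by (simp add: \<Phi>_def)
      with keys show "A \<in> \<Phi> ` carrier ?F" by auto
    qed
  qed
  ultimately have "\<Phi> \<in> iso ?F H"
    using hom by (auto simp: iso_def bij_betw_def)
  then show "H \<cong> ?F"
    using group.iso_sym[OF group_free_Abelian_group] by (auto simp: is_iso_def)
qed

text \<open>\<open>is_free_abelian\<close> asks for a basis inside the element type of the group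
  itself; an infinite type has room for any finite number of basis elements.\<close>

lemma is_free_abelian_finite_rank:
  fixes G :: "('a, 'm) monoid_scheme"
  assumes "infinite (UNIV :: 'a set)" "G \<cong> free_Abelian_group {..<N::nat}"
  shows "is_free_abelian G"
proof -
  obtain B :: "'a set" where "finite B" "card B = N"
    using infinite_arbitrarily_large[OF assms(1)] by blast
  then have "{..<N} \<approx> B"
    by (simp add: eqpoll_iff_card)
  then have "free_Abelian_group {..<N} \<cong> free_Abelian_group B"
    by (simp add: isomorphic_free_Abelian_groups)
  with assms(2) show ?thesis
    unfolding is_free_abelian_def by (blast intro: iso_trans)
qed

section \<open>Coefficients of the generating polynomial\<close>

text \<open>The coefficient of \<open>b\<^sup>i a\<^sup>j\<close>, given by the recursion that both
  sides satisfy: multiplication by the factor for one Hopf link shifts exponents by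
  \<open>(2, 4)\<close> and \<open>(-2, -4)\<close>, and homology splits with the same shifts. The
  base case is a single circle, positive or negative.\<close>

fun hopf_betti :: "nat \<Rightarrow> int \<Rightarrow> int \<Rightarrow> nat" where
  "hopf_betti 0 i j = (if i = 0 \<and> \<bar>j\<bar> = 2 then 1 else 0)"
| "hopf_betti (Suc n) i j = hopf_betti n (i - 2) (j - 4) + hopf_betti n (i + 2) (j + 4)"

lemma lookup_mult_single:
  fixes p :: "'a::ab_group_add \<Rightarrow>\<^sub>0 'b::comm_semiring_1"
  shows "Poly_Mapping.lookup (p * Poly_Mapping.single k c) x = Poly_Mapping.lookup p (x - k) * c"
proof -
  have "(\<Sum>q. Poly_Mapping.lookup (Poly_Mapping.single k c) q when x = l + q) = (c when l = x - k)" for l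
  proof -
    have "(Poly_Mapping.lookup (Poly_Mapping.single k c) q when x = l + q) = ((c when l = x - k) when q = k)" for q
      by (auto simp: lookup_single when_def)
    then show ?thesis by simp
  qed
  then show ?thesis
    by (simp add: lookup_mult mult_when)
qed

lemma lookup_hopf_polynomial:
  "Poly_Mapping.lookup ((laurent_monom 0 2 + laurent_monom 0 (-2)) *
      (laurent_monom 2 4 + laurent_monom (-2) (-4)) ^ n) (i, j) = int (hopf_betti n i j)"
proof (induction n arbitrary: i j)
  case 0
  show ?case
    by (auto simp: laurent_monom_def lookup_add lookup_single when_def)
next
  case (Suc n)
  then show ?case
    unfolding power_Suc2 mult.assoc[symmetric]
    by (simp add: laurent_monom_def lookup_add lookup_mult_single distrib_left diff_Pair)
qed

lemma laurent_expansion: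
  fixes p :: laurent
  assumes "\<And>i j. Poly_Mapping.lookup p (i, j) = int (r i j)"
  shows "(\<Sum>(i, j) | r i j \<noteq> 0. of_nat (r i j) * laurent_monom i j) = p"
proof -
  have keys: "{(i, j). r i j \<noteq> 0} = Poly_Mapping.keys p"
    using assms by (auto simp: in_keys_iff)
  have coeff: "of_nat (r i j) * laurent_monom i j = Poly_Mapping.single (i, j) (Poly_Mapping.lookup p (i, j))" for i j
    by (simp add: laurent_monom_def assms mult_single flip: single_of_nat)
  have "(\<Sum>(i, j) | r i j \<noteq> 0. of_nat (r i j) * laurent_monom i j) =
      (\<Sum>x\<in>Poly_Mapping.keys p. Poly_Mapping.single x (Poly_Mapping.lookup p x))"
    unfolding keys by (intro sum.cong refl) (clarsimp simp: coeff)
  also have "\<dots> = p"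
  proof (rule poly_mapping_eqI)
    fix x
    show "Poly_Mapping.lookup (\<Sum>x\<in>Poly_Mapping.keys p. Poly_Mapping.single x (Poly_Mapping.lookup p x)) x = Poly_Mapping.lookup p x"
      by (cases "x \<in> Poly_Mapping.keys p") (auto simp: lookup_sum lookup_single when_def in_keys_iff)
  qed
  finally show ?thesis .
qed

section \<open>Circles of a smoothed diagram\<close>

text \<open>Circles are connected components, and these labellings are the Boolean functions that
  are constant on components. They allow circles of different diagrams to be compared crossing by
  crossing, without following paths.\<close>

definition compatible :: "diagram \<Rightarrow> (nat \<Rightarrow> int) \<Rightarrow> (nat \<Rightarrow> bool) \<Rightarrow> bool" where
  "compatible D s g \<longleftrightarrow> (\<forall>(a, b) \<in> smoothing_rel D s. g a = g b)"

lemma compatible_iff: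
  "compatible D s g \<longleftrightarrow> (\<forall>c\<in>crossings D.
     if s c = 1 then g (edge D (c, 0)) = g (edge D (c, 1)) \<and> g (edge D (c, 2)) = g (edge D (c, 3))
     else g (edge D (c, 1)) = g (edge D (c, 2)) \<and> g (edge D (c, 3)) = g (edge D (c, 0)))"
proof -
  have "compatible D s g \<longleftrightarrow>
      (\<forall>c\<in>crossings D. \<forall>(k, l)\<in>smoothing (s c). g (edge D (c, k)) = g (edge D (c, l)))"
    unfolding compatible_def smoothing_rel_def by blast
  then show ?thesis by (simp add: smoothing_def)
qed

definition circle_of :: "diagram \<Rightarrow> (nat \<Rightarrow> int) \<Rightarrow> nat \<Rightarrow> nat set" where
  "circle_of D s a = (smoothing_rel D s \<union> (smoothing_rel D s)\<inverse>)\<^sup>* `` {a}"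

lemma circles_eq_image: "circles D s = circle_of D s ` arcs D"
  by (auto simp: circles_def quotient_def circle_of_def)

lemma compatible_mem_circle_of: "compatible D s (\<lambda>x. x \<in> circle_of D s a)"
  unfolding compatible_def circle_of_def by (auto intro: rtrancl_into_rtrancl)

text \<open>Labellings separate components: the indicator of the circle through \<open>a\<close> is
  itself compatible.\<close>

lemma mem_circle_of_iff: "b \<in> circle_of D s a \<longleftrightarrow> (\<forall>g. compatible D s g \<longrightarrow> g a = g b)"
proof
  assume "b \<in> circle_of D s a"
  then have "(a, b) \<in> (smoothing_rel D s \<union> (smoothing_rel D s)\<inverse>)\<^sup>*"
    by (simp add: circle_of_def)
  then show "\<forall>g. compatible D s g \<longrightarrow> g a = g b"
    by induction (auto simp: compatible_def)
next
  assume "\<forall>g. compatible D s g \<longrightarrow> g a = g b"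
  moreover have "compatible D s (\<lambda>x. x \<in> circle_of D s a)"
    by (rule compatible_mem_circle_of)
  moreover have "a \<in> circle_of D s a"
    by (simp add: circle_of_def)
  ultimately show "b \<in> circle_of D s a" by blast
qed

lemma self_mem_circle_of [simp]: "a \<in> circle_of D s a"
  by (simp add: mem_circle_of_iff)

lemma circle_of_eq_iff: "circle_of D s a = circle_of D s b \<longleftrightarrow> a \<in> circle_of D s b"
proof
  assume "a \<in> circle_of D s b"
  then have "compatible D s g \<Longrightarrow> g b = g a" for g
    by (simp add: mem_circle_of_iff)
  then show "circle_of D s a = circle_of D s b"
    unfolding set_eq_iff mem_circle_of_iff by blast
qed (use self_mem_circle_of in blast)

lemma circle_of_eqI:
  assumes "a \<in> C" "compatible D s (\<lambda>x. x \<in> C)"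
    and "\<And>b g. b \<in> C \<Longrightarrow> compatible D s g \<Longrightarrow> g a = g b"
  shows "circle_of D s a = C"
  using assms by (auto simp: mem_circle_of_iff)

lemma circle_eq_circle_of: "C \<in> circles D s \<Longrightarrow> a \<in> C \<Longrightarrow> C = circle_of D s a"
  using circle_of_eq_iff[of D s a] by (auto simp only: circles_eq_image)

lemma circle_of_in_circles [simp]: "a \<in> arcs D \<Longrightarrow> circle_of D s a \<in> circles D s"
  by (simp add: circles_eq_image)

lemma circle_of_cong:
  assumes "\<And>c. c \<in> crossings D \<Longrightarrow> s c = s' c"
  shows "circle_of D s = circle_of D s'" "circles D s = circles D s'"
proof -
  have "compatible D s g = compatible D s' g" for g
    using assms by (simp add: compatible_iff)
  then show *: "circle_of D s = circle_of D s'"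
    by (auto simp: mem_circle_of_iff)
  show "circles D s = circles D s'"
    by (simp add: circles_eq_image *)
qed

lemma circle_of_subset_arcs:
  assumes "edge D ` slots D \<subseteq> arcs D" "a \<in> arcs D"
  shows "circle_of D s a \<subseteq> arcs D"
proof
  fix b assume "b \<in> circle_of D s a"
  moreover have "compatible D s (\<lambda>x. x \<in> arcs D)"
    using assms(1) by (force simp: compatible_iff slots_def)
  ultimately show "b \<in> arcs D"
    using assms(2) unfolding mem_circle_of_iff by blast
qed

lemma circle_not_touching_persists:
  assumes "C \<in> circles D s" "\<not> touches D C v"
  shows "C \<in> circles D (s(v := m))"
proof -
  obtain a where a: "a \<in> arcs D" "C = circle_of D s a"
    using assms(1) by (auto simp: circles_eq_image)
  have v: "edge D (v, k) \<notin> C" if "k < 4" for k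
    using assms(2) that by (auto simp: touches_def)
  have C: "compatible D s (\<lambda>x. x \<in> C)"
    unfolding a(2) by (rule compatible_mem_circle_of)
  have "circle_of D (s(v := m)) a = C"
  proof (rule circle_of_eqI)
    show "compatible D (s(v := m)) (\<lambda>x. x \<in> C)"
      unfolding compatible_iff
    proof
      fix c assume "c \<in> crossings D"
      then show "if (s(v := m)) c = 1
         then (edge D (c, 0) \<in> C) = (edge D (c, 1) \<in> C) \<and> (edge D (c, 2) \<in> C) = (edge D (c, 3) \<in> C)
         else (edge D (c, 1) \<in> C) = (edge D (c, 2) \<in> C) \<and> (edge D (c, 3) \<in> C) = (edge D (c, 0) \<in> C)"
        using C v by (cases "c = v") (auto simp: compatible_iff)
    qed
  next
    fix b g assume b: "b \<in> C" and g: "compatible D (s(v := m)) g"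
    \<comment> \<open>Cut down to \<open>C\<close>, the labelling is constantly false at
      \<open>v\<close>, so the marker there does not matter. It is compatible with the old state,
      for which \<open>C\<close> is a single circle.\<close>
    have "compatible D s (\<lambda>x. x \<in> C \<and> g x)"
      unfolding compatible_iff
    proof
      fix c assume c: "c \<in> crossings D"
      show "if s c = 1
         then (edge D (c, 0) \<in> C \<and> g (edge D (c, 0))) = (edge D (c, 1) \<in> C \<and> g (edge D (c, 1)))
           \<and> (edge D (c, 2) \<in> C \<and> g (edge D (c, 2))) = (edge D (c, 3) \<in> C \<and> g (edge D (c, 3)))
         else (edge D (c, 1) \<in> C \<and> g (edge D (c, 1))) = (edge D (c, 2) \<in> C \<and> g (edge D (c, 2)))
           \<and> (edge D (c, 3) \<in> C \<and> g (edge D (c, 3))) = (edge D (c, 0) \<in> C \<and> g (edge D (c, 0)))"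
      proof (cases "c = v")
        case False
        with c g C show ?thesis by (auto simp: compatible_iff)
      qed (use v in auto)
    qed
    then have "(a \<in> C \<and> g a) = (b \<in> C \<and> g b)"
      using b mem_circle_of_iff[of b D s a] a(2) by blast
    moreover have "a \<in> C" by (simp add: a(2))
    ultimately show "g a = g b" using b by simp
  qed (use a in simp)
  with a show ?thesis by (metis circle_of_in_circles)
qed

section \<open>Signs of circles and adjacent enhanced states\<close>

lemma enhanced_states_iff:
  "(s, g) \<in> enhanced_states D \<longleftrightarrow>
     s \<in> crossings D \<rightarrow>\<^sub>E {1, -1} \<and> g \<in> circles D s \<rightarrow>\<^sub>E {1, -1}"
  by (simp add: enhanced_states_def kauffman_states_def)

definition sign_at :: "diagram \<Rightarrow> nat \<Rightarrow> enhanced_state \<Rightarrow> int" where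
  "sign_at D a S = snd S (circle_of D (fst S) a)"

definition set_sign :: "diagram \<Rightarrow> nat \<Rightarrow> int \<Rightarrow> enhanced_state \<Rightarrow> enhanced_state" where
  "set_sign D a r S = (fst S, (snd S)(circle_of D (fst S) a := r))"

lemma fst_set_sign [simp]: "fst (set_sign D a r S) = fst S"
  by (simp add: set_sign_def)

lemma enhanced_stateD:
  assumes "S \<in> enhanced_states D"
  shows "fst S \<in> crossings D \<rightarrow>\<^sub>E {1, -1}" "snd S \<in> circles D (fst S) \<rightarrow>\<^sub>E {1, -1}"
  using assms by (cases S; simp add: enhanced_states_iff)+

lemma set_sign_in_enhanced_states:
  assumes S: "S \<in> enhanced_states D" and a: "a \<in> arcs D" and r: "r \<in> {1, -1}"
  shows "set_sign D a r S \<in> enhanced_states D"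
proof -
  have "insert (circle_of D (fst S) a) (circles D (fst S)) = circles D (fst S)"
    using a by (intro insert_absorb) simp
  then have "(snd S)(circle_of D (fst S) a := r) \<in> circles D (fst S) \<rightarrow>\<^sub>E {1, -1}"
    using PiE_fun_upd[OF r enhanced_stateD(2)[OF S], of "circle_of D (fst S) a"] by (rule subst)
  then show ?thesis
    unfolding set_sign_def enhanced_states_iff using enhanced_stateD(1)[OF S] by (intro conjI)
qed

lemma sign_at_in:
  assumes "S \<in> enhanced_states D" "a \<in> arcs D"
  shows "sign_at D a S \<in> {1, -1}"
  unfolding sign_at_def
  by (rule PiE_mem[OF enhanced_stateD(2)[OF assms(1)]]) (simp add: assms(2))

lemma tau_set_sign:
  assumes "finite (arcs D)" "a \<in> arcs D"
  shows "tau D (set_sign D a r S) = tau D S - sign_at D a S + r"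
proof -
  let ?c = "circle_of D (fst S) a"
  have fin: "finite (circles D (fst S))" and c: "?c \<in> circles D (fst S)"
    using assms by (simp_all add: circles_eq_image)
  have "(\<Sum>C\<in>circles D (fst S) - {?c}. ((snd S)(?c := r)) C) = (\<Sum>C\<in>circles D (fst S) - {?c}. snd S C)"
    by (intro sum.cong) auto
  then show ?thesis
    using sum.remove[OF fin c, of "snd S"] sum.remove[OF fin c, of "(snd S)(?c := r)"]
    by (simp add: tau_def set_sign_def sign_at_def)
qed

text \<open>The pairs of generators with incidence 1. As sigma drops by 2 and \<open>j\<close> is
  kept, tau must rise by 1; this replaces the two degrees and also the distinction between merging
  and splitting circles.\<close>

definition adjacent :: "diagram \<Rightarrow> nat \<Rightarrow> enhanced_state \<Rightarrow> enhanced_state \<Rightarrow> bool" where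
  "adjacent D v S S' \<longleftrightarrow> S \<in> enhanced_states D \<and> S' \<in> enhanced_states D \<and> v \<in> crossings D \<and>
     fst S v = 1 \<and> fst S' = (fst S)(v := -1) \<and> tau D S' = tau D S + 1 \<and>
     (\<forall>C\<in>circles D (fst S). \<not> touches D C v \<longrightarrow> snd S C = snd S' C)"

text \<open>
  The assumptions cover both a connected sum with a Hopf link along the arcs \<open>e\<close> and \<open>f\<close> and the
  Hopf link itself, seen as an extension of a crossingless circle with \<open>e = f\<close>. The labels at the
  positions enter only through Boolean labellings that do not distinguish \<open>e\<close> from \<open>f\<close>.
\<close>

locale hopf_extension =
  fixes D1 D :: diagram and p q w x y z e f :: nat
  assumes distinct_crossings: "p \<noteq> q" "p \<notin> crossings D1" "q \<notin> crossings D1"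
    and crossings_eq: "crossings D = insert p (insert q (crossings D1))"
    and finite_crossings1: "finite (crossings D1)"
    and distinct_arcs: "distinct [w, x, y, z]"
    and arcs_eq: "arcs D = arcs D1 \<union> {w, x, y, z}"
    and finite_arcs1: "finite (arcs D1)"
    and slots_arcs1: "edge D1 ` slots D1 \<subseteq> arcs D1"
    and e_arc: "e \<in> arcs D1" and f_arc: "f \<in> {w, x, y, z}"
    and arcs_Int: "arcs D1 \<inter> {w, x, y, z} \<subseteq> {e} \<inter> {f}"
    and edge_old: "\<And>g c k. (g e \<longleftrightarrow> g f) \<Longrightarrow> c \<in> crossings D1 \<Longrightarrow> k < 4 \<Longrightarrow>
          g (edge D (c, k)) \<longleftrightarrow> g (edge D1 (c, k))"
    and edge_p: "\<And>g. (g e \<longleftrightarrow> g f) \<Longrightarrow> map (\<lambda>k. g (edge D (p, k))) [0, 1, 2, 3] = map g [w, x, y, z]"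
    and edge_q: "\<And>g. (g e \<longleftrightarrow> g f) \<Longrightarrow> map (\<lambda>k. g (edge D (q, k))) [0, 1, 2, 3] = map g [z, y, x, w]"
    and compatible_join: "\<And>s g. compatible D s g \<Longrightarrow> g e \<longleftrightarrow> g f"
begin

text \<open>With equal markers at \<open>p\<close> and \<open>q\<close> the smoothed Hopf link falls
  into two circles, with different markers it is one circle. \<open>F s\<close> is the circle
  through \<open>f\<close>, which the sum glues to the circle through \<open>e\<close>; the rest,
  \<open>G\<close>, is a free circle or empty.\<close>

definition F :: "(nat \<Rightarrow> int) \<Rightarrow> nat set" where
  "F s = (if s p = 1 \<and> s q = 1 then (if f \<in> {w, x} then {w, x} else {y, z})
     else if s p \<noteq> 1 \<and> s q \<noteq> 1 then (if f \<in> {x, y} then {x, y} else {z, w})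
     else {w, x, y, z})"

definition G :: "(nat \<Rightarrow> int) \<Rightarrow> nat set" where
  "G s = {w, x, y, z} - F s"

text \<open>A labelling with equal values at \<open>e\<close> and \<open>f\<close> cannot see that
  the labels at the cut were exchanged, so the conditions for \<open>D\<close> become those for
  \<open>D1\<close> and for the Hopf link separately. Conversely \<open>compatible_join\<close>
  forces the equal values.\<close>

lemma compatible_split:
  "compatible D s g \<longleftrightarrow> compatible D1 s g \<and> (g e \<longleftrightarrow> g f) \<and>
    (if s p = 1 then g w = g x \<and> g y = g z else g x = g y \<and> g z = g w) \<and>
    (if s q = 1 then g z = g y \<and> g x = g w else g y = g x \<and> g w = g z)"
proof (cases "g e \<longleftrightarrow> g f")
  case True
  have "compatible D1 s g \<longleftrightarrow> (\<forall>c\<in>crossings D1.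
     if s c = 1 then g (edge D (c, 0)) = g (edge D (c, 1)) \<and> g (edge D (c, 2)) = g (edge D (c, 3))
     else g (edge D (c, 1)) = g (edge D (c, 2)) \<and> g (edge D (c, 3)) = g (edge D (c, 0)))"
    unfolding compatible_iff by (intro ball_cong refl) (simp add: edge_old[OF True])
  then show ?thesis
    using edge_p[OF True] edge_q[OF True] True
    unfolding compatible_iff[of D] crossings_eq by auto
next
  case False
  then show ?thesis using compatible_join by blast
qed

lemma F_facts: "f \<in> F s" "F s \<subseteq> {w, x, y, z}" "F s \<inter> arcs D1 \<subseteq> {e}" "G s \<inter> arcs D1 = {}"
  "F s \<inter> G s = {}" "{w, x, y, z} = F s \<union> G s" "e \<notin> G s" "f \<notin> G s"
proof -
  show 1: "f \<in> F s" "F s \<subseteq> {w, x, y, z}"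
    using f_arc by (auto simp: F_def)
  show "F s \<inter> arcs D1 \<subseteq> {e}" "G s \<inter> arcs D1 = {}"
    using 1 arcs_Int by (auto simp: G_def)
  show "F s \<inter> G s = {}" "{w, x, y, z} = F s \<union> G s" "f \<notin> G s"
    using 1 by (auto simp: G_def)
  show "e \<notin> G s" using \<open>G s \<inter> arcs D1 = {}\<close> e_arc by auto
qed

lemma arcs_neq: "w \<noteq> x" "w \<noteq> y" "w \<noteq> z" "x \<noteq> w" "x \<noteq> y" "x \<noteq> z" "y \<noteq> w" "y \<noteq> x" "y \<noteq> z" "z \<noteq> w" "z \<noteq> x" "z \<noteq> y"
  using distinct_arcs by auto

lemma G_empty_iff: "G s = {} \<longleftrightarrow> (s p = 1) \<noteq> (s q = 1)"
  by (simp add: G_def F_def insert_Diff_if arcs_neq)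

lemma F_compatible:
  "if s p = 1 then (w \<in> F s \<longleftrightarrow> x \<in> F s) \<and> (y \<in> F s \<longleftrightarrow> z \<in> F s)
   else (x \<in> F s \<longleftrightarrow> y \<in> F s) \<and> (z \<in> F s \<longleftrightarrow> w \<in> F s)"
  "if s q = 1 then (z \<in> F s \<longleftrightarrow> y \<in> F s) \<and> (x \<in> F s \<longleftrightarrow> w \<in> F s)
   else (y \<in> F s \<longleftrightarrow> x \<in> F s) \<and> (w \<in> F s \<longleftrightarrow> z \<in> F s)"
proof -
  show "if s p = 1 then (w \<in> F s \<longleftrightarrow> x \<in> F s) \<and> (y \<in> F s \<longleftrightarrow> z \<in> F s)
     else (x \<in> F s \<longleftrightarrow> y \<in> F s) \<and> (z \<in> F s \<longleftrightarrow> w \<in> F s)"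
    by (simp add: F_def arcs_neq)
  show "if s q = 1 then (z \<in> F s \<longleftrightarrow> y \<in> F s) \<and> (x \<in> F s \<longleftrightarrow> w \<in> F s)
     else (y \<in> F s \<longleftrightarrow> x \<in> F s) \<and> (w \<in> F s \<longleftrightarrow> z \<in> F s)"
    by (simp add: F_def arcs_neq)
qed

lemma compatible_F:
  assumes g: "compatible D s g" and a: "a \<in> F s"
  shows "g a = g f"
proof (cases "s p = 1"; cases "s q = 1")
  assume s: "s p = 1" "s q = 1"
  have "g u = g v" if "u \<in> {w, x} \<and> v \<in> {w, x} \<or> u \<in> {y, z} \<and> v \<in> {y, z}" for u v
    using g s that by (simp add: compatible_split) metis
  moreover have "a \<in> {w, x} \<and> f \<in> {w, x} \<or> a \<in> {y, z} \<and> f \<in> {y, z}"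
    using a f_arc s by (simp add: F_def arcs_neq split: if_splits; blast)
  ultimately show ?thesis by blast
next
  assume s: "s p \<noteq> 1" "s q \<noteq> 1"
  have "g u = g v" if "u \<in> {x, y} \<and> v \<in> {x, y} \<or> u \<in> {z, w} \<and> v \<in> {z, w}" for u v
    using g s that by (simp add: compatible_split) metis
  moreover have "a \<in> {x, y} \<and> f \<in> {x, y} \<or> a \<in> {z, w} \<and> f \<in> {z, w}"
    using a f_arc s by (simp add: F_def arcs_neq split: if_splits; blast)
  ultimately show ?thesis by blast
next
  assume s: "s p = 1" "s q \<noteq> 1"
  have "g u = g x" if "u \<in> {w, x, y, z}" for u
    using g s that by (simp add: compatible_split) metis
  moreover have "a \<in> {w, x, y, z}" using a s by (simp add: F_def)
  ultimately show ?thesis using f_arc by blast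
next
  assume s: "s p \<noteq> 1" "s q = 1"
  have "g u = g x" if "u \<in> {w, x, y, z}" for u
    using g s that by (simp add: compatible_split) metis
  moreover have "a \<in> {w, x, y, z}" using a s by (simp add: F_def)
  ultimately show ?thesis using f_arc by blast
qed

lemma compatible_G:
  assumes g: "compatible D s g" and ab: "a \<in> G s" "b \<in> G s"
  shows "g a = g b"
proof (cases "s p = 1"; cases "s q = 1")
  assume s: "s p = 1" "s q = 1"
  have "g u = g v" if "u \<in> {w, x} \<and> v \<in> {w, x} \<or> u \<in> {y, z} \<and> v \<in> {y, z}" for u v
    using g s that by (simp add: compatible_split) metis
  moreover have "a \<in> {w, x} \<and> b \<in> {w, x} \<or> a \<in> {y, z} \<and> b \<in> {y, z}"
    using ab s by (simp add: G_def F_def arcs_neq split: if_splits; blast)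
  ultimately show ?thesis by blast
next
  assume s: "s p \<noteq> 1" "s q \<noteq> 1"
  have "g u = g v" if "u \<in> {x, y} \<and> v \<in> {x, y} \<or> u \<in> {z, w} \<and> v \<in> {z, w}" for u v
    using g s that by (simp add: compatible_split) metis
  moreover have "a \<in> {x, y} \<and> b \<in> {x, y} \<or> a \<in> {z, w} \<and> b \<in> {z, w}"
    using ab s by (simp add: G_def F_def arcs_neq split: if_splits; blast)
  ultimately show ?thesis by blast
qed (use ab in \<open>simp_all add: G_def F_def\<close>)

lemma compatible1_cong:
  assumes "\<And>a. a \<in> arcs D1 \<Longrightarrow> g a = g' a"
  shows "compatible D1 s g = compatible D1 s g'"
proof -
  have "g (edge D1 (c, k)) = g' (edge D1 (c, k))" if "c \<in> crossings D1" "k < 4" for c k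
    using that slots_arcs1 by (intro assms) (auto simp: slots_def)
  then show ?thesis by (simp add: compatible_iff)
qed

lemma circle_of_subset_arcs1: "a \<in> arcs D1 \<Longrightarrow> circle_of D1 s a \<subseteq> arcs D1"
  using circle_of_subset_arcs slots_arcs1 by blast

lemma circle_subset_arcs1: "C \<in> circles D1 s \<Longrightarrow> C \<subseteq> arcs D1"
  using circle_of_subset_arcs1 by (auto simp: circles_eq_image)

definition merge :: "(nat \<Rightarrow> int) \<Rightarrow> nat set \<Rightarrow> nat set" where
  "merge s C = (if e \<in> C then C \<union> F s else C)"

text \<open>The glued-in arcs meet \<open>D1\<close> at most in \<open>e\<close>, which happens for
  the Hopf link seen as an extension of a circle. Intersecting with \<open>arcs D1\<close> therefore
  undoes the gluing.\<close>

lemma merge_Int: "C \<subseteq> arcs D1 \<Longrightarrow> merge s C \<inter> arcs D1 = C"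
  using F_facts(3) by (auto simp: merge_def)

lemma circle_of_old:
  assumes a: "a \<in> arcs D1"
  shows "circle_of D s a = merge s (circle_of D1 s a)"
proof (rule circle_of_eqI)
  let ?C = "circle_of D1 s a"
  have C: "?C \<subseteq> arcs D1" using a by (rule circle_of_subset_arcs1)
  show "a \<in> merge s ?C" by (simp add: merge_def)
  have "compatible D1 s (\<lambda>u. u \<in> merge s ?C) = compatible D1 s (\<lambda>u. u \<in> ?C)"
    using merge_Int[OF C, of s] by (intro compatible1_cong) auto
  moreover have ef: "e \<in> merge s ?C \<longleftrightarrow> f \<in> merge s ?C"
    using F_facts(1) C arcs_Int f_arc by (auto simp: merge_def)
  moreover have new: "u \<in> merge s ?C \<longleftrightarrow> e \<in> ?C \<and> u \<in> F s" if "u \<in> {w, x, y, z}" for u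
    using that C F_facts(1)[of s] arcs_Int by (auto simp: merge_def)
  ultimately show "compatible D s (\<lambda>u. u \<in> merge s ?C)"
    unfolding compatible_split using compatible_mem_circle_of[of D1 s a] F_compatible[of s]
      new[of w] new[of x] new[of y] new[of z] by (simp split: if_splits)
  fix b g assume b: "b \<in> merge s ?C" and g: "compatible D s g"
  then have g1: "compatible D1 s g" and ef: "g e = g f" by (auto simp: compatible_split)
  then have old: "g a = g c" if "c \<in> ?C" for c using that by (auto simp: mem_circle_of_iff)
  show "g a = g b"
  proof (cases "b \<in> ?C")
    case False
    with b have "b \<in> F s" "e \<in> ?C" by (auto simp: merge_def split: if_splits)
    then show ?thesis using compatible_F[OF g] old ef by metis
  qed (use old in auto)
qed

lemma circle_of_new:
  "a \<in> F s \<Longrightarrow> circle_of D s a = merge s (circle_of D1 s e)"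
  "a \<in> G s \<Longrightarrow> circle_of D s a = G s"
proof -
  assume "a \<in> F s"
  then have "a \<in> circle_of D s e"
    by (simp add: circle_of_old e_arc merge_def)
  then show "circle_of D s a = merge s (circle_of D1 s e)"
    using circle_of_eq_iff circle_of_old[OF e_arc] by metis
next
  assume a: "a \<in> G s"
  show "circle_of D s a = G s"
  proof (rule circle_of_eqI[OF a])
    have "compatible D1 s (\<lambda>u. u \<in> G s) = compatible D1 s (\<lambda>u. False)"
      using F_facts(4) by (intro compatible1_cong) auto
    then have "compatible D1 s (\<lambda>u. u \<in> G s)"
      by (simp add: compatible_def)
    moreover have "u \<in> G s \<longleftrightarrow> u \<notin> F s" if "u \<in> {w, x, y, z}" for u
      using that by (auto simp: G_def)
    ultimately show "compatible D s (\<lambda>u. u \<in> G s)"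
      unfolding compatible_split using F_facts(7,8)[of s] F_compatible[of s] by (simp split: if_splits)
  qed (use compatible_G a in blast)
qed

text \<open>The topological input of the square: the circles of \<open>D1\<close>, one of them
  enlarged, and a further circle exactly when the new markers agree. This is why two corners carry a
  factor \<open>A\<close> and two do not.\<close>

lemma circles_eq: "circles D s = merge s ` circles D1 s \<union> (if G s = {} then {} else {G s})"
proof -
  have "circles D s = circle_of D s ` arcs D1 \<union> circle_of D s ` F s \<union> circle_of D s ` G s"
    unfolding circles_eq_image[of D] arcs_eq F_facts(6)[of s] by blast
  also have "circle_of D s ` arcs D1 = merge s ` circles D1 s"
    by (simp add: circles_eq_image image_image circle_of_old)
  also have "circle_of D s ` G s = (if G s = {} then {} else {G s})"
    using circle_of_new(2)[of _ s] by auto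
  also have "circle_of D s ` F s \<subseteq> merge s ` circles D1 s"
    using circle_of_new(1)[of _ s] e_arc by auto
  then have "merge s ` circles D1 s \<union> circle_of D s ` F s = merge s ` circles D1 s" by blast
  finally show ?thesis .
qed

lemma circle_ef: "C \<in> circles D s \<Longrightarrow> e \<in> C \<longleftrightarrow> f \<in> C"
proof -
  assume "C \<in> circles D s"
  then have "compatible D s (\<lambda>u. u \<in> C)"
    using compatible_mem_circle_of by (auto simp: circles_eq_image)
  then show ?thesis using compatible_join by blast
qed

lemma ex_less_4: "(\<exists>k<4. P k) \<longleftrightarrow> P 0 \<or> P 1 \<or> P 2 \<or> P (3::nat)"
  by (auto simp: eval_nat_numeral less_Suc_eq)

lemma touches_old:
  assumes C: "C \<in> circles D s" and v: "v \<in> crossings D1"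
  shows "touches D C v \<longleftrightarrow> touches D1 (C \<inter> arcs D1) v"
proof -
  have "edge D (v, k) \<in> C \<longleftrightarrow> edge D1 (v, k) \<in> C \<inter> arcs D1" if "k < 4" for k
    using edge_old[of "\<lambda>u. u \<in> C" v k] circle_ef[OF C] v that slots_arcs1 by (auto simp: slots_def)
  then show ?thesis by (auto simp: touches_def)
qed

lemma touches_new:
  assumes C: "C \<in> circles D s" and v: "v \<in> {p, q}"
  shows "touches D C v \<longleftrightarrow> C \<inter> {w, x, y, z} \<noteq> {}"
  using edge_p[of "\<lambda>u. u \<in> C"] edge_q[of "\<lambda>u. u \<in> C"] circle_ef[OF C] v
  by (auto simp: touches_def ex_less_4)

end

section \<open>Enhanced states of a Hopf extension\<close>

lemma circle_nonempty:
  assumes "C \<in> circles D s"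
  shows "C \<noteq> {}"
proof -
  from assms obtain a where "C = circle_of D s a" by (auto simp: circles_eq_image)
  then have "a \<in> C" by simp
  then show ?thesis by blast
qed

context hopf_extension
begin

text \<open>The generator \<open>S \<otimes> t\<close> in the corner \<open>(a, b)\<close>. The free
  circle is recognised by avoiding \<open>arcs D1\<close>; in the mixed corners there is none and
  the state does not depend on \<open>t\<close>.\<close>

definition extend :: "int \<Rightarrow> int \<Rightarrow> int \<Rightarrow> enhanced_state \<Rightarrow> enhanced_state" where
  "extend a b t S = (let s = (fst S)(p := a, q := b) in
     (s, \<lambda>C\<in>circles D s. if C \<inter> arcs D1 = {} then t else snd S (C \<inter> arcs D1)))"

lemma upd_eqD:
  assumes "s(p := a, q := b) = s'(p := a', q := b')"
  shows "a = a'" "b = b'" "c \<in> crossings D1 \<Longrightarrow> s c = s' c"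
  using fun_cong[OF assms, of p] fun_cong[OF assms, of q] fun_cong[OF assms, of c] distinct_crossings
  by (auto split: if_splits)

lemma fst_extend [simp]: "fst (extend a b t S) = (fst S)(p := a, q := b)"
  by (simp add: extend_def Let_def)

lemma circle_of1_cong [simp]: "circle_of D1 (s(p := a, q := b)) = circle_of D1 s"
  using distinct_crossings by (intro circle_of_cong) auto

lemma circles1_cong [simp]: "circles D1 (s(p := a, q := b)) = circles D1 s"
  using distinct_crossings by (intro circle_of_cong) auto


lemma merge_Int_circle: "C \<in> circles D1 s \<Longrightarrow> merge s' C \<inter> arcs D1 = C"
  by (simp add: merge_Int circle_subset_arcs1)

lemma merge_in_circles: "C \<in> circles D1 s \<Longrightarrow> merge (s(p := a, q := b)) C \<in> circles D (s(p := a, q := b))"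
  by (simp add: circles_eq)

lemma G_in_circles: "G s \<noteq> {} \<Longrightarrow> G s \<in> circles D s"
  by (simp add: circles_eq)

lemma snd_extend_merge [simp]:
  "C \<in> circles D1 (fst S) \<Longrightarrow> snd (extend a b t S) (merge ((fst S)(p := a, q := b)) C) = snd S C"
  using circle_nonempty merge_in_circles
  by (simp add: extend_def Let_def merge_Int_circle)

lemma snd_extend_not_merge:
  "C \<notin> circles D ((fst S)(p := a, q := b)) \<Longrightarrow> snd (extend a b t S) C = undefined"
  by (simp add: extend_def Let_def)

lemma snd_extend_G:
  "G ((fst S)(p := a, q := b)) \<noteq> {} \<Longrightarrow>
    snd (extend a b t S) (G ((fst S)(p := a, q := b))) = t"
  by (simp add: extend_def Let_def G_in_circles F_facts(4))

lemma G_upd_empty_iff: "a \<in> {1, -1} \<Longrightarrow> b \<in> {1, -1} \<Longrightarrow> G (s(p := a, q := b)) = {} \<longleftrightarrow> a \<noteq> b"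
  using distinct_crossings by (auto simp: G_empty_iff)

lemma extend_in_enhanced_states:
  assumes "S \<in> enhanced_states D1" "a \<in> {1, -1}" "b \<in> {1, -1}" "t \<in> {1, -1}"
  shows "extend a b t S \<in> enhanced_states D"
proof -
  obtain s g where S: "S = (s, g)" by (cases S)
  have s: "s \<in> crossings D1 \<rightarrow>\<^sub>E {1, -1}" and g: "g \<in> circles D1 s \<rightarrow>\<^sub>E {1, -1}"
    using assms(1) by (auto simp: S enhanced_states_iff)
  have "s(p := a, q := b) \<in> crossings D \<rightarrow>\<^sub>E {1, -1}"
    using s assms by (auto simp: crossings_eq PiE_iff extensional_def)
  moreover have "(if C \<inter> arcs D1 = {} then t else g (C \<inter> arcs D1)) \<in> {1, -1}"
    if "C \<in> circles D (s(p := a, q := b))" for C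
  proof (cases "C = G (s(p := a, q := b))")
    case True
    then show ?thesis using F_facts(4) assms by simp
  next
    case False
    with that obtain C1 where C1: "C1 \<in> circles D1 s" "C = merge (s(p := a, q := b)) C1"
      by (auto simp: circles_eq split: if_splits)
    then show ?thesis
      using g assms(4) by (auto simp: merge_Int_circle)
  qed
  ultimately show ?thesis
    unfolding extend_def S Let_def enhanced_states_iff fst_conv snd_conv
    by (intro conjI restrict_PiE_iff[THEN iffD2] ballI)
qed

lemma enhanced_state_eqI:
  assumes "S \<in> enhanced_states D" "S' \<in> enhanced_states D"
    and "fst S = fst S'" "\<And>C. C \<in> circles D (fst S) \<Longrightarrow> snd S C = snd S' C"
  shows "S = S'"
proof -
  have "snd S = snd S'"
    using assms by (cases S; cases S') (auto simp: enhanced_states_iff intro: PiE_ext)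
  then show ?thesis using assms(3) by (simp add: prod_eq_iff)
qed

lemma enhanced_state_cases:
  assumes S: "S \<in> enhanced_states D"
  obtains S1 a b t where "S1 \<in> enhanced_states D1" "a \<in> {1, -1}" "b \<in> {1, -1}" "t \<in> {1, -1}"
    "S = extend a b t S1"
proof -
  define s1 where "s1 = restrict (fst S) (crossings D1)"
  define S1 where "S1 = (s1, \<lambda>C\<in>circles D1 s1. snd S (merge (fst S) C))"
  define a where "a = fst S p"
  define b where "b = fst S q"
  \<comment> \<open>Without a free circle any label would do; 1 is also the label chosen later for
    the mixed blocks.\<close>
  define t where "t = (if G (fst S) = {} then 1 else snd S (G (fst S)))"
  obtain s g where Sg: "S = (s, g)" by (cases S)
  have s: "s \<in> crossings D \<rightarrow>\<^sub>E {1, -1}" and g: "g \<in> circles D s \<rightarrow>\<^sub>E {1, -1}"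
    using S by (auto simp: Sg enhanced_states_iff)
  have fst: "s = s1(p := a, q := b)"
    using s distinct_crossings by (fastforce simp: s1_def a_def b_def Sg crossings_eq PiE_iff extensional_def fun_eq_iff)
  have ab: "a \<in> {1, -1}" "b \<in> {1, -1}"
    using s by (auto simp: a_def b_def Sg crossings_eq PiE_iff)
  have t: "t \<in> {1, -1}"
    using g G_in_circles[of s] by (auto simp: t_def Sg PiE_iff)
  have S1: "S1 \<in> enhanced_states D1"
  proof -
    have "s1 \<in> crossings D1 \<rightarrow>\<^sub>E {1, -1}"
      using s by (auto simp: s1_def Sg crossings_eq PiE_iff)
    moreover have "g (merge s C) \<in> {1, -1}" if "C \<in> circles D1 s1" for C
      using g that merge_in_circles[OF that, of a b] unfolding fst by auto
    ultimately show ?thesis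
      by (simp add: S1_def Sg enhanced_states_iff)
  qed
  have "S = extend a b t S1"
  proof (rule enhanced_state_eqI[OF S extend_in_enhanced_states[OF S1 ab t]])
    show "fst S = fst (extend a b t S1)"
      using fst by (simp add: Sg S1_def)
  next
    fix C assume C: "C \<in> circles D (fst S)"
    show "snd S C = snd (extend a b t S1) C"
    proof (cases "C = G s")
      case True
      then have "G s \<noteq> {}" using circle_nonempty[OF C] by simp
      then show ?thesis using True snd_extend_G[of S1 a b t]
        by (simp add: S1_def t_def Sg flip: fst)
    next
      case False
      with C obtain C1 where C1: "C1 \<in> circles D1 s" "C = merge s C1"
        by (auto simp: circles_eq Sg split: if_splits)
      then have "C1 \<in> circles D1 s1" using fst by simp
      then show ?thesis using snd_extend_merge[of C1 S1 a b t] C1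
        by (simp add: S1_def Sg flip: fst)
    qed
  qed
  with S1 ab t that show ?thesis by blast
qed

lemma extend_inj:
  assumes "S \<in> enhanced_states D1" "S' \<in> enhanced_states D1"
    and ab: "a \<in> {1, -1}" "b \<in> {1, -1}"
    and eq: "extend a b t S = extend a' b' t' S'"
  shows "a = a'" "b = b'" "S = S'" "a = b \<Longrightarrow> t = t'"
proof -
  have *: "(fst S)(p := a, q := b) = (fst S')(p := a', q := b')"
    using arg_cong[OF eq, of fst] by simp
  show a: "a = a'" using fun_cong[OF *, of p] distinct_crossings by simp
  show b: "b = b'" using fun_cong[OF *, of q] by simp
  obtain s g s' g' where S: "S = (s, g)" "S' = (s', g')" by (cases S; cases S')
  have fst: "s = s'"
  proof (rule PiE_ext)
    show "s \<in> crossings D1 \<rightarrow>\<^sub>E {1, -1}" "s' \<in> crossings D1 \<rightarrow>\<^sub>E {1, -1}"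
      using assms S by (auto simp: enhanced_states_iff)
    fix c assume "c \<in> crossings D1"
    then show "s c = s' c"
      using fun_cong[OF *, of c] distinct_crossings by (auto simp: S split: if_splits)
  qed
  have "g = g'"
  proof (rule PiE_ext)
    show "g \<in> circles D1 s \<rightarrow>\<^sub>E {1, -1}" "g' \<in> circles D1 s \<rightarrow>\<^sub>E {1, -1}"
      using assms S fst by (auto simp: enhanced_states_iff)
    fix C assume "C \<in> circles D1 s"
    then show "g C = g' C"
      using snd_extend_merge[of C S a b t] snd_extend_merge[of C S' a' b' t'] eq a b fst
      by (simp add: S)
  qed
  with fst show "S = S'" by (simp add: S)
  assume "a = b"
  then have "G ((fst S)(p := a, q := b)) \<noteq> {}" using ab by (simp add: G_upd_empty_iff)
  then show "t = t'" using snd_extend_G[of S a b t] snd_extend_G[of S' a' b' t'] eq a b fst by (simp add: S)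
qed

lemma extend_mixed:
  assumes "S \<in> enhanced_states D1" "a \<in> {1, -1}" "b \<in> {1, -1}" "t \<in> {1, -1}" "t' \<in> {1, -1}" "a \<noteq> b"
  shows "extend a b t S = extend a b t' S"
proof (rule enhanced_state_eqI)
  fix C assume C: "C \<in> circles D (fst (extend a b t S))"
  have "G ((fst S)(p := a, q := b)) = {}" using assms by (simp add: G_upd_empty_iff)
  with C obtain C1 where "C1 \<in> circles D1 (fst S)" "C = merge ((fst S)(p := a, q := b)) C1"
    by (auto simp: circles_eq)
  then show "snd (extend a b t S) C = snd (extend a b t' S) C" by simp
qed (use assms extend_in_enhanced_states in auto)

lemma finite_crossings: "finite (crossings D)"
  by (simp add: crossings_eq finite_crossings1)

lemma finite_arcs: "finite (arcs D)"
  by (simp add: arcs_eq finite_arcs1)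

lemma sigma_extend: "sigma D (extend a b t S) = sigma D1 S + a + b"
proof -
  have "(\<Sum>c\<in>crossings D1. ((fst S)(p := a, q := b)) c) = (\<Sum>c\<in>crossings D1. fst S c)"
    using distinct_crossings by (intro sum.cong) auto
  then show ?thesis
    using distinct_crossings finite_crossings1 by (simp add: sigma_def crossings_eq)
qed

lemma inj_on_merge: "inj_on (merge s) (circles D1 s')"
  using merge_Int_circle by (metis inj_onI)

lemma tau_extend:
  assumes "a \<in> {1, -1}" "b \<in> {1, -1}"
  shows "tau D (extend a b t S) = tau D1 S + (if a = b then t else 0)"
proof -
  let ?s = "(fst S)(p := a, q := b)"
  have fin: "finite (circles D1 (fst S))" by (simp add: circles_eq_image finite_arcs1)
  have "(\<Sum>C\<in>merge ?s ` circles D1 (fst S). snd (extend a b t S) C) = tau D1 S"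
    by (simp add: tau_def sum.reindex[OF inj_on_merge])
  moreover have "G ?s \<notin> merge ?s ` circles D1 (fst S)"
    using F_facts(4)[of ?s] circle_nonempty merge_Int_circle by fastforce
  ultimately show ?thesis
    using G_upd_empty_iff[OF assms, of "fst S"] snd_extend_G[of S a b t] fin
    by (auto simp: tau_def circles_eq[of ?s])
qed

lemma sign_at_extend_old:
  "c \<in> arcs D1 \<Longrightarrow> sign_at D c (extend a b t S) = sign_at D1 c S"
  by (simp add: sign_at_def circle_of_old)

lemma sign_at_extend_F:
  "c \<in> F ((fst S)(p := a, q := b)) \<Longrightarrow> sign_at D c (extend a b t S) = sign_at D1 e S"
  by (simp add: sign_at_def circle_of_new e_arc)

lemma sign_at_extend_G:
  "c \<in> G ((fst S)(p := a, q := b)) \<Longrightarrow> sign_at D c (extend a b t S) = t"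
  using snd_extend_G[of S a b t] by (auto simp: sign_at_def circle_of_new)

text \<open>One statement for two uses: an arc of \<open>D1\<close>, and an arc of \<open>F\<close>
  with \<open>c = e\<close>. In both cases the circle in \<open>D\<close> is the glued image of a
  circle of \<open>D1\<close>.\<close>

lemma set_sign_extend_merge:
  assumes "c \<in> arcs D1" "circle_of D ((fst S)(p := a, q := b)) c' = merge ((fst S)(p := a, q := b)) (circle_of D1 (fst S) c)"
  shows "set_sign D c' r (extend a b t S) = extend a b t (set_sign D1 c r S)"
proof -
  let ?s = "(fst S)(p := a, q := b)"
  have "((snd (extend a b t S))(merge ?s (circle_of D1 (fst S) c) := r)) C = snd (extend a b t (set_sign D1 c r S)) C" for C
  proof (cases "C \<in> circles D ?s \<and> C \<noteq> G ?s")
    case True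
    then obtain C1 where C1: "C1 \<in> circles D1 (fst S)" "C = merge ?s C1"
      by (auto simp: circles_eq split: if_splits)
    then show ?thesis
      using snd_extend_merge[of C1 "set_sign D1 c r S" a b t] inj_onD[OF inj_on_merge, of ?s C1 "circle_of D1 (fst S) c" "fst S"] assms(1)
      by (auto simp: set_sign_def)
  next
    case False
    have in_circles: "merge ?s (circle_of D1 (fst S) c) \<in> circles D ?s"
      using assms(1) by (simp add: merge_in_circles)
    have not_G: "merge ?s (circle_of D1 (fst S) c) \<noteq> G ?s" 
      using F_facts(4)[of ?s] merge_Int_circle[of "circle_of D1 (fst S) c" "fst S" ?s] circle_nonempty[of "circle_of D1 (fst S) c"] assms(1)
      by (metis circle_of_in_circles)
    show ?thesis
    proof (cases "C = G ?s \<and> G ?s \<noteq> {}")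
      case True
      then show ?thesis
        using not_G snd_extend_G[of S a b t] snd_extend_G[of "set_sign D1 c r S" a b t] by simp
    next
      case C: False
      with False have "C \<notin> circles D ?s"
        using circle_nonempty by blast
      with in_circles show ?thesis
        using snd_extend_not_merge[of C S a b t] snd_extend_not_merge[of C "set_sign D1 c r S" a b t] by auto
    qed
  qed
  then show ?thesis
    by (auto simp: prod_eq_iff set_sign_def assms(2) fun_eq_iff)
qed

lemma set_sign_extend_old:
  "c \<in> arcs D1 \<Longrightarrow> set_sign D c r (extend a b t S) = extend a b t (set_sign D1 c r S)"
  by (rule set_sign_extend_merge) (simp_all add: circle_of_old)

lemma set_sign_extend_F:
  "c \<in> F ((fst S)(p := a, q := b)) \<Longrightarrow> set_sign D c r (extend a b t S) = extend a b t (set_sign D1 e r S)"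
  by (rule set_sign_extend_merge) (simp_all add: circle_of_new e_arc)

lemma set_sign_extend_G:
  assumes "c \<in> G ((fst S)(p := a, q := b))"
  shows "set_sign D c r (extend a b t S) = extend a b r S"
proof -
  let ?s = "(fst S)(p := a, q := b)"
  have "((snd (extend a b t S))(G ?s := r)) C = snd (extend a b r S) C" for C
  proof (cases "C \<in> circles D ?s \<and> C \<noteq> G ?s")
    case True
    then obtain C1 where C1: "C1 \<in> circles D1 (fst S)" "C = merge ?s C1"
      by (auto simp: circles_eq split: if_splits)
    with True show ?thesis by simp
  next
    case False
    have G: "G ?s \<noteq> {}" using assms by auto
    show ?thesis
    proof (cases "C = G ?s")
      case True
      with G show ?thesis using snd_extend_G[of S a b r] by simp
    next
      case C: False
      with False have "C \<notin> circles D ?s" by blast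
      with C show ?thesis
        using snd_extend_not_merge[of C S a b t] snd_extend_not_merge[of C S a b r] by simp
    qed
  qed
  then show ?thesis
    using assms by (auto simp: prod_eq_iff set_sign_def circle_of_new fun_eq_iff)
qed

section \<open>Adjacency in a Hopf extension\<close>

text \<open>The free circle avoids \<open>arcs D1\<close>, hence touches no old crossing and keeps
  its sign. Gluing \<open>F\<close> to the circle through \<open>e\<close> does not change which
  circles touch \<open>v\<close>, so everything else happens as in \<open>D1\<close>.\<close>

lemma adjacent_extend_old:
  assumes v: "v \<in> crossings D1" and S: "S \<in> enhanced_states D1"
    and ab: "a \<in> {1, -1}" "b \<in> {1, -1}" "t \<in> {1, -1}"
  shows "{S'. adjacent D v (extend a b t S) S'} = extend a b t ` {S'. adjacent D1 v S S'}"
proof (intro equalityI subsetI)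
  have vpq: "v \<noteq> p" "v \<noteq> q" using v distinct_crossings by auto
  let ?s = "(fst S)(p := a, q := b)"
  fix T assume "T \<in> {S'. adjacent D v (extend a b t S) S'}"
  then have T: "T \<in> enhanced_states D" "fst S v = 1" "fst T = ((fst S)(v := -1))(p := a, q := b)"
    "tau D T = tau D (extend a b t S) + 1"
    "\<And>C. C \<in> circles D ?s \<Longrightarrow> \<not> touches D C v \<Longrightarrow> snd (extend a b t S) C = snd T C"
    using vpq by (auto simp: adjacent_def fun_upd_twist)
  from enhanced_state_cases[OF T(1)] obtain S' a' b' t' where
    S': "S' \<in> enhanced_states D1" "a' \<in> {1, -1}" "b' \<in> {1, -1}" "t' \<in> {1, -1}" "T = extend a' b' t' S'"
    by metis
  have ab': "a' = a" "b' = b"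
    using T(3) S'(5) upd_eqD(1,2)[of "fst S'" a' b' "(fst S)(v := -1)" a b] by simp_all
  have fst': "fst S' = (fst S)(v := -1)"
  proof (rule PiE_ext)
    show "fst S' \<in> crossings D1 \<rightarrow>\<^sub>E {1, -1}" "(fst S)(v := -1) \<in> crossings D1 \<rightarrow>\<^sub>E {1, -1}"
      using S S' v by (cases S; cases S'; auto simp: enhanced_states_iff PiE_iff extensional_def)+
    fix c assume "c \<in> crossings D1"
    then show "fst S' c = ((fst S)(v := -1)) c"
      using T(3) S'(5) upd_eqD(3)[of "fst S'" a' b' "(fst S)(v := -1)" a b c] by simp
  qed
  have eqT: "T = extend a b t S'"
  proof (cases "a = b")
    case True
    then have nG: "G ?s \<noteq> {}" "G (fst T) \<noteq> {}"
      using ab by (auto simp: T(3) G_upd_empty_iff)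
    have G: "G (fst T) = G ?s"
      using distinct_crossings by (simp add: T(3) G_def F_def)
    have "\<not> touches D (G ?s) v"
      using touches_old[OF G_in_circles[OF nG(1)] v] by (simp add: F_facts(4) touches_def)
    then have "snd (extend a b t S) (G ?s) = snd T (G ?s)"
      using T(5) G_in_circles[OF nG(1)] by blast
    then have "t = t'"
      using snd_extend_G[OF nG(1)] snd_extend_G[of S' a' b' t'] nG(2) S'(5) G by simp
    with S' ab' show ?thesis by simp
  next
    case False
    with S' ab' ab show ?thesis using extend_mixed by metis
  qed
  have "adjacent D1 v S S'"
    unfolding adjacent_def
  proof (intro conjI ballI impI)
    show "tau D1 S' = tau D1 S + 1"
      using T(4) ab by (simp add: eqT tau_extend)
    fix C assume C: "C \<in> circles D1 (fst S)" "\<not> touches D1 C v"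
    have m: "merge ?s C = merge (fst T) C"
      using distinct_crossings by (simp add: T(3) merge_def F_def)
    have "snd S C = snd (extend a b t S) (merge ?s C)" using C by simp
    also have "\<dots> = snd T (merge ?s C)"
      using C touches_old[OF merge_in_circles[OF C(1)] v] by (intro T(5) merge_in_circles) (auto simp: merge_Int_circle)
    also have "\<dots> = snd S' C"
      using snd_extend_merge[of C S' a b t] circle_not_touching_persists[OF C, of "-1"] m
      by (simp add: eqT fst')
    finally show "snd S C = snd S' C" .
  qed (use S S' v T(2) fst' in auto)
  with eqT show "T \<in> extend a b t ` {S'. adjacent D1 v S S'}" by blast
next
  have vpq: "v \<noteq> p" "v \<noteq> q" using v distinct_crossings by auto
  let ?s = "(fst S)(p := a, q := b)"
  fix T assume "T \<in> extend a b t ` {S'. adjacent D1 v S S'}"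
  then obtain S' where T: "T = extend a b t S'" and S': "S' \<in> enhanced_states D1" "fst S v = 1"
    "fst S' = (fst S)(v := -1)" "tau D1 S' = tau D1 S + 1"
    "\<And>C. C \<in> circles D1 (fst S) \<Longrightarrow> \<not> touches D1 C v \<Longrightarrow> snd S C = snd S' C"
    by (auto simp: adjacent_def)
  have fst: "fst T = ?s(v := -1)" using vpq by (simp add: T S'(3) fun_upd_twist)
  have "snd (extend a b t S) C = snd T C" if C: "C \<in> circles D ?s" "\<not> touches D C v" for C
  proof (cases "C = G ?s")
    case True
    have "G (fst T) = G ?s"
      using distinct_crossings by (simp add: T S'(3) G_def F_def)
    moreover have "G ?s \<noteq> {}" using circle_nonempty[OF C(1)] True by simp
    ultimately show ?thesis
      using True snd_extend_G[of S a b t] snd_extend_G[of S' a b t] by (simp add: T)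
  next
    case False
    with C obtain C1 where C1: "C1 \<in> circles D1 (fst S)" "C = merge ?s C1"
      by (auto simp: circles_eq split: if_splits)
    have m: "C = merge (fst T) C1"
      using distinct_crossings by (simp add: C1 T S'(3) merge_def F_def)
    have nt: "\<not> touches D1 C1 v"
      using C touches_old[OF C(1) v] C1 by (simp add: merge_Int_circle)
    have "snd (extend a b t S) C = snd S C1" using C1 by simp
    also have "\<dots> = snd S' C1" using S'(5) C1 nt by blast
    also have "\<dots> = snd T C"
      using snd_extend_merge[of C1 S' a b t] circle_not_touching_persists[OF C1(1) nt, of "-1"] m
      by (simp add: T S'(3))
    finally show ?thesis .
  qed
  then show "T \<in> {S'. adjacent D v (extend a b t S) S'}"
    using S S' v ab vpq fst extend_in_enhanced_states[OF S ab] extend_in_enhanced_states[OF S'(1) ab]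
    by (simp add: adjacent_def crossings_eq T tau_extend)
qed

text \<open>Only the circle through \<open>e\<close> and the free circle touch \<open>p\<close> and
  \<open>q\<close>. The target is thus determined by their signs \<open>r\<close> and
  \<open>t'\<close>, and the rise of tau by 1 is the only condition left. The same equation governs
  multiplication and comultiplication.\<close>

lemma adjacent_extend_new:
  assumes S: "S \<in> enhanced_states D1"
    and ab: "a \<in> {1, -1}" "b \<in> {1, -1}" "t \<in> {1, -1}"
    and ab': "a' \<in> {1, -1}" "b' \<in> {1, -1}"
    and v: "v = p \<and> a = 1 \<and> a' = -1 \<and> b' = b \<or> v = q \<and> b = 1 \<and> b' = -1 \<and> a' = a"
  shows "adjacent D v (extend a b t S) T \<longleftrightarrow>
    (\<exists>r\<in>{1, -1}. \<exists>t'\<in>{1, -1}. T = extend a' b' t' (set_sign D1 e r S) \<and>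
       r + (if a' = b' then t' else 0) = sign_at D1 e S + (if a = b then t else 0) + 1)"
proof
  let ?s = "(fst S)(p := a, q := b)" and ?s' = "(fst S)(p := a', q := b')"
  have s': "?s(v := -1) = ?s'" and vv: "?s v = 1"
    using v distinct_crossings by (auto simp: fun_upd_twist)
  have vpq: "v \<in> {p, q}" using v by blast
  {
    fix C assume C: "C \<in> circles D1 (fst S)" "e \<notin> C"
    then have "merge ?s C = C" "merge ?s' C = C" by (auto simp: merge_def)
    moreover from this have Cs: "C \<in> circles D ?s" using merge_in_circles C(1) by metis
    moreover have "C \<inter> {w, x, y, z} = {}"
      using C circle_subset_arcs1[OF C(1)] arcs_Int by auto
    ultimately have "merge ?s C = C" "merge ?s' C = C" "C \<in> circles D ?s" "\<not> touches D C v"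
      using touches_new[OF Cs vpq] by auto
  } note old = this
  {
    assume "adjacent D v (extend a b t S) T"
    then have T: "T \<in> enhanced_states D" "fst T = ?s'"
      "tau D T = tau D (extend a b t S) + 1"
      "\<And>C. C \<in> circles D ?s \<Longrightarrow> \<not> touches D C v \<Longrightarrow> snd (extend a b t S) C = snd T C"
      using s' by (auto simp: adjacent_def)
    from enhanced_state_cases[OF T(1)] obtain S' a'' b'' t' where
      S': "S' \<in> enhanced_states D1" "a'' \<in> {1, -1}" "b'' \<in> {1, -1}" "t' \<in> {1, -1}" "T = extend a'' b'' t' S'"
      by metis
    have eq: "a'' = a'" "b'' = b'"
      using T(2) S'(5) upd_eqD(1,2)[of "fst S'" a'' b'' "fst S" a' b'] by simp_all
    have fst': "fst S' = fst S"
    proof (rule PiE_ext)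
      show "fst S' \<in> crossings D1 \<rightarrow>\<^sub>E {1, -1}" "fst S \<in> crossings D1 \<rightarrow>\<^sub>E {1, -1}"
        using S S' by (cases S; cases S'; auto simp: enhanced_states_iff)+
      fix c assume "c \<in> crossings D1"
      then show "fst S' c = fst S c"
        using T(2) S'(5) upd_eqD(3)[of "fst S'" a'' b'' "fst S" a' b' c] by simp
    qed
    let ?r = "sign_at D1 e S'"
    \<comment> \<open>A circle of \<open>D1\<close> that avoids \<open>e\<close> is unchanged by the
      gluing and touches neither \<open>p\<close> nor \<open>q\<close>, so its sign
      persists.\<close>
    have "snd S' = (snd S)(circle_of D1 (fst S) e := ?r)"
    proof (rule PiE_ext)
      show "snd S' \<in> circles D1 (fst S) \<rightarrow>\<^sub>E {1, -1}"
        using S'(1) by (cases S') (auto simp: enhanced_states_iff fst'[symmetric])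
      show "(snd S)(circle_of D1 (fst S) e := ?r) \<in> circles D1 (fst S) \<rightarrow>\<^sub>E {1, -1}"
        using set_sign_in_enhanced_states[OF S e_arc sign_at_in[OF S'(1) e_arc]]
        by (simp add: set_sign_def enhanced_states_iff)
      fix C assume C: "C \<in> circles D1 (fst S)"
      show "snd S' C = ((snd S)(circle_of D1 (fst S) e := ?r)) C"
      proof (cases "e \<in> C")
        case True
        then show ?thesis using circle_eq_circle_of[OF C] by (simp add: sign_at_def fst')
      next
        case False
        note o = old[OF C False]
        then have "snd S C = snd S' C"
          using T(4)[OF o(3,4)] snd_extend_merge[OF C, of a b t] snd_extend_merge[of C S' a' b' t'] C
          by (simp add: S'(5) eq fst')
        then show ?thesis using False by auto
      qed
    qed
    then have S'_eq: "S' = set_sign D1 e ?r S"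
      using fst' by (simp add: set_sign_def prod_eq_iff)
    moreover have "tau D1 S' = tau D1 S - sign_at D1 e S + ?r"
      using tau_set_sign[OF finite_arcs1 e_arc, of ?r S] S'_eq by simp
    then have "?r + (if a' = b' then t' else 0) = sign_at D1 e S + (if a = b then t else 0) + 1"
      using T(3) ab ab' by (simp add: S'(5) eq tau_extend)
    ultimately show "\<exists>r\<in>{1, -1}. \<exists>t'\<in>{1, -1}. T = extend a' b' t' (set_sign D1 e r S) \<and>
       r + (if a' = b' then t' else 0) = sign_at D1 e S + (if a = b then t else 0) + 1"
      using sign_at_in[OF S'(1) e_arc] S' eq by metis
  }
  {
    assume "\<exists>r\<in>{1, -1}. \<exists>t'\<in>{1, -1}. T = extend a' b' t' (set_sign D1 e r S) \<and>
       r + (if a' = b' then t' else 0) = sign_at D1 e S + (if a = b then t else 0) + 1"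
    then obtain r t' where r: "r \<in> {1, -1}" "t' \<in> {1, -1}" "T = extend a' b' t' (set_sign D1 e r S)"
       "r + (if a' = b' then t' else 0) = sign_at D1 e S + (if a = b then t else 0) + 1" by blast
    have TE: "T \<in> enhanced_states D"
      using r S ab' set_sign_in_enhanced_states[OF S e_arc r(1)] by (simp add: extend_in_enhanced_states)
    have tau: "tau D T = tau D (extend a b t S) + 1"
      using r(4) ab ab' by (simp add: r(3) tau_extend tau_set_sign[OF finite_arcs1 e_arc])
    have "snd (extend a b t S) C = snd T C" if C: "C \<in> circles D ?s" "\<not> touches D C v" for C
    proof -
      have "C \<inter> {w, x, y, z} = {}"
        using C touches_new[OF C(1) vpq] by blast
      moreover have "G ?s \<inter> {w, x, y, z} = G ?s" "F ?s \<inter> {w, x, y, z} = F ?s" "f \<in> F ?s"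
        using F_facts[of ?s] by auto
      moreover have "C \<noteq> {}" using circle_nonempty[OF C(1)] by simp
      ultimately have "C \<noteq> G ?s" by auto
      then obtain C1 where C1: "C1 \<in> circles D1 (fst S)" "C = merge ?s C1"
        using C by (auto simp: circles_eq split: if_splits)
      have "e \<notin> C1"
        using C1 \<open>C \<inter> {w, x, y, z} = {}\<close> \<open>f \<in> F ?s\<close> f_arc by (auto simp: merge_def)
      note o = old[OF C1(1) this]
      have "circle_of D1 (fst S) e \<noteq> C1" using \<open>e \<notin> C1\<close> self_mem_circle_of by metis
      then have "snd (set_sign D1 e r S) C1 = snd S C1" by (auto simp: set_sign_def)
      then show ?thesis
        using snd_extend_merge[OF C1(1), of a b t] snd_extend_merge[of C1 "set_sign D1 e r S" a' b' t'] C1 o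
        by (simp add: r(3))
    qed
    then show "adjacent D v (extend a b t S) T"
      using TE tau extend_in_enhanced_states[OF S ab] vpq s' vv
      by (simp add: adjacent_def crossings_eq) (auto simp: r(3))
  }
qed

end

section \<open>The differential and multiplication by x\<close>

text \<open>Additivity is stated for differences because the induction principle for free abelian
  groups closes the generators under differences.\<close>

lemma frag_additive_eqI:
  fixes f g :: "('a \<Rightarrow>\<^sub>0 int) \<Rightarrow> 'b::ab_group_add"
  assumes f: "\<And>x y. f (x - y) = f x - f y" and g: "\<And>x y. g (x - y) = g x - g y"
    and eq: "\<And>S. S \<in> E \<Longrightarrow> f (frag_of S) = g (frag_of S)"
    and c: "Poly_Mapping.keys c \<subseteq> E"
  shows "f c = g c"
  using c
proof (rule free_Abelian_group_induct)
  show "f 0 = g 0" using f[of 0 0] g[of 0 0] by simp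
qed (simp_all add: f g eq)

lemma keys_frag_extend_subset:
  assumes "\<And>S. S \<in> Poly_Mapping.keys c \<Longrightarrow> Poly_Mapping.keys (f S) \<subseteq> E"
  shows "Poly_Mapping.keys (frag_extend f c) \<subseteq> E"
  using keys_frag_extend[of f c] assms by blast

definition adjacency_sign :: "diagram \<Rightarrow> nat \<Rightarrow> enhanced_state \<Rightarrow> int" where
  "adjacency_sign D v S = (-1) ^ card {c \<in> crossings D. fst S c = -1 \<and> v < c}"

definition boundary_at :: "diagram \<Rightarrow> nat \<Rightarrow> enhanced_state \<Rightarrow> (enhanced_state \<Rightarrow>\<^sub>0 int)" where
  "boundary_at D v S = (\<Sum>S' | adjacent D v S S'. frag_of S')"

text \<open>The differential in all degrees at once: \<open>adjacent\<close> already controls the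
  change of degree, so compositions and commutation with \<open>x\<close> can be treated without
  carrying \<open>i\<close> and \<open>j\<close>.\<close>

definition boundary :: "diagram \<Rightarrow> (enhanced_state \<Rightarrow>\<^sub>0 int) \<Rightarrow> (enhanced_state \<Rightarrow>\<^sub>0 int)" where
  "boundary D = frag_extend (\<lambda>S. \<Sum>v\<in>crossings D. frag_cmul (adjacency_sign D v S) (boundary_at D v S))"

lemma finite_enhanced_states:
  assumes "finite (crossings D)" "finite (arcs D)"
  shows "finite (enhanced_states D)"
  unfolding enhanced_states_def kauffman_states_def using assms
  by (intro finite_SigmaI finite_PiE) (auto simp: circles_eq_image)

lemma finite_adjacent:
  assumes "finite (crossings D)" "finite (arcs D)"
  shows "finite {S'. adjacent D v S S'}"
  using finite_enhanced_states[OF assms] by (rule rev_finite_subset) (auto simp: adjacent_def)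

lemma sigma_fun_upd:
  fixes s :: "nat \<Rightarrow> int"
  assumes "finite (crossings D)" "v \<in> crossings D"
  shows "(\<Sum>c\<in>crossings D. (s(v := m)) c) = (\<Sum>c\<in>crossings D. s c) - s v + m"
proof -
  have "(\<Sum>c\<in>crossings D - {v}. (s(v := m)) c) = (\<Sum>c\<in>crossings D - {v}. s c)"
    by (intro sum.cong) auto
  then show ?thesis
    using sum.remove[OF assms, of s] sum.remove[OF assms, of "s(v := m)"] by simp
qed

lemma adjacent_generators:
  assumes "finite (crossings D)" "S \<in> generators D i j" "adjacent D v S S'"
  shows "S' \<in> generators D (i - 2) j"
  using assms sigma_fun_upd[of D v "fst S" "-1"] by (auto simp: generators_def adjacent_def sigma_def)

text \<open>The degrees do the work: if sigma drops by 2 through a change of one marker, the marker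
  went from 1 to -1, and the common \<open>j\<close> then makes tau rise by 1.\<close>

lemma adjacent_iff_differ:
  assumes fin: "finite (crossings D)" and S: "S \<in> generators D i j" and S': "S' \<in> generators D (i - 2) j"
  shows "adjacent D v S S' \<longleftrightarrow> differ_exactly_at D S S' v \<and>
    (\<forall>C\<in>circles D (fst S). \<not> touches D C v \<longrightarrow> snd S C = snd S' C)"
proof -
  have E: "S \<in> enhanced_states D" "S' \<in> enhanced_states D"
    using S S' by (auto simp: generators_def)
  note s = enhanced_stateD(1)[OF E(1)] and s' = enhanced_stateD(1)[OF E(2)]
  have "v \<in> crossings D \<and> fst S v = 1 \<and> fst S' = (fst S)(v := -1) \<and> tau D S' = tau D S + 1
      \<longleftrightarrow> differ_exactly_at D S S' v"
  proof
    assume "v \<in> crossings D \<and> fst S v = 1 \<and> fst S' = (fst S)(v := -1) \<and> tau D S' = tau D S + 1"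
    then show "differ_exactly_at D S S' v"
      by (auto simp: differ_exactly_at_def)
  next
    assume d: "differ_exactly_at D S S' v"
    then have v: "v \<in> crossings D" "fst S v \<noteq> fst S' v"
      and same: "\<And>c. c \<in> crossings D \<Longrightarrow> c \<noteq> v \<Longrightarrow> fst S c = fst S' c"
      by (auto simp: differ_exactly_at_def)
    have fst: "fst S' = (fst S)(v := fst S' v)"
    proof
      fix c show "fst S' c = ((fst S)(v := fst S' v)) c"
        using same[of c] PiE_arb[OF s, of c] PiE_arb[OF s', of c] by (cases "c \<in> crossings D") auto
    qed
    have "sigma D S' = sigma D S - fst S v + fst S' v"
      using sigma_fun_upd[OF fin v(1), of "fst S" "fst S' v"] by (simp add: sigma_def flip: fst)
    then have "fst S v - fst S' v = 2" using S S' by (auto simp: generators_def)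
    moreover have "fst S v \<in> {1, -1}" "fst S' v \<in> {1, -1}"
      using PiE_mem[OF s v(1)] PiE_mem[OF s' v(1)] by auto
    ultimately have "fst S v = 1" "fst S' v = -1" by auto
    moreover have "tau D S' = tau D S + 1"
      using S S' by (auto simp: generators_def)
    ultimately show "v \<in> crossings D \<and> fst S v = 1 \<and> fst S' = (fst S)(v := -1) \<and> tau D S' = tau D S + 1"
      using v(1) fst by simp
  qed
  then show ?thesis using E by (simp add: adjacent_def) blast
qed

lemma differential_eq_boundary:
  assumes fin: "finite (crossings D)" "finite (arcs D)" and c: "Poly_Mapping.keys c \<subseteq> generators D i j"
  shows "differential D i j c = boundary D c"
  unfolding differential_def boundary_def
proof (rule frag_extend_eq)
  fix S assume "S \<in> Poly_Mapping.keys c"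
  with c have S: "S \<in> generators D i j" by blast
  have fin_gen: "finite (generators D (i - 2) j)"
    using finite_enhanced_states[OF fin] by (rule rev_finite_subset) (auto simp: generators_def)
  let ?t = "\<lambda>v S'. if adjacent D v S S' then frag_cmul (adjacency_sign D v S) (frag_of S') else 0"
  have coeff: "frag_cmul ((-1) ^ sign_exponent D S S' * incidence D S S') (frag_of S') = (\<Sum>v\<in>crossings D. ?t v S')"
    if S': "S' \<in> generators D (i - 2) j" for S'
  proof (cases "\<exists>v. adjacent D v S S'")
    case True
    then obtain v where v: "adjacent D v S S'" by blast
    then have d: "differ_exactly_at D S S' v"
      by (simp add: adjacent_iff_differ[OF fin(1) S S'])
    then have unique: "differ_exactly_at D S S' u \<longleftrightarrow> u = v" for u
      by (auto simp: differ_exactly_at_def)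
    have "(\<Sum>v\<in>crossings D. ?t v S') = (\<Sum>u\<in>crossings D. if u = v then frag_cmul (adjacency_sign D v S) (frag_of S') else 0)"
      using v unique by (intro sum.cong refl) (auto simp: adjacent_iff_differ[OF fin(1) S S'])
    also have "\<dots> = frag_cmul (adjacency_sign D v S) (frag_of S')"
      using v fin by (simp add: adjacent_def)
    moreover have "(THE v. differ_exactly_at D S S' v) = v"
      using unique by simp
    moreover have "incidence D S S' = 1"
      using v by (auto simp: incidence_def adjacent_iff_differ[OF fin(1) S S'])
    ultimately show ?thesis
      by (simp add: sign_exponent_def adjacency_sign_def)
  next
    \<comment> \<open>The description \<open>THE v\<close> may denote anything here, but the sign it
      enters is multiplied by incidence 0.\<close>
    case False
    then have "incidence D S S' = 0"
      by (auto simp: incidence_def adjacent_iff_differ[OF fin(1) S S'])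
    with False show ?thesis by simp
  qed
  have "(\<Sum>S'\<in>generators D (i - 2) j.
       frag_cmul ((-1) ^ sign_exponent D S S' * incidence D S S') (frag_of S')) =
      (\<Sum>S'\<in>generators D (i - 2) j. \<Sum>v\<in>crossings D. ?t v S')"
    using coeff by (rule sum.cong[OF refl])
  also have "\<dots> = (\<Sum>v\<in>crossings D. \<Sum>S'\<in>generators D (i - 2) j. ?t v S')"
    by (rule sum.swap)
  also have "\<dots> = (\<Sum>v\<in>crossings D. frag_cmul (adjacency_sign D v S) (boundary_at D v S))"
  proof (rule sum.cong[OF refl])
    fix v
    have "{S' \<in> generators D (i - 2) j. adjacent D v S S'} = {S'. adjacent D v S S'}"
      using adjacent_generators[OF fin(1) S] by blast
    then show "(\<Sum>S'\<in>generators D (i - 2) j. ?t v S') = frag_cmul (adjacency_sign D v S) (boundary_at D v S)"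
      using sum.inter_filter[OF fin_gen, of "\<lambda>S'. frag_cmul (adjacency_sign D v S) (frag_of S')" "adjacent D v S"]
      by (simp add: boundary_at_def frag_cmul_sum)
  qed
  finally show "(\<Sum>S'\<in>generators D (i - 2) j.
       frag_cmul ((-1) ^ sign_exponent D S S' * incidence D S S') (frag_of S')) =
      (\<Sum>v\<in>crossings D. frag_cmul (adjacency_sign D v S) (boundary_at D v S))" .
qed

lemma boundary_diff: "boundary D (x - y) = boundary D x - boundary D y"
  and boundary_add: "boundary D (x + y) = boundary D x + boundary D y"
  and boundary_minus: "boundary D (- x) = - boundary D x"
  and boundary_zero [simp]: "boundary D 0 = 0"
  by (simp_all add: boundary_def frag_extend_diff frag_extend_add frag_extend_minus)

lemma keys_boundary:
  assumes "finite (crossings D)" "Poly_Mapping.keys c \<subseteq> generators D i j"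
  shows "Poly_Mapping.keys (boundary D c) \<subseteq> generators D (i - 2) j"
  unfolding boundary_def
proof (rule keys_frag_extend_subset)
  fix S assume "S \<in> Poly_Mapping.keys c"
  then have S: "S \<in> generators D i j" using assms by blast
  have "Poly_Mapping.keys (boundary_at D v S) \<subseteq> generators D (i - 2) j" for v
    unfolding boundary_at_def
    using adjacent_generators[OF assms(1) S] by (intro order_trans[OF keys_sum]) auto
  then show "Poly_Mapping.keys (\<Sum>v\<in>crossings D. frag_cmul (adjacency_sign D v S) (boundary_at D v S)) \<subseteq> generators D (i - 2) j"
    by (rule keys_sum_frag_cmul)
qed

lemma keys_boundary_enhanced:
  assumes "Poly_Mapping.keys c \<subseteq> enhanced_states D"
  shows "Poly_Mapping.keys (boundary D c) \<subseteq> enhanced_states D"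
  unfolding boundary_def
proof (rule keys_frag_extend_subset)
  fix S
  have "Poly_Mapping.keys (boundary_at D v S) \<subseteq> enhanced_states D" for v
    unfolding boundary_at_def
    by (intro order_trans[OF keys_sum]) (auto simp: adjacent_def)
  then show "Poly_Mapping.keys (\<Sum>v\<in>crossings D. frag_cmul (adjacency_sign D v S) (boundary_at D v S)) \<subseteq> enhanced_states D"
    by (rule keys_sum_frag_cmul)
qed

text \<open>
  Multiplication by \<open>x\<close> at the circle through the arc \<open>a\<close>, where circles are labelled by
  \<open>\<int>[x]/x\<^sup>2\<close> with basis \<open>1 = -\<close> and \<open>x = +\<close>.
\<close>

definition x_mult :: "diagram \<Rightarrow> nat \<Rightarrow> (enhanced_state \<Rightarrow>\<^sub>0 int) \<Rightarrow> (enhanced_state \<Rightarrow>\<^sub>0 int)" where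
  "x_mult D a = frag_extend (\<lambda>S. if sign_at D a S = -1 then frag_of (set_sign D a 1 S) else 0)"

lemma x_mult_diff: "x_mult D a (x - y) = x_mult D a x - x_mult D a y"
  and x_mult_add: "x_mult D a (x + y) = x_mult D a x + x_mult D a y"
  and x_mult_minus: "x_mult D a (- x) = - x_mult D a x"
  and x_mult_zero [simp]: "x_mult D a 0 = 0"
  by (simp_all add: x_mult_def frag_extend_diff frag_extend_add frag_extend_minus)

lemma x_mult_frag_of:
  "x_mult D a (frag_of S) = (if sign_at D a S = -1 then frag_of (set_sign D a 1 S) else 0)"
  by (simp add: x_mult_def)

lemma sign_at_set_sign:
  "sign_at D a (set_sign D b r S) = (if circle_of D (fst S) a = circle_of D (fst S) b then r else sign_at D a S)"
  by (simp add: sign_at_def set_sign_def)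

lemma x_mult_square: "x_mult D a (x_mult D a c) = 0"
  by (rule frag_additive_eqI[where f = "\<lambda>c. x_mult D a (x_mult D a c)" and g = "\<lambda>_. 0" and E = UNIV])
    (simp_all add: x_mult_diff x_mult_frag_of sign_at_set_sign)

lemma x_mult_commute: "x_mult D a (x_mult D b c) = x_mult D b (x_mult D a c)"
proof (rule frag_additive_eqI[where f = "\<lambda>c. x_mult D a (x_mult D b c)" and g = "\<lambda>c. x_mult D b (x_mult D a c)" and E = UNIV])
  fix S
  have "set_sign D a 1 (set_sign D b 1 S) = set_sign D b 1 (set_sign D a 1 S)"
    by (auto simp: set_sign_def fun_upd_twist)
  then show "x_mult D a (x_mult D b (frag_of S)) = x_mult D b (x_mult D a (frag_of S))"
    by (simp add: x_mult_frag_of sign_at_set_sign)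
qed (simp_all add: x_mult_diff)

text \<open>Raising one sign from -1 to 1 adds 2 to tau and hence 4 to \<open>j\<close>.\<close>

lemma keys_x_mult:
  assumes "finite (arcs D)" "a \<in> arcs D" "Poly_Mapping.keys c \<subseteq> generators D i j"
  shows "Poly_Mapping.keys (x_mult D a c) \<subseteq> generators D i (j + 4)"
  unfolding x_mult_def
proof (rule keys_frag_extend_subset)
  fix S assume "S \<in> Poly_Mapping.keys c"
  then have S: "S \<in> generators D i j" using assms by blast
  then have "sign_at D a S = -1 \<Longrightarrow> set_sign D a 1 S \<in> generators D i (j + 4)"
    using assms set_sign_in_enhanced_states[of S D a 1] tau_set_sign[of D a 1 S]
    by (auto simp: generators_def sigma_def)
  then show "Poly_Mapping.keys (if sign_at D a S = -1 then frag_of (set_sign D a 1 S) else 0) \<subseteq> generators D i (j + 4)"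
    by simp
qed

lemma keys_x_mult_enhanced:
  assumes "a \<in> arcs D" "Poly_Mapping.keys c \<subseteq> enhanced_states D"
  shows "Poly_Mapping.keys (x_mult D a c) \<subseteq> enhanced_states D"
  unfolding x_mult_def
proof (rule keys_frag_extend_subset)
  fix S assume "S \<in> Poly_Mapping.keys c"
  then have "S \<in> enhanced_states D" using assms by blast
  then show "Poly_Mapping.keys (if sign_at D a S = -1 then frag_of (set_sign D a 1 S) else 0) \<subseteq> enhanced_states D"
    using assms set_sign_in_enhanced_states[of S D a 1] by simp
qed

section \<open>The differential of a Hopf extension\<close>

lemma set_sign_sign_at: "set_sign D c (sign_at D c S) S = S"
  by (simp add: set_sign_def sign_at_def)

lemma x_mult_cmul: "x_mult D a (frag_cmul k c) = frag_cmul k (x_mult D a c)"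
  by (simp add: x_mult_def frag_extend_cmul)

lemma frag_cmul_diff_distrib2: "frag_cmul k (c - c') = frag_cmul k c - frag_cmul k c'"
  by (simp add: poly_mapping_eqI lookup_minus right_diff_distrib)

text \<open>The marker at \<open>v\<close> has become negative, and it is counted for a change at
  \<open>r\<close> exactly when \<open>r < v\<close>. All anticommutation of the square comes from
  this.\<close>

lemma adjacency_sign_adjacent:
  assumes "finite (crossings D)" "adjacent D v S S'"
  shows "adjacency_sign D r S' = adjacency_sign D r S * (if r < v then -1 else 1)"
proof -
  have v: "v \<in> crossings D" "fst S v = 1" "fst S' = (fst S)(v := -1)"
    using assms(2) by (auto simp: adjacent_def)
  have "{c \<in> crossings D. fst S' c = -1 \<and> r < c} =
      (if r < v then insert v {c \<in> crossings D. fst S c = -1 \<and> r < c} else {c \<in> crossings D. fst S c = -1 \<and> r < c})"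
    using v by auto
  moreover have "card (insert v {c \<in> crossings D. fst S c = -1 \<and> r < c}) =
      Suc (card {c \<in> crossings D. fst S c = -1 \<and> r < c})"
    using v(2) assms(1) by (intro card_insert_disjoint) auto
  ultimately show ?thesis
    by (simp add: adjacency_sign_def)
qed

lemma adjacency_sign_square: "adjacency_sign D r S * adjacency_sign D r S = 1"
  by (simp add: adjacency_sign_def flip: power_add)

context hopf_extension
begin

lemma adjacency_sign_extend:
  "adjacency_sign D v (extend a b t S) =
    adjacency_sign D1 v S * (if a = -1 \<and> v < p then -1 else 1) * (if b = -1 \<and> v < q then -1 else 1)"
proof -
  let ?A = "{c \<in> crossings D1. fst S c = -1 \<and> v < c}"
  let ?P = "if a = -1 \<and> v < p then {p} else {}" and ?Q = "if b = -1 \<and> v < q then {q} else {}"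
  have eq: "{c \<in> crossings D. fst (extend a b t S) c = -1 \<and> v < c} = ?A \<union> (?P \<union> ?Q)"
    using distinct_crossings by (auto simp: crossings_eq)
  have "card (?A \<union> (?P \<union> ?Q)) = card ?A + card (?P \<union> ?Q)"
    using finite_crossings1 distinct_crossings by (intro card_Un_disjoint) auto
  also have "card (?P \<union> ?Q) = card ?P + card ?Q"
    using distinct_crossings by (intro card_Un_disjoint) auto
  finally show ?thesis
    unfolding adjacency_sign_def eq by (simp add: power_add)
qed

text \<open>
  The sign that reorders the negative markers so that those of \<open>D1\<close> come before \<open>p\<close> and \<open>q\<close>.
\<close>

definition twist :: "int \<Rightarrow> int \<Rightarrow> enhanced_state \<Rightarrow> int" where
  "twist a b S = (if a = -1 then adjacency_sign D1 p S else 1) * (if b = -1 then adjacency_sign D1 q S else 1)"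

lemma twist_square: "twist a b S * twist a b S = 1"
  using adjacency_sign_square[of D1 p S] adjacency_sign_square[of D1 q S]
  by (simp add: twist_def algebra_simps)

text \<open>The embedding of \<open>C(D\<^sub>1)\<close> as one block of the corner
  \<open>(a, b)\<close>, corrected by \<open>twist\<close> so that the part of \<open>d\<close> at
  the old crossings does not depend on where \<open>p\<close> and \<open>q\<close> stand in the
  ordering.\<close>

definition J :: "int \<Rightarrow> int \<Rightarrow> int \<Rightarrow> (enhanced_state \<Rightarrow>\<^sub>0 int) \<Rightarrow> (enhanced_state \<Rightarrow>\<^sub>0 int)" where
  "J a b t = frag_extend (\<lambda>S. frag_cmul (twist a b S) (frag_of (extend a b t S)))"

lemma J_diff: "J a b t (c - c') = J a b t c - J a b t c'"
  and J_add: "J a b t (c + c') = J a b t c + J a b t c'"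
  and J_minus: "J a b t (- c) = - J a b t c"
  and J_zero [simp]: "J a b t 0 = 0"
  and J_cmul: "J a b t (frag_cmul k c) = frag_cmul k (J a b t c)"
  and J_sum: "finite I \<Longrightarrow> J a b t (sum h I) = (\<Sum>i\<in>I. J a b t (h i))"
  by (simp_all add: J_def frag_extend_diff frag_extend_add frag_extend_minus frag_extend_cmul frag_extend_sum comp_def)

lemma J_frag_of: "J a b t (frag_of S) = frag_cmul (twist a b S) (frag_of (extend a b t S))"
  by (simp add: J_def)

text \<open>A negative marker at \<open>p\<close> contributes one factor -1 in either case: if
  \<open>p < v\<close>, through the change of \<open>twist\<close>; if \<open>v < p\<close>, through
  the sign of \<open>d\<close> at \<open>v\<close>. The same holds for \<open>q\<close>, which gives
  \<open>a * b\<close> in total.\<close>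

lemma boundary_old_crossings:
  assumes S: "S \<in> enhanced_states D1" and ab: "a \<in> {1, -1}" "b \<in> {1, -1}" "t \<in> {1, -1}"
  shows "(\<Sum>v\<in>crossings D1. frag_cmul (twist a b S * adjacency_sign D v (extend a b t S)) (boundary_at D v (extend a b t S)))
    = frag_cmul (a * b) (J a b t (boundary D1 (frag_of S)))"
proof -
  have "frag_cmul (twist a b S * adjacency_sign D v (extend a b t S)) (boundary_at D v (extend a b t S))
      = frag_cmul (a * b) (J a b t (frag_cmul (adjacency_sign D1 v S) (boundary_at D1 v S)))"
    if v: "v \<in> crossings D1" for v
  proof -
    have vpq: "v \<noteq> p" "v \<noteq> q" using v distinct_crossings by auto
    have inj: "inj_on (extend a b t) {S'. adjacent D1 v S S'}"
      using extend_inj(3) ab by (intro inj_onI) (auto simp: adjacent_def)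
    have fin: "finite {S'. adjacent D1 v S S'}"
      using finite_crossings1 finite_arcs1 by (rule finite_adjacent)
    have sign: "twist a b S * adjacency_sign D v (extend a b t S) = a * b * adjacency_sign D1 v S * twist a b S'"
      if "adjacent D1 v S S'" for S'
    proof -
      have "(if a = -1 then if p < v then -1 else 1 else 1) * (if a = -1 \<and> v < p then -1 else 1) = a"
        "(if b = -1 then if q < v then -1 else 1 else 1) * (if b = -1 \<and> v < q then -1 else 1) = b"
        using ab vpq by auto
      moreover have "twist a b S' = twist a b S * (if a = -1 then if p < v then -1 else 1 else 1) *
          (if b = -1 then if q < v then -1 else 1 else 1)"
        using adjacency_sign_adjacent[OF finite_crossings1 that] by (simp add: twist_def)
      moreover have "(if a = -1 then if p < v then -1 else 1 else 1) * (if a = -1 then if p < v then -1 else 1 else 1) = (1::int)"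
        "(if b = -1 then if q < v then -1 else 1 else 1) * (if b = -1 then if q < v then -1 else 1 else 1) = (1::int)"
        by simp_all
      moreover have "t * (s * A' * B') = A * A' * (B * B') * s * t'"
        if "t' = t * A * B" "A * A = 1" "B * B = 1" for s t t' A A' B B' :: int
        using that by algebra
      ultimately show ?thesis
        unfolding adjacency_sign_extend by metis
    qed
    have "boundary_at D v (extend a b t S) = (\<Sum>S' | adjacent D1 v S S'. frag_of (extend a b t S'))"
      unfolding boundary_at_def adjacent_extend_old[OF v S ab] by (simp add: sum.reindex[OF inj])
    then have "frag_cmul (twist a b S * adjacency_sign D v (extend a b t S)) (boundary_at D v (extend a b t S)) =
        (\<Sum>S' | adjacent D1 v S S'. frag_cmul (a * b * adjacency_sign D1 v S) (frag_cmul (twist a b S') (frag_of (extend a b t S'))))"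
      by (simp add: frag_cmul_sum sign)
    also have "\<dots> = frag_cmul (a * b) (J a b t (frag_cmul (adjacency_sign D1 v S) (boundary_at D1 v S)))"
      using fin by (simp add: boundary_at_def J_cmul J_sum J_frag_of frag_cmul_sum mult.assoc)
    finally show ?thesis .
  qed
  then show ?thesis
    using finite_crossings1 by (simp add: boundary_def J_sum frag_cmul_sum)
qed

section \<open>Multiplication and comultiplication as blocks of the differential\<close>

text \<open>The sign equation becomes \<open>r = sign + t + 1\<close>, the multiplication of
  \<open>A\<close>: the label -1 is the unit, the label 1 multiplies by \<open>x\<close>, and
  \<open>x\<close> times \<open>x\<close> admits no \<open>r\<close>.\<close>

lemma boundary_at_merge:
  assumes S: "S \<in> enhanced_states D1" and t: "t \<in> {1, -1}"
    and v: "v = p \<and> a' = -1 \<and> b' = 1 \<or> v = q \<and> a' = 1 \<and> b' = -1"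
  shows "boundary_at D v (extend 1 1 t S) =
    (if t = -1 then frag_of (extend a' b' 1 S)
     else if sign_at D1 e S = -1 then frag_of (extend a' b' 1 (set_sign D1 e 1 S)) else 0)"
proof -
  have ab': "a' \<in> {1, -1}" "b' \<in> {1, -1}" "a' \<noteq> b'" using v by auto
  have sign: "sign_at D1 e S \<in> {1, -1}" by (rule sign_at_in[OF S e_arc])
  have "adjacent D v (extend 1 1 t S) T \<longleftrightarrow>
      (\<exists>r\<in>{1, -1}. T = extend a' b' 1 (set_sign D1 e r S) \<and> r = sign_at D1 e S + t + 1)" for T
  proof -
    \<comment> \<open>Both values of \<open>t'\<close> in the adjacency criterion name the same
      state, which must be counted once.\<close>
    have "extend a' b' (-1) (set_sign D1 e r S) = extend a' b' 1 (set_sign D1 e r S)" if "r \<in> {1, -1}" for r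
      using extend_mixed[OF set_sign_in_enhanced_states[OF S e_arc that] ab'(1,2), of "-1" 1] ab' by simp
    moreover have "adjacent D v (extend 1 1 t S) T \<longleftrightarrow>
      (\<exists>r\<in>{1, -1}. \<exists>t'\<in>{1, -1}. T = extend a' b' t' (set_sign D1 e r S) \<and> r = sign_at D1 e S + t + 1)"
      using adjacent_extend_new[OF S _ _ t ab'(1,2), of 1 1 v T] v ab' by auto
    ultimately show ?thesis by auto
  qed
  then have "{T. adjacent D v (extend 1 1 t S) T} =
      (if t = -1 then {extend a' b' 1 (set_sign D1 e (sign_at D1 e S) S)}
     else if sign_at D1 e S = -1 then {extend a' b' 1 (set_sign D1 e 1 S)} else {})"
    using sign t by auto
  then show ?thesis
    by (simp add: boundary_at_def set_sign_sign_at)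
qed

text \<open>Now the equation is \<open>r + t' = sign + 1\<close>. A positive circle allows only two
  positive ones, a negative circle allows both mixed pairs; this is
  \<open>c \<otimes> x + x c \<otimes> 1\<close>, whose second term vanishes on positive
  circles.\<close>

lemma boundary_at_split:
  assumes S: "S \<in> enhanced_states D1"
    and v: "v = p \<and> a = 1 \<and> b = -1 \<or> v = q \<and> a = -1 \<and> b = 1"
  shows "boundary_at D v (extend a b 1 S) = frag_of (extend (-1) (-1) 1 S) +
    (if sign_at D1 e S = -1 then frag_of (extend (-1) (-1) (-1) (set_sign D1 e 1 S)) else 0)"
proof -
  have ab: "a \<in> {1, -1}" "b \<in> {1, -1}" "a \<noteq> b" using v by auto
  have sign: "sign_at D1 e S \<in> {1, -1}" by (rule sign_at_in[OF S e_arc])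
  have "adjacent D v (extend a b 1 S) T \<longleftrightarrow>
      (\<exists>r\<in>{1, -1}. \<exists>t'\<in>{1, -1}. T = extend (-1) (-1) t' (set_sign D1 e r S) \<and> r + t' = sign_at D1 e S + 1)" for T
    using adjacent_extend_new[OF S ab(1,2), of 1 "-1" "-1" v T] v ab by auto
  then have "{T. adjacent D v (extend a b 1 S) T} =
      (if sign_at D1 e S = -1 then {extend (-1) (-1) 1 (set_sign D1 e (sign_at D1 e S) S), extend (-1) (-1) (-1) (set_sign D1 e 1 S)}
     else {extend (-1) (-1) 1 (set_sign D1 e (sign_at D1 e S) S)})"
    using sign by auto
  \<comment> \<open>The two targets differ in the label of the free circle, so the sum over adjacent
    states really has two terms.\<close>
  moreover have "extend (-1) (-1) 1 S \<noteq> extend (-1) (-1) (-1) (set_sign D1 e 1 S)"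
    using extend_inj(4)[OF S set_sign_in_enhanced_states[OF S e_arc, of 1], of "-1" "-1" 1 "-1" "-1" "-1"] by auto
  moreover have "sign_at D1 e S = -1 \<Longrightarrow> set_sign D1 e (-1) S = S"
    by (metis set_sign_sign_at)
  ultimately show ?thesis
    by (simp add: boundary_at_def set_sign_sign_at)
qed

lemma boundary_at_negative:
  "v = p \<and> a = -1 \<or> v = q \<and> b = -1 \<Longrightarrow> boundary_at D v (extend a b t S) = 0"
  using distinct_crossings by (auto simp: boundary_at_def adjacent_def)

lemma boundary_extend:
  assumes S: "S \<in> enhanced_states D1" and ab: "a \<in> {1, -1}" "b \<in> {1, -1}" "t \<in> {1, -1}"
  shows "boundary D (J a b t (frag_of S)) = frag_cmul (a * b) (J a b t (boundary D1 (frag_of S))) +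
    frag_cmul (twist a b S * adjacency_sign D p (extend a b t S)) (boundary_at D p (extend a b t S)) +
    frag_cmul (twist a b S * adjacency_sign D q (extend a b t S)) (boundary_at D q (extend a b t S))"
  unfolding boundary_old_crossings[OF S ab, symmetric]
  using distinct_crossings finite_crossings1
  by (simp add: boundary_def J_frag_of frag_extend_cmul crossings_eq frag_cmul_sum frag_cmul_distrib2)

text \<open>The matrix of \<open>d\<close> in the six blocks. The two mixed corners map to the last
  corner with opposite signs: changing \<open>p\<close> counts the negative marker of
  \<open>q\<close> if \<open>p < q\<close>, changing \<open>q\<close> counts that of
  \<open>p\<close> if \<open>q < p\<close>, and exactly one of these holds.\<close>

lemma boundary_J:
  assumes "Poly_Mapping.keys c \<subseteq> enhanced_states D1"
  shows "boundary D (J 1 1 (-1) c) = J 1 1 (-1) (boundary D1 c) + J (-1) 1 1 c + J 1 (-1) 1 c"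
    and "boundary D (J 1 1 1 c) = J 1 1 1 (boundary D1 c) + J (-1) 1 1 (x_mult D1 e c) + J 1 (-1) 1 (x_mult D1 e c)"
    and "boundary D (J 1 (-1) 1 c) = - J 1 (-1) 1 (boundary D1 c) +
      frag_cmul (if p < q then -1 else 1) (J (-1) (-1) 1 c + J (-1) (-1) (-1) (x_mult D1 e c))"
    and "boundary D (J (-1) 1 1 c) = - J (-1) 1 1 (boundary D1 c) -
      frag_cmul (if p < q then -1 else 1) (J (-1) (-1) 1 c + J (-1) (-1) (-1) (x_mult D1 e c))"
    and "t \<in> {1, -1} \<Longrightarrow> boundary D (J (-1) (-1) t c) = J (-1) (-1) t (boundary D1 c)"
proof -
  note linear = boundary_diff J_diff x_mult_diff frag_cmul_diff_distrib2
  have twist: "twist a b (set_sign D1 e r S) = twist a b S" for a b r S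
    by (simp add: twist_def adjacency_sign_def)
  show "boundary D (J 1 1 (-1) c) = J 1 1 (-1) (boundary D1 c) + J (-1) 1 1 c + J 1 (-1) 1 c"
  proof (rule frag_additive_eqI[where f = "\<lambda>c. boundary D (J 1 1 (-1) c)"
        and g = "\<lambda>c. J 1 1 (-1) (boundary D1 c) + J (-1) 1 1 c + J 1 (-1) 1 c", OF _ _ _ assms])
    fix S assume S: "S \<in> enhanced_states D1"
    show "boundary D (J 1 1 (-1) (frag_of S)) = J 1 1 (-1) (boundary D1 (frag_of S)) + J (-1) 1 1 (frag_of S) + J 1 (-1) 1 (frag_of S)"
      by (subst boundary_extend[OF S]) (simp_all add: boundary_at_merge[OF S, of "-1" p "-1" 1]
          boundary_at_merge[OF S, of "-1" q 1 "-1"] J_frag_of twist_def adjacency_sign_extend)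
  qed (simp_all add: linear)
  show "boundary D (J 1 1 1 c) = J 1 1 1 (boundary D1 c) + J (-1) 1 1 (x_mult D1 e c) + J 1 (-1) 1 (x_mult D1 e c)"
  proof (rule frag_additive_eqI[where f = "\<lambda>c. boundary D (J 1 1 1 c)"
        and g = "\<lambda>c. J 1 1 1 (boundary D1 c) + J (-1) 1 1 (x_mult D1 e c) + J 1 (-1) 1 (x_mult D1 e c)", OF _ _ _ assms])
    fix S assume S: "S \<in> enhanced_states D1"
    show "boundary D (J 1 1 1 (frag_of S)) = J 1 1 1 (boundary D1 (frag_of S)) +
        J (-1) 1 1 (x_mult D1 e (frag_of S)) + J 1 (-1) 1 (x_mult D1 e (frag_of S))"
      by (subst boundary_extend[OF S]) (simp_all add: boundary_at_merge[OF S, of 1 p "-1" 1]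
          boundary_at_merge[OF S, of 1 q 1 "-1"] J_frag_of x_mult_frag_of twist twist_def[of _ _ S] adjacency_sign_extend)
  qed (simp_all add: linear)
  show "boundary D (J 1 (-1) 1 c) = - J 1 (-1) 1 (boundary D1 c) +
      frag_cmul (if p < q then -1 else 1) (J (-1) (-1) 1 c + J (-1) (-1) (-1) (x_mult D1 e c))"
  proof (rule frag_additive_eqI[where f = "\<lambda>c. boundary D (J 1 (-1) 1 c)"
        and g = "\<lambda>c. - J 1 (-1) 1 (boundary D1 c) +
      frag_cmul (if p < q then -1 else 1) (J (-1) (-1) 1 c + J (-1) (-1) (-1) (x_mult D1 e c))", OF _ _ _ assms])
    fix S assume S: "S \<in> enhanced_states D1"
    have sign: "twist 1 (-1) S * adjacency_sign D p (extend 1 (-1) 1 S) = (if p < q then -1 else 1) * twist (-1) (-1) S"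
      by (simp add: twist_def adjacency_sign_extend)
    show "boundary D (J 1 (-1) 1 (frag_of S)) = - J 1 (-1) 1 (boundary D1 (frag_of S)) +
      frag_cmul (if p < q then -1 else 1) (J (-1) (-1) 1 (frag_of S) + J (-1) (-1) (-1) (x_mult D1 e (frag_of S)))"
      by (subst boundary_extend[OF S]) (simp_all add: boundary_at_split[OF S, of p 1 "-1"]
          boundary_at_negative sign J_frag_of x_mult_frag_of twist frag_cmul_distrib2)
  qed (simp_all add: linear)
  show "boundary D (J (-1) 1 1 c) = - J (-1) 1 1 (boundary D1 c) -
      frag_cmul (if p < q then -1 else 1) (J (-1) (-1) 1 c + J (-1) (-1) (-1) (x_mult D1 e c))"
  proof (rule frag_additive_eqI[where f = "\<lambda>c. boundary D (J (-1) 1 1 c)"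
        and g = "\<lambda>c. - J (-1) 1 1 (boundary D1 c) -
      frag_cmul (if p < q then -1 else 1) (J (-1) (-1) 1 c + J (-1) (-1) (-1) (x_mult D1 e c))", OF _ _ _ assms])
    fix S assume S: "S \<in> enhanced_states D1"
    have sign: "twist (-1) 1 S * adjacency_sign D q (extend (-1) 1 1 S) = (if p < q then 1 else -1) * twist (-1) (-1) S"
      using distinct_crossings by (simp add: twist_def adjacency_sign_extend)
    show "boundary D (J (-1) 1 1 (frag_of S)) = - J (-1) 1 1 (boundary D1 (frag_of S)) -
      frag_cmul (if p < q then -1 else 1) (J (-1) (-1) 1 (frag_of S) + J (-1) (-1) (-1) (x_mult D1 e (frag_of S)))"
      by (subst boundary_extend[OF S]) (simp_all add: boundary_at_split[OF S, of q "-1" 1]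
          boundary_at_negative sign J_frag_of x_mult_frag_of twist frag_cmul_distrib2)
  qed (simp_all add: linear)
  show "boundary D (J (-1) (-1) t c) = J (-1) (-1) t (boundary D1 c)" if t: "t \<in> {1, -1}"
  proof (rule frag_additive_eqI[where f = "\<lambda>c. boundary D (J (-1) (-1) t c)"
        and g = "\<lambda>c. J (-1) (-1) t (boundary D1 c)", OF _ _ _ assms])
    fix S assume S: "S \<in> enhanced_states D1"
    show "boundary D (J (-1) (-1) t (frag_of S)) = J (-1) (-1) t (boundary D1 (frag_of S))"
      by (subst boundary_extend[OF S]) (use t in \<open>simp_all add: boundary_at_negative\<close>)
  qed (simp_all add: linear)
qed

section \<open>Decomposition of the complex into six blocks\<close>

text \<open>The shifts are \<open>(2, 4)\<close> for \<open>J 1 1 1\<close> and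
  \<open>(-2, -4)\<close> for \<open>J (-1) (-1) (-1)\<close>, the exponents in the theorem. They
  are \<open>(2, 0)\<close> and \<open>(-2, 0)\<close> for the other labels in these corners, and
  zero for the mixed corners.\<close>

lemma keys_J:
  assumes ab: "a \<in> {1, -1}" "b \<in> {1, -1}" "t \<in> {1, -1}" and c: "Poly_Mapping.keys c \<subseteq> generators D1 i j"
  shows "Poly_Mapping.keys (J a b t c) \<subseteq> generators D (i + a + b) (j + a + b + (if a = b then 2 * t else 0))"
  unfolding J_def
proof (rule keys_frag_extend_subset)
  fix S assume "S \<in> Poly_Mapping.keys c"
  then have S: "S \<in> generators D1 i j" using c by blast
  then have "extend a b t S \<in> generators D (i + a + b) (j + a + b + (if a = b then 2 * t else 0))"
    using ab by (auto simp: generators_def extend_in_enhanced_states sigma_extend tau_extend)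
  then show "Poly_Mapping.keys (frag_cmul (twist a b S) (frag_of (extend a b t S)))
      \<subseteq> generators D (i + a + b) (j + a + b + (if a = b then 2 * t else 0))"
    by (intro order_trans[OF keys_cmul]) simp
qed

lemma lookup_J:
  assumes c: "Poly_Mapping.keys c \<subseteq> enhanced_states D1" and S: "S \<in> enhanced_states D1"
    and l: "a \<in> {1, -1}" "b \<in> {1, -1}" "t \<in> {1, -1}" "t' \<in> {1, -1}"
  shows "Poly_Mapping.lookup (J a b t c) (extend a' b' t' S) =
    (if a = a' \<and> b = b' \<and> (a = b \<longrightarrow> t = t') then twist a b S * Poly_Mapping.lookup c S else 0)"
proof (rule frag_additive_eqI[where f = "\<lambda>c. Poly_Mapping.lookup (J a b t c) (extend a' b' t' S)"
      and g = "\<lambda>c. if a = a' \<and> b = b' \<and> (a = b \<longrightarrow> t = t') then twist a b S * Poly_Mapping.lookup c S else 0", OF _ _ _ c])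
  fix T assume T: "T \<in> enhanced_states D1"
  have "extend a b t T = extend a' b' t' S \<longleftrightarrow> a = a' \<and> b = b' \<and> (a = b \<longrightarrow> t = t') \<and> T = S"
  proof
    assume eq: "extend a b t T = extend a' b' t' S"
    from extend_inj[OF T S l(1,2) eq] show "a = a' \<and> b = b' \<and> (a = b \<longrightarrow> t = t') \<and> T = S" by simp
  next
    assume "a = a' \<and> b = b' \<and> (a = b \<longrightarrow> t = t') \<and> T = S"
    then show "extend a b t T = extend a' b' t' S"
      using extend_mixed[OF S l] by (cases "a = b") auto
  qed
  then show "Poly_Mapping.lookup (J a b t (frag_of T)) (extend a' b' t' S) =
      (if a = a' \<and> b = b' \<and> (a = b \<longrightarrow> t = t') then twist a b S * Poly_Mapping.lookup (frag_of T) S else 0)"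
    by (auto simp: J_frag_of)
qed (auto simp: J_diff lookup_minus right_diff_distrib)

text \<open>Two blocks for each corner with a free circle and one for each mixed corner. The degrees
  of the components undo the shifts of the blocks.\<close>

lemma J_decomposition:
  assumes "Poly_Mapping.keys c \<subseteq> generators D i j"
  obtains c1 c2 c3 c4 c5 c6 where
    "Poly_Mapping.keys c1 \<subseteq> generators D1 (i - 2) j" "Poly_Mapping.keys c2 \<subseteq> generators D1 (i - 2) (j - 4)"
    "Poly_Mapping.keys c3 \<subseteq> generators D1 i j" "Poly_Mapping.keys c4 \<subseteq> generators D1 i j"
    "Poly_Mapping.keys c5 \<subseteq> generators D1 (i + 2) (j + 4)" "Poly_Mapping.keys c6 \<subseteq> generators D1 (i + 2) j"
    "c = J 1 1 (-1) c1 + J 1 1 1 c2 + J 1 (-1) 1 c3 + J (-1) 1 1 c4 + J (-1) (-1) (-1) c5 + J (-1) (-1) 1 c6"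
proof -
  let ?P = "\<lambda>c. \<exists>c1 c2 c3 c4 c5 c6.
    Poly_Mapping.keys c1 \<subseteq> generators D1 (i - 2) j \<and> Poly_Mapping.keys c2 \<subseteq> generators D1 (i - 2) (j - 4) \<and>
    Poly_Mapping.keys c3 \<subseteq> generators D1 i j \<and> Poly_Mapping.keys c4 \<subseteq> generators D1 i j \<and>
    Poly_Mapping.keys c5 \<subseteq> generators D1 (i + 2) (j + 4) \<and> Poly_Mapping.keys c6 \<subseteq> generators D1 (i + 2) j \<and>
    c = J 1 1 (-1) c1 + J 1 1 1 c2 + J 1 (-1) 1 c3 + J (-1) 1 1 c4 + J (-1) (-1) (-1) c5 + J (-1) (-1) 1 c6"
  have "?P c" using assms
  proof (rule free_Abelian_group_induct)
    show "?P 0" by (intro exI[of _ 0]) simp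
  next
    fix c c' assume "?P c" and c': "?P c'"
    then obtain c1 c2 c3 c4 c5 c6 where c:
      "Poly_Mapping.keys c1 \<subseteq> generators D1 (i - 2) j" "Poly_Mapping.keys c2 \<subseteq> generators D1 (i - 2) (j - 4)"
      "Poly_Mapping.keys c3 \<subseteq> generators D1 i j" "Poly_Mapping.keys c4 \<subseteq> generators D1 i j"
      "Poly_Mapping.keys c5 \<subseteq> generators D1 (i + 2) (j + 4)" "Poly_Mapping.keys c6 \<subseteq> generators D1 (i + 2) j"
      "c = J 1 1 (-1) c1 + J 1 1 1 c2 + J 1 (-1) 1 c3 + J (-1) 1 1 c4 + J (-1) (-1) (-1) c5 + J (-1) (-1) 1 c6"
      by blast
    from c' obtain d1 d2 d3 d4 d5 d6 where d:
      "Poly_Mapping.keys d1 \<subseteq> generators D1 (i - 2) j" "Poly_Mapping.keys d2 \<subseteq> generators D1 (i - 2) (j - 4)"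
      "Poly_Mapping.keys d3 \<subseteq> generators D1 i j" "Poly_Mapping.keys d4 \<subseteq> generators D1 i j"
      "Poly_Mapping.keys d5 \<subseteq> generators D1 (i + 2) (j + 4)" "Poly_Mapping.keys d6 \<subseteq> generators D1 (i + 2) j"
      "c' = J 1 1 (-1) d1 + J 1 1 1 d2 + J 1 (-1) 1 d3 + J (-1) 1 1 d4 + J (-1) (-1) (-1) d5 + J (-1) (-1) 1 d6"
      by blast
    show "?P (c - c')"
      by (rule exI[of _ "c1 - d1"], rule exI[of _ "c2 - d2"], rule exI[of _ "c3 - d3"],
          rule exI[of _ "c4 - d4"], rule exI[of _ "c5 - d5"], rule exI[of _ "c6 - d6"], intro conjI)
        (use c d in \<open>simp_all add: J_diff order_trans[OF keys_diff]\<close>)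
  next
    fix T assume T: "T \<in> generators D i j"
    then have "T \<in> enhanced_states D" by (simp add: generators_def)
    then obtain S a b t where S: "S \<in> enhanced_states D1" "a \<in> {1, -1}" "b \<in> {1, -1}" "t \<in> {1, -1}" "T = extend a b t S"
      by (rule enhanced_state_cases)
    \<comment> \<open>\<open>twist\<close> is a sign, so this factor cancels the one inside
      \<open>J\<close>.\<close>
    define g where "g = frag_cmul (twist a b S) (frag_of S)"
    have S1: "S \<in> generators D1 (i - a - b) (j - a - b - (if a = b then 2 * t else 0))"
      using T S by (auto simp: generators_def sigma_extend tau_extend)
    then have g: "Poly_Mapping.keys g \<subseteq> generators D1 (i - a - b) (j - a - b - (if a = b then 2 * t else 0))"
      unfolding g_def by (intro order_trans[OF keys_cmul]) simp
    have JT: "J a b t g = frag_of T"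
      using twist_square[of a b S] by (simp add: g_def J_cmul J_frag_of S(5))
    consider "a = 1" "b = 1" "t = -1" | "a = 1" "b = 1" "t = 1" | "a = 1" "b = -1" | "a = -1" "b = 1"
      | "a = -1" "b = -1" "t = -1" | "a = -1" "b = -1" "t = 1"
      using S by auto
    then show "?P (frag_of T)"
    proof cases
      case 1
      show ?thesis
        by (rule exI[of _ g], rule exI[of _ 0], rule exI[of _ 0], rule exI[of _ 0], rule exI[of _ 0], rule exI[of _ 0], use 1 g JT in simp)
    next
      case 2
      show ?thesis
        by (rule exI[of _ 0], rule exI[of _ g], rule exI[of _ 0], rule exI[of _ 0], rule exI[of _ 0], rule exI[of _ 0], use 2 g JT in simp)
    next
      case 3
      then have gT: "J 1 (-1) 1 g = frag_of T"
        using extend_mixed[OF S(1), of 1 "-1" t 1] S(4,5) twist_square[of a b S] by (simp add: g_def J_cmul J_frag_of)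
      show ?thesis
        by (rule exI[of _ 0], rule exI[of _ 0], rule exI[of _ g], rule exI[of _ 0], rule exI[of _ 0], rule exI[of _ 0], use 3 g gT in simp)
    next
      case 4
      then have gT: "J (-1) 1 1 g = frag_of T"
        using extend_mixed[OF S(1), of "-1" 1 t 1] S(4,5) twist_square[of a b S] by (simp add: g_def J_cmul J_frag_of)
      show ?thesis
        by (rule exI[of _ 0], rule exI[of _ 0], rule exI[of _ 0], rule exI[of _ g], rule exI[of _ 0], rule exI[of _ 0], use 4 g gT in simp)
    next
      case 5
      show ?thesis
        by (rule exI[of _ 0], rule exI[of _ 0], rule exI[of _ 0], rule exI[of _ 0], rule exI[of _ g], rule exI[of _ 0], use 5 g JT in \<open>simp add: add.commute\<close>)
    next
      case 6
      show ?thesis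
        by (rule exI[of _ 0], rule exI[of _ 0], rule exI[of _ 0], rule exI[of _ 0], rule exI[of _ 0], rule exI[of _ g], use 6 g JT in \<open>simp add: add.commute\<close>)
    qed
  qed
  with that show ?thesis by blast
qed

lemma J_independent:
  assumes keys: "Poly_Mapping.keys c1 \<subseteq> enhanced_states D1" "Poly_Mapping.keys c2 \<subseteq> enhanced_states D1"
      "Poly_Mapping.keys c3 \<subseteq> enhanced_states D1" "Poly_Mapping.keys c4 \<subseteq> enhanced_states D1"
      "Poly_Mapping.keys c5 \<subseteq> enhanced_states D1" "Poly_Mapping.keys c6 \<subseteq> enhanced_states D1"
    and sum: "J 1 1 (-1) c1 + J 1 1 1 c2 + J 1 (-1) 1 c3 + J (-1) 1 1 c4 + J (-1) (-1) (-1) c5 + J (-1) (-1) 1 c6 = 0"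
  shows "c1 = 0" "c2 = 0" "c3 = 0" "c4 = 0" "c5 = 0" "c6 = 0"
proof -
  have zeroI: "c = 0" if "Poly_Mapping.keys c \<subseteq> enhanced_states D1"
    "\<And>S. S \<in> enhanced_states D1 \<Longrightarrow> twist a b S * Poly_Mapping.lookup c S = 0" for c a b
  proof -
    have "twist a b S \<noteq> 0" for S
      using twist_square[of a b S] by auto
    then have "S \<notin> Poly_Mapping.keys c" for S
      using that by (meson in_keys_iff mult_eq_0_iff subsetD)
    then show ?thesis by (metis all_not_in_conv keys_eq_empty)
  qed
  have *: "Poly_Mapping.lookup (J 1 1 (-1) c1 + J 1 1 1 c2 + J 1 (-1) 1 c3 + J (-1) 1 1 c4 + J (-1) (-1) (-1) c5 + J (-1) (-1) 1 c6) (extend a b t S) = 0" for a b t S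
    by (simp add: sum)
  show "c1 = 0"
  proof (rule zeroI[of _ 1 1])
    show "twist 1 1 S * Poly_Mapping.lookup c1 S = 0" if "S \<in> enhanced_states D1" for S
      using *[of 1 1 "-1" S] by (simp add: lookup_add lookup_J[OF keys(1) that] lookup_J[OF keys(2) that]
        lookup_J[OF keys(3) that] lookup_J[OF keys(4) that] lookup_J[OF keys(5) that] lookup_J[OF keys(6) that])
  qed (rule keys)
  show "c2 = 0"
  proof (rule zeroI[of _ 1 1])
    show "twist 1 1 S * Poly_Mapping.lookup c2 S = 0" if "S \<in> enhanced_states D1" for S
      using *[of 1 1 1 S] by (simp add: lookup_add lookup_J[OF keys(1) that] lookup_J[OF keys(2) that]
        lookup_J[OF keys(3) that] lookup_J[OF keys(4) that] lookup_J[OF keys(5) that] lookup_J[OF keys(6) that])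
  qed (rule keys)
  show "c3 = 0"
  proof (rule zeroI[of _ 1 "-1"])
    show "twist 1 (-1) S * Poly_Mapping.lookup c3 S = 0" if "S \<in> enhanced_states D1" for S
      using *[of 1 "-1" 1 S] by (simp add: lookup_add lookup_J[OF keys(1) that] lookup_J[OF keys(2) that]
        lookup_J[OF keys(3) that] lookup_J[OF keys(4) that] lookup_J[OF keys(5) that] lookup_J[OF keys(6) that])
  qed (rule keys)
  show "c4 = 0"
  proof (rule zeroI[of _ "-1" 1])
    show "twist (-1) 1 S * Poly_Mapping.lookup c4 S = 0" if "S \<in> enhanced_states D1" for S
      using *[of "-1" 1 1 S] by (simp add: lookup_add lookup_J[OF keys(1) that] lookup_J[OF keys(2) that]
        lookup_J[OF keys(3) that] lookup_J[OF keys(4) that] lookup_J[OF keys(5) that] lookup_J[OF keys(6) that])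
  qed (rule keys)
  show "c5 = 0"
  proof (rule zeroI[of _ "-1" "-1"])
    show "twist (-1) (-1) S * Poly_Mapping.lookup c5 S = 0" if "S \<in> enhanced_states D1" for S
      using *[of "-1" "-1" "-1" S] by (simp add: lookup_add lookup_J[OF keys(1) that] lookup_J[OF keys(2) that]
        lookup_J[OF keys(3) that] lookup_J[OF keys(4) that] lookup_J[OF keys(5) that] lookup_J[OF keys(6) that])
  qed (rule keys)
  show "c6 = 0"
  proof (rule zeroI[of _ "-1" "-1"])
    show "twist (-1) (-1) S * Poly_Mapping.lookup c6 S = 0" if "S \<in> enhanced_states D1" for S
      using *[of "-1" "-1" 1 S] by (simp add: lookup_add lookup_J[OF keys(1) that] lookup_J[OF keys(2) that]
        lookup_J[OF keys(3) that] lookup_J[OF keys(4) that] lookup_J[OF keys(5) that] lookup_J[OF keys(6) that])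
  qed (rule keys)
qed

section \<open>Multiplication by x on the blocks\<close>

lemma F_cong: "F (s(p := a, q := b)) = F (s'(p := a, q := b))" "G (s(p := a, q := b)) = G (s'(p := a, q := b))"
  using distinct_crossings by (simp_all add: F_def G_def)

lemma x_mult_J_old:
  assumes "c \<in> arcs D1"
  shows "x_mult D c (J a b t u) = J a b t (x_mult D1 c u)"
proof (rule frag_additive_eqI[where f = "\<lambda>u. x_mult D c (J a b t u)" and g = "\<lambda>u. J a b t (x_mult D1 c u)" and E = UNIV])
  fix S
  have "twist a b (set_sign D1 c 1 S) = twist a b S" by (simp add: twist_def adjacency_sign_def)
  then show "x_mult D c (J a b t (frag_of S)) = J a b t (x_mult D1 c (frag_of S))"
    using assms by (simp add: J_frag_of x_mult_def frag_extend_cmul sign_at_extend_old set_sign_extend_old)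
qed (simp_all add: x_mult_diff J_diff)

text \<open>\<open>F\<close> depends only on the markers at \<open>p\<close> and \<open>q\<close>,
  so a constant state stands for all states of the corner. An arc of \<open>F\<close> lies on the
  circle through \<open>e\<close>, hence acts as \<open>e\<close> does.\<close>

lemma x_mult_J_F:
  assumes "c \<in> F ((\<lambda>_. 1)(p := a, q := b))"
  shows "x_mult D c (J a b t u) = J a b t (x_mult D1 e u)"
proof (rule frag_additive_eqI[where f = "\<lambda>u. x_mult D c (J a b t u)" and g = "\<lambda>u. J a b t (x_mult D1 e u)" and E = UNIV])
  fix S
  have "twist a b (set_sign D1 e 1 S) = twist a b S" by (simp add: twist_def adjacency_sign_def)
  moreover have "c \<in> F ((fst S)(p := a, q := b))" using assms F_cong by blast
  ultimately show "x_mult D c (J a b t (frag_of S)) = J a b t (x_mult D1 e (frag_of S))"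
    by (simp add: J_frag_of x_mult_def frag_extend_cmul sign_at_extend_F set_sign_extend_F)
qed (simp_all add: x_mult_diff J_diff)

lemma x_mult_J_G:
  assumes "c \<in> G ((\<lambda>_. 1)(p := a, q := b))"
  shows "x_mult D c (J a b (-1) u) = J a b 1 u" "x_mult D c (J a b 1 u) = 0"
proof -
  have G: "c \<in> G ((fst S)(p := a, q := b))" for S :: enhanced_state using assms F_cong by blast
  show "x_mult D c (J a b (-1) u) = J a b 1 u"
    by (rule frag_additive_eqI[where f = "\<lambda>u. x_mult D c (J a b (-1) u)" and g = "J a b 1" and E = UNIV])
      (simp_all add: G x_mult_diff J_diff J_frag_of x_mult_cmul x_mult_frag_of sign_at_extend_G set_sign_extend_G)
  show "x_mult D c (J a b 1 u) = 0"
    by (rule frag_additive_eqI[where f = "\<lambda>u. x_mult D c (J a b 1 u)" and g = "\<lambda>_. 0" and E = UNIV])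
      (simp_all add: G x_mult_diff J_diff J_frag_of x_mult_cmul x_mult_frag_of sign_at_extend_G)
qed

end

section \<open>Homology of a Hopf extension\<close>

text \<open>If \<open>f\<close> and \<open>g\<close> together induce an isomorphism from the direct
  sum of two quotients onto \<open>Z\<close> modulo \<open>B\<close>, bases can be concatenated.
  \<open>surj\<close> and \<open>inj\<close> are the two halves of that isomorphism, stated on
  representatives.\<close>

lemma homology_basis_sum:
  fixes f :: "('a \<Rightarrow>\<^sub>0 int) \<Rightarrow> ('c \<Rightarrow>\<^sub>0 int)" and g :: "('b \<Rightarrow>\<^sub>0 int) \<Rightarrow> ('c \<Rightarrow>\<^sub>0 int)"
  assumes 1: "homology_basis Z1 B1 N1 b1" and 2: "homology_basis Z2 B2 N2 b2"
    and f: "\<And>c d. f (c + d) = f c + f d" "\<And>k c. f (frag_cmul k c) = frag_cmul k (f c)"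
    and g: "\<And>c d. g (c + d) = g c + g d" "\<And>k c. g (frag_cmul k c) = frag_cmul k (g c)"
    and Z: "\<And>c. c \<in> Z1 \<Longrightarrow> f c \<in> Z" "\<And>c. c \<in> Z2 \<Longrightarrow> g c \<in> Z"
    and B: "\<And>c. c \<in> B1 \<Longrightarrow> f c \<in> B" "\<And>c. c \<in> B2 \<Longrightarrow> g c \<in> B" "\<And>c d. c \<in> B \<Longrightarrow> d \<in> B \<Longrightarrow> c + d \<in> B"
    and closed: "\<And>c. (\<Sum>k<N1. frag_cmul (c k) (b1 k)) \<in> Z1" "\<And>c. (\<Sum>k<N2. frag_cmul (c k) (b2 k)) \<in> Z2"
    and surj: "\<And>z. z \<in> Z \<Longrightarrow> \<exists>u\<in>Z1. \<exists>v\<in>Z2. z - (f u + g v) \<in> B"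
    and inj: "\<And>u v. u \<in> Z1 \<Longrightarrow> v \<in> Z2 \<Longrightarrow> f u + g v \<in> B \<Longrightarrow> u \<in> B1 \<and> v \<in> B2"
  shows "homology_basis Z B (N1 + N2) (\<lambda>k. if k < N1 then f (b1 k) else g (b2 (k - N1)))"
    (is "homology_basis Z B _ ?b")
proof -
  have f0: "f 0 = 0" and g0: "g 0 = 0" using f(1)[of 0 0] g(1)[of 0 0] by simp_all
  have f_sum: "f (sum h {..<n}) = (\<Sum>k<n. f (h k))" for h and n :: nat
    by (induction n) (simp_all add: f f0)
  have g_sum: "g (sum h {..<n}) = (\<Sum>k<n. g (h k))" for h and n :: nat
    by (induction n) (simp_all add: g g0)
  have split: "(\<Sum>k<N1 + N2. frag_cmul (c k) (?b k)) =
      f (\<Sum>k<N1. frag_cmul (c k) (b1 k)) + g (\<Sum>k<N2. frag_cmul (c (N1 + k)) (b2 k))" for c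
  proof -
    have "k \<in> (+) N1 ` {..<N2}" if "\<not> k < N1" "k < N1 + N2" for k
      using that by (intro image_eqI[of _ _ "k - N1"]) auto
    then have "{..<N1 + N2} = {..<N1} \<union> (+) N1 ` {..<N2}"
      by fastforce
    moreover have "{..<N1} \<inter> (+) N1 ` {..<N2} = {}" by auto
    ultimately have "(\<Sum>k<N1 + N2. frag_cmul (c k) (?b k)) =
        (\<Sum>k<N1. frag_cmul (c k) (?b k)) + (\<Sum>k\<in>(+) N1 ` {..<N2}. frag_cmul (c k) (?b k))"
      by (simp add: sum.union_disjoint)
    then show ?thesis
      by (simp add: f_sum g_sum f g sum.reindex)
  qed
  show ?thesis
    unfolding homology_basis_def
  proof (intro conjI ballI allI impI)
    have "?b k \<in> Z" if "k < N1 + N2" for k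
      using that 1 2 Z by (auto simp: homology_basis_def image_subset_iff)
    then show "?b ` {..<N1 + N2} \<subseteq> Z" by blast
  next
    fix z assume "z \<in> Z"
    from surj[OF this] obtain u v where uv: "u \<in> Z1" "v \<in> Z2" "z - (f u + g v) \<in> B" by blast
    obtain c1 where c1: "u - (\<Sum>k<N1. frag_cmul (c1 k) (b1 k)) \<in> B1"
      using 1 uv by (auto simp: homology_basis_def)
    obtain c2 where c2: "v - (\<Sum>k<N2. frag_cmul (c2 k) (b2 k)) \<in> B2"
      using 2 uv by (auto simp: homology_basis_def)
    define c where "c k = (if k < N1 then c1 k else c2 (k - N1))" for k
    let ?u = "\<Sum>k<N1. frag_cmul (c1 k) (b1 k)" and ?v = "\<Sum>k<N2. frag_cmul (c2 k) (b2 k)"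
    have "f u = f (u - ?u) + f ?u" "g v = g (v - ?v) + g ?v"
      by (simp_all flip: f g)
    then have "z - (f ?u + g ?v) = (z - (f u + g v)) + (f (u - ?u) + g (v - ?v))"
      by (simp add: algebra_simps)
    also have "\<dots> \<in> B" using uv(3) c1 c2 B by blast
    also have "f ?u + g ?v = (\<Sum>k<N1 + N2. frag_cmul (c k) (?b k))"
      by (simp add: split c_def)
    finally show "\<exists>c. z - (\<Sum>k<N1 + N2. frag_cmul (c k) (?b k)) \<in> B" by blast
  next
    fix c k assume c: "(\<Sum>k<N1 + N2. frag_cmul (c k) (?b k)) \<in> B" and k: "k < N1 + N2"
    have "(\<Sum>k<N1. frag_cmul (c k) (b1 k)) \<in> B1 \<and> (\<Sum>k<N2. frag_cmul (c (N1 + k)) (b2 k)) \<in> B2"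
      using c unfolding split by (intro inj closed)
    moreover have z1: "\<forall>k<N1. c k = 0" if "(\<Sum>k<N1. frag_cmul (c k) (b1 k)) \<in> B1" for c
      using 1 that by (simp add: homology_basis_def)
    moreover have z2: "\<forall>k<N2. c k = 0" if "(\<Sum>k<N2. frag_cmul (c k) (b2 k)) \<in> B2" for c
      using 2 that by (simp add: homology_basis_def)
    ultimately have "\<forall>k<N1. c k = 0" "\<forall>k<N2. c (N1 + k) = 0"
      using z2[of "\<lambda>k. c (N1 + k)"] by simp_all
    then show "c k = 0"
      using k by (cases "k < N1") (auto dest: spec[of _ "k - N1"])
  qed
qed

section \<open>Cycles, boundaries and the inductive invariant\<close>

definition cycles :: "diagram \<Rightarrow> int \<Rightarrow> int \<Rightarrow> (enhanced_state \<Rightarrow>\<^sub>0 int) set" where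
  "cycles D i j = {c. Poly_Mapping.keys c \<subseteq> generators D i j \<and> boundary D c = 0}"

definition boundaries :: "diagram \<Rightarrow> int \<Rightarrow> int \<Rightarrow> (enhanced_state \<Rightarrow>\<^sub>0 int) set" where
  "boundaries D i j = boundary D ` {c. Poly_Mapping.keys c \<subseteq> generators D (i + 2) j}"

text \<open>All arcs are included since the next Hopf link may be attached at any of them, and the
  chain map it produces needs \<open>x\<close> at that arc to commute with \<open>d\<close>.\<close>

definition x_linear_complex :: "diagram \<Rightarrow> bool" where
  "x_linear_complex D \<longleftrightarrow> (\<forall>c. Poly_Mapping.keys c \<subseteq> enhanced_states D \<longrightarrow>
     boundary D (boundary D c) = 0 \<and>
     (\<forall>a\<in>arcs D. x_mult D a (boundary D c) = boundary D (x_mult D a c)))"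

lemma boundary_cmul: "boundary D (frag_cmul k c) = frag_cmul k (boundary D c)"
  by (simp add: boundary_def frag_extend_cmul)

lemma generators_subset: "generators D i j \<subseteq> enhanced_states D"
  by (auto simp: generators_def)

lemma cycles_lincomb:
  fixes b :: "nat \<Rightarrow> enhanced_state \<Rightarrow>\<^sub>0 int"
  assumes "\<And>k. k < N \<Longrightarrow> b k \<in> cycles D i j"
  shows "(\<Sum>k<N. frag_cmul (c k) (b k)) \<in> cycles D i j"
proof -
  have "boundary D (\<Sum>k<n. frag_cmul (c k) (b k)) = (\<Sum>k<n. frag_cmul (c k) (boundary D (b k)))" for n :: nat
    by (induction n) (simp_all add: boundary_add boundary_cmul)
  moreover have "Poly_Mapping.keys (\<Sum>k<N. frag_cmul (c k) (b k)) \<subseteq> generators D i j"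
    using assms by (intro keys_sum_frag_cmul) (auto simp: cycles_def)
  ultimately show ?thesis using assms by (simp add: cycles_def)
qed

lemma boundaries_add:
  assumes "c \<in> boundaries D i j" "d \<in> boundaries D i j"
  shows "c + d \<in> boundaries D i j"
proof -
  obtain c' where c': "Poly_Mapping.keys c' \<subseteq> generators D (i + 2) j" "c = boundary D c'"
    using assms(1) by (auto simp: boundaries_def)
  obtain d' where d': "Poly_Mapping.keys d' \<subseteq> generators D (i + 2) j" "d = boundary D d'"
    using assms(2) by (auto simp: boundaries_def)
  have "c + d = boundary D (c' + d')"
    by (simp add: c' d' boundary_add)
  moreover have "Poly_Mapping.keys (c' + d') \<subseteq> generators D (i + 2) j"
    using c'(1) d'(1) by (rule order_trans[OF keys_add Un_least])
  ultimately show ?thesis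
    unfolding boundaries_def by blast
qed

lemma keys_diff_subset:
  "Poly_Mapping.keys c \<subseteq> S \<Longrightarrow> Poly_Mapping.keys c' \<subseteq> S \<Longrightarrow> Poly_Mapping.keys (c - c') \<subseteq> S"
  by (rule order_trans[OF keys_diff Un_least])

lemma keys_add_subset:
  "Poly_Mapping.keys c \<subseteq> S \<Longrightarrow> Poly_Mapping.keys c' \<subseteq> S \<Longrightarrow> Poly_Mapping.keys (c + c') \<subseteq> S"
  by (rule order_trans[OF keys_add Un_least])

context hopf_extension
begin

text \<open>
  The roles of the two mixed smoothings are chosen such that no sign depends on the order of \<open>p\<close>
  and \<open>q\<close>.
\<close>

definition M :: "(enhanced_state \<Rightarrow>\<^sub>0 int) \<Rightarrow> (enhanced_state \<Rightarrow>\<^sub>0 int)" where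
  "M = (if p < q then J (-1) 1 1 else J 1 (-1) 1)"

definition N :: "(enhanced_state \<Rightarrow>\<^sub>0 int) \<Rightarrow> (enhanced_state \<Rightarrow>\<^sub>0 int)" where
  "N = (if p < q then J 1 (-1) 1 else J (-1) 1 1)"

abbreviation "P \<equiv> J 1 1 (-1)"
abbreviation "P' \<equiv> J 1 1 1"
abbreviation "Q \<equiv> J (-1) (-1) (-1)"
abbreviation "Q' \<equiv> J (-1) (-1) 1"
abbreviation "d1 \<equiv> boundary D1"
abbreviation "d \<equiv> boundary D"
abbreviation "X \<equiv> x_mult D1 e"
abbreviation "chain1 (c :: enhanced_state \<Rightarrow>\<^sub>0 int) \<equiv> Poly_Mapping.keys c \<subseteq> enhanced_states D1"

lemma MN_linear: "M (c - c') = M c - M c'" "M (c + c') = M c + M c'" "M (- c) = - M c" "M 0 = 0"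
  "N (c - c') = N c - N c'" "N (c + c') = N c + N c'" "N (- c) = - N c" "N 0 = 0"
  by (simp_all add: M_def N_def J_diff J_add J_minus)

text \<open>The first map of the square lands in the diagonal \<open>M c + N c\<close>, and the
  second one cancels there because its values on \<open>M c\<close> and \<open>N c\<close> are
  opposite.\<close>

lemma boundary_blocks:
  assumes "chain1 c"
  shows "d (P c) = P (d1 c) + M c + N c"
    "d (P' c) = P' (d1 c) + M (X c) + N (X c)"
    "d (M c) = - M (d1 c) + Q' c + Q (X c)"
    "d (N c) = - N (d1 c) - Q' c - Q (X c)"
    "d (Q c) = Q (d1 c)"
    "d (Q' c) = Q' (d1 c)"
proof -
  note b = boundary_J[OF assms]
  have swap: "u + M c' + N c' = u + J (-1) 1 1 c' + J 1 (-1) 1 c'" for u c'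
    by (simp add: M_def N_def add.assoc add.commute)
  show "d (P c) = P (d1 c) + M c + N c"
    unfolding swap by (rule b(1))
  show "d (P' c) = P' (d1 c) + M (X c) + N (X c)"
    unfolding swap by (rule b(2))
  show "d (M c) = - M (d1 c) + Q' c + Q (X c)"
    by (cases "p < q") (simp_all only: M_def b(3,4) frag_cmul_one frag_cmul_minus_one if_True if_False diff_minus_eq_add add.assoc)
  show "d (N c) = - N (d1 c) - Q' c - Q (X c)"
    by (cases "p < q") (simp_all only: N_def b(3,4) frag_cmul_one frag_cmul_minus_one if_True if_False add_uminus_conv_diff diff_diff_eq)
  show "d (Q c) = Q (d1 c)" "d (Q' c) = Q' (d1 c)"
    by (rule b(5), simp)+
qed

lemma block_decomposition:
  assumes "Poly_Mapping.keys c \<subseteq> generators D i j"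
  obtains c1 c2 c3 c4 c5 c6 where
    "Poly_Mapping.keys c1 \<subseteq> generators D1 (i - 2) j" "Poly_Mapping.keys c2 \<subseteq> generators D1 (i - 2) (j - 4)"
    "Poly_Mapping.keys c3 \<subseteq> generators D1 i j" "Poly_Mapping.keys c4 \<subseteq> generators D1 i j"
    "Poly_Mapping.keys c5 \<subseteq> generators D1 (i + 2) (j + 4)" "Poly_Mapping.keys c6 \<subseteq> generators D1 (i + 2) j"
    "c = P c1 + P' c2 + M c3 + N c4 + Q c5 + Q' c6"
proof -
  obtain c1 c2 c3 c4 c5 c6 where c:
    "Poly_Mapping.keys c1 \<subseteq> generators D1 (i - 2) j" "Poly_Mapping.keys c2 \<subseteq> generators D1 (i - 2) (j - 4)"
    "Poly_Mapping.keys c3 \<subseteq> generators D1 i j" "Poly_Mapping.keys c4 \<subseteq> generators D1 i j"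
    "Poly_Mapping.keys c5 \<subseteq> generators D1 (i + 2) (j + 4)" "Poly_Mapping.keys c6 \<subseteq> generators D1 (i + 2) j"
    "c = P c1 + P' c2 + J 1 (-1) 1 c3 + J (-1) 1 1 c4 + Q c5 + Q' c6"
    using J_decomposition[OF assms] by metis
  show ?thesis
  proof (cases "p < q")
    case True
    then have "c = P c1 + P' c2 + M c4 + N c3 + Q c5 + Q' c6"
      using c(7) by (simp add: M_def N_def add_ac)
    with c that show ?thesis by blast
  next
    case False
    then have "c = P c1 + P' c2 + M c3 + N c4 + Q c5 + Q' c6"
      using c(7) by (simp add: M_def N_def)
    with c that show ?thesis by blast
  qed
qed

lemma block_independent:
  assumes "chain1 c1" "chain1 c2" "chain1 c3" "chain1 c4" "chain1 c5" "chain1 c6"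
    and sum: "P c1 + P' c2 + M c3 + N c4 + Q c5 + Q' c6 = 0"
  shows "c1 = 0" "c2 = 0" "c3 = 0" "c4 = 0" "c5 = 0" "c6 = 0"
proof -
  have "c1 = 0 \<and> c2 = 0 \<and> c3 = 0 \<and> c4 = 0 \<and> c5 = 0 \<and> c6 = 0"
  proof (cases "p < q")
    case True
    then have "P c1 + P' c2 + J 1 (-1) 1 c4 + J (-1) 1 1 c3 + Q c5 + Q' c6 = 0"
      using sum by (simp add: M_def N_def add_ac)
    from J_independent[OF assms(1,2,4,3,5,6) this] show ?thesis by simp
  next
    case False
    then have "P c1 + P' c2 + J 1 (-1) 1 c3 + J (-1) 1 1 c4 + Q c5 + Q' c6 = 0"
      using sum by (simp add: M_def N_def)
    from J_independent[OF assms(1-6) this] show ?thesis by simp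
  qed
  then show "c1 = 0" "c2 = 0" "c3 = 0" "c4 = 0" "c5 = 0" "c6 = 0" by simp_all
qed

lemma keys_MN:
  assumes "Poly_Mapping.keys c \<subseteq> generators D1 i j"
  shows "Poly_Mapping.keys (M c) \<subseteq> generators D i j" "Poly_Mapping.keys (N c) \<subseteq> generators D i j"
  using keys_J[of 1 "-1" 1 c i j] keys_J[of "-1" 1 1 c i j] assms by (simp_all add: M_def N_def)

text \<open>In a mixed corner all four arcs of the Hopf link lie on the circle through
  \<open>e\<close>. One arc \<open>a'\<close> serves both corners, which matters when
  \<open>x\<close> is moved past \<open>d (P c)\<close>, having components in both.\<close>

lemma x_mult_MN:
  assumes "a \<in> arcs D"
  obtains a' where "a' \<in> arcs D1" "\<And>c. x_mult D a (M c) = M (x_mult D1 a' c)" "\<And>c. x_mult D a (N c) = N (x_mult D1 a' c)"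
    "a' = a \<or> a' = e \<and> a \<notin> arcs D1"
proof (cases "a \<in> arcs D1")
  case True
  then show ?thesis using that x_mult_J_old unfolding M_def N_def by simp
next
  case False
  then have a: "a \<in> {w, x, y, z}" using assms by (simp add: arcs_eq)
  have "a \<in> F ((\<lambda>_. 1)(p := 1, q := -1))" "a \<in> F ((\<lambda>_. 1)(p := -1, q := 1))"
    using a distinct_crossings by (simp_all add: F_def)
  with False show ?thesis
    using that[of e] e_arc x_mult_J_F unfolding M_def N_def by simp
qed

text \<open>A new arc acts either at \<open>e\<close> or on the free factor \<open>A\<close>. The
  alternative depends on the corner: the same arc may belong to \<open>F\<close> for positive
  markers and to \<open>G\<close> for negative ones.\<close>

lemma x_mult_pure:
  assumes "a \<in> arcs D"
  obtains a' where "a' \<in> arcs D1" "\<And>t c. x_mult D a (J r r t c) = J r r t (x_mult D1 a' c)" "a' = a \<or> a' = e \<and> a \<notin> arcs D1"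
  | "a \<notin> arcs D1" "\<And>c. x_mult D a (J r r (-1) c) = J r r 1 c" "\<And>c. x_mult D a (J r r 1 c) = 0"
proof (cases "a \<in> arcs D1")
  case True
  then show ?thesis using that(1) x_mult_J_old by simp
next
  case False
  then have a: "a \<in> {w, x, y, z}" using assms by (simp add: arcs_eq)
  show ?thesis
  proof (cases "a \<in> F ((\<lambda>_. 1)(p := r, q := r))")
    case True
    then show ?thesis using that(1)[of e] e_arc x_mult_J_F False by simp
  next
    case nF: False
    then have "a \<in> G ((\<lambda>_. 1)(p := r, q := r))" using a by (simp add: G_def)
    then show ?thesis using that(2) x_mult_J_G False by simp
  qed
qed

text \<open>Everything reduces to the blocks. \<open>d\<^sup>2 = 0\<close> follows from
  \<open>d1 X = X d1\<close>, from the sign -1 before \<open>d1\<close> in the mixed corners and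
  from the cancellation on the diagonal. Commutation with \<open>x\<close> on a free factor uses
  \<open>X\<^sup>2 = 0\<close>; on the other circles it uses that multiplications by
  \<open>x\<close> commute.\<close>

lemma x_linear_complex_extend:
  assumes D1: "x_linear_complex D1"
  shows "x_linear_complex D"
  unfolding x_linear_complex_def
proof (intro allI impI conjI ballI)
  have d1d1: "d1 (d1 c) = 0" and xd: "\<And>a. a \<in> arcs D1 \<Longrightarrow> x_mult D1 a (d1 c) = d1 (x_mult D1 a c)"
    if "chain1 c" for c
    using D1 that by (auto simp: x_linear_complex_def)
  have ch: "chain1 (d1 c)" "\<And>a. a \<in> arcs D1 \<Longrightarrow> chain1 (x_mult D1 a c)" if "chain1 c" for c
    using that keys_boundary_enhanced keys_x_mult_enhanced by blast+
  have Xd: "X (d1 c) = d1 (X c)" and chX: "chain1 (X c)" if "chain1 c" for c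
    using xd[OF that e_arc] ch(2)[OF that e_arc] by simp_all
  note linear = boundary_diff boundary_add boundary_minus x_mult_diff x_mult_add x_mult_minus
    J_diff J_add J_minus MN_linear
  {
    fix c assume c: "chain1 c"
    note b = boundary_blocks[OF c] boundary_blocks[OF ch(1)[OF c]] boundary_blocks[OF chX[OF c]]
    have dd: "d (d (P c)) = 0" "d (d (P' c)) = 0" "d (d (M c)) = 0" "d (d (N c)) = 0" "d (d (Q c)) = 0" "d (d (Q' c)) = 0"
      by (simp_all add: b linear d1d1[OF c] Xd[OF c])
    have dx: "x_mult D a (d u) = d (x_mult D a u)"
      if a: "a \<in> arcs D" and u: "u \<in> {P c, P' c, M c, N c, Q c, Q' c}" for a u
    proof -
      obtain a0 where a0: "a0 \<in> arcs D1" "\<And>c. x_mult D a (M c) = M (x_mult D1 a0 c)"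
        "\<And>c. x_mult D a (N c) = N (x_mult D1 a0 c)" "a0 = a \<or> a0 = e \<and> a \<notin> arcs D1"
        using x_mult_MN[OF a] by blast
      note b0 = boundary_blocks[OF ch(2)[OF c a0(1)]]
      \<comment> \<open>The arc standing for \<open>a\<close> in a pure corner is the one already
        found for the mixed corners, so a single \<open>a0\<close> works in all blocks that
        \<open>d\<close> connects.\<close>
      have old: "\<And>t c. x_mult D a (J r r t c) = J r r t (x_mult D1 a0 c)"
        if "a' \<in> arcs D1" "\<And>t c. x_mult D a (J r r t c) = J r r t (x_mult D1 a' c)" "a' = a \<or> a' = e \<and> a \<notin> arcs D1" for a' r
      proof -
        have "a' = a0" using that(1,3) a0(1,4) by auto
        with that(2) show "x_mult D a (J r r t c) = J r r t (x_mult D1 a0 c)" for t c by simp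
      qed
      have new: "a0 = e" if "a \<notin> arcs D1" using that a0(1,4) by auto
      note comm = x_mult_commute[of D1 a0 e]
      have PM: "x_mult D a (d (P c)) = d (x_mult D a (P c))" "x_mult D a (d (P' c)) = d (x_mult D a (P' c))"
      proof -
        have "x_mult D a (d (P c)) = d (x_mult D a (P c)) \<and> x_mult D a (d (P' c)) = d (x_mult D a (P' c))"
        proof (rule x_mult_pure[OF a, of 1])
          fix a' assume "a' \<in> arcs D1" "\<And>t c. x_mult D a (J 1 1 t c) = J 1 1 t (x_mult D1 a' c)" "a' = a \<or> a' = e \<and> a \<notin> arcs D1"
          note o = old[OF this]
          show ?thesis
            by (simp add: b b0 linear o a0(2,3) comm xd[OF c a0(1)])
        next
          assume *: "a \<notin> arcs D1" "\<And>c. x_mult D a (P c) = P' c" "\<And>c. x_mult D a (P' c) = 0"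
          show ?thesis
            by (simp add: b linear * a0(2,3) new[OF *(1)] x_mult_square)
        qed
        then show "x_mult D a (d (P c)) = d (x_mult D a (P c))" "x_mult D a (d (P' c)) = d (x_mult D a (P' c))" by simp_all
      qed
      have "x_mult D a (d (M c)) = d (x_mult D a (M c)) \<and> x_mult D a (d (N c)) = d (x_mult D a (N c)) \<and>
          x_mult D a (d (Q c)) = d (x_mult D a (Q c)) \<and> x_mult D a (d (Q' c)) = d (x_mult D a (Q' c))"
      proof (rule x_mult_pure[OF a, of "-1"])
        fix a' assume "a' \<in> arcs D1" "\<And>t c. x_mult D a (J (-1) (-1) t c) = J (-1) (-1) t (x_mult D1 a' c)" "a' = a \<or> a' = e \<and> a \<notin> arcs D1"
        note o = old[OF this]
        show ?thesis
          by (simp add: b b0 linear o a0(2,3) comm xd[OF c a0(1)])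
      next
        assume *: "a \<notin> arcs D1" "\<And>c. x_mult D a (Q c) = Q' c" "\<And>c. x_mult D a (Q' c) = 0"
        show ?thesis
          by (simp add: b linear * a0(2,3) new[OF *(1)] x_mult_square Xd[OF c])
      qed
      with PM u show ?thesis by auto
    qed
    note dd dx
  } note blocks = this
  \<comment> \<open>Each generator of \<open>C(D)\<close> lies in a single block, so checking the
    blocks suffices by additivity.\<close>
  have frag: "\<exists>c. chain1 c \<and> frag_of T \<in> {P c, P' c, M c, N c, Q c, Q' c}" if T: "T \<in> enhanced_states D" for T
  proof -
    obtain S a b t where S: "S \<in> enhanced_states D1" "a \<in> {1, -1}" "b \<in> {1, -1}" "t \<in> {1, -1}" "T = extend a b t S"
      using enhanced_state_cases[OF T] by metis
    define g where "g = frag_cmul (twist a b S) (frag_of S)"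
    have g: "chain1 g"
      unfolding g_def using S by (intro order_trans[OF keys_cmul]) simp
    have "J a b t g = frag_of T" "a \<noteq> b \<Longrightarrow> J a b 1 g = frag_of T"
      using twist_square[of a b S] extend_mixed[OF S(1-4), of 1] by (simp_all add: g_def J_cmul J_frag_of S(5))
    then have "frag_of T \<in> {P g, P' g, M g, N g, Q g, Q' g}"
      using S(2-4) by (auto simp: M_def N_def)
    with g show ?thesis by blast
  qed
  fix c :: "enhanced_state \<Rightarrow>\<^sub>0 int"
  assume c: "Poly_Mapping.keys c \<subseteq> enhanced_states D"
  show "d (d c) = 0"
  proof (rule frag_additive_eqI[where f = "\<lambda>c. d (d c)" and g = "\<lambda>_. 0", OF _ _ _ c])
    fix T assume "T \<in> enhanced_states D"
    from frag[OF this] obtain u where u: "chain1 u" "frag_of T \<in> {P u, P' u, M u, N u, Q u, Q' u}" by blast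
    have "d (d v) = 0" if "v \<in> {P u, P' u, M u, N u, Q u, Q' u}" for v
      using that blocks(1-6)[OF u(1)] by (elim insertE emptyE) simp_all
    then show "d (d (frag_of T)) = 0" using u(2) by blast
  qed (simp_all add: boundary_diff)
  fix a assume a: "a \<in> arcs D"
  show "x_mult D a (d c) = d (x_mult D a c)"
  proof (rule frag_additive_eqI[where f = "\<lambda>c. x_mult D a (d c)" and g = "\<lambda>c. d (x_mult D a c)", OF _ _ _ c])
    fix T assume "T \<in> enhanced_states D"
    from frag[OF this] obtain u where "chain1 u" "frag_of T \<in> {P u, P' u, M u, N u, Q u, Q' u}" by blast
    then show "x_mult D a (d (frag_of T)) = d (x_mult D a (frag_of T))"
      by (rule blocks(7)[OF _ a])
  qed (simp_all add: boundary_diff x_mult_diff)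
qed

text \<open>The isomorphism is induced by \<open>f\<close> on the kernel of the multiplication and
  by \<open>Q\<close> on representatives of the cokernel of the comultiplication. All conditions
  follow by comparing the six components of \<open>d\<close>.\<close>

lemma homology_basis_extend:
  assumes D1: "x_linear_complex D1"
    and 1: "homology_basis (cycles D1 (i - 2) (j - 4)) (boundaries D1 (i - 2) (j - 4)) N1 b1"
    and 2: "homology_basis (cycles D1 (i + 2) (j + 4)) (boundaries D1 (i + 2) (j + 4)) N2 b2"
  shows "\<exists>b. homology_basis (cycles D i j) (boundaries D i j) (N1 + N2) b"
proof -
  have xd: "X (d1 c) = d1 (X c)" if "chain1 c" for c
    using D1 that e_arc by (auto simp: x_linear_complex_def)
  have gen: "chain1 c" if "Poly_Mapping.keys c \<subseteq> generators D1 i j" for c i j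
    using that generators_subset by blast
  have chX: "chain1 (X c)" if "chain1 c" for c
    using keys_x_mult_enhanced[OF e_arc that] .
  have chd: "chain1 (d1 c)" if "chain1 c" for c
    using keys_boundary_enhanced[OF that] .
  have ch: "chain1 (c + c')" "chain1 (c - c')" if "chain1 c" "chain1 c'" for c c'
    using that by (simp_all add: keys_add_subset keys_diff_subset)
  note linear = boundary_diff boundary_add boundary_minus x_mult_diff x_mult_add x_mult_minus
    J_diff J_add J_minus MN_linear
  \<comment> \<open>The element \<open>c \<otimes> x - x c \<otimes> 1\<close>. Both terms multiply
    to \<open>x c\<close>, so the mixed components of \<open>d (f c)\<close> cancel and
    \<open>d (f c) = f (d1 c)\<close>.\<close>
  define f where "f c = P' c - P (X c)" for c
  have keys_f: "Poly_Mapping.keys (f c) \<subseteq> generators D (k + 2) (l + 4)"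
    if "Poly_Mapping.keys c \<subseteq> generators D1 k l" for c k l
    unfolding f_def
  proof (rule keys_diff_subset)
    show "Poly_Mapping.keys (P' c) \<subseteq> generators D (k + 2) (l + 4)"
      using keys_J[of 1 1 1 c k l] that by (simp add: add.assoc)
    show "Poly_Mapping.keys (P (X c)) \<subseteq> generators D (k + 2) (l + 4)"
      using keys_J[of 1 1 "-1" "X c" k "l + 4"] keys_x_mult[OF finite_arcs1 e_arc that] by (simp add: add.commute)
  qed
  have keys_Q: "Poly_Mapping.keys (Q c) \<subseteq> generators D (k - 2) (l - 4)"
    if "Poly_Mapping.keys c \<subseteq> generators D1 k l" for c k l
    using keys_J[of "-1" "-1" "-1" c k l] that by (simp add: algebra_simps)
  have df: "d (f c) = f (d1 c)" if "chain1 c" for c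
    by (simp add: f_def linear boundary_blocks[OF that] boundary_blocks[OF chX[OF that]] xd[OF that])
  have "homology_basis (cycles D i j) (boundaries D i j) (N1 + N2)
      (\<lambda>k. if k < N1 then f (b1 k) else Q (b2 (k - N1)))"
  proof (rule homology_basis_sum[OF 1 2])
    show "f (c + c') = f c + f c'" "f (frag_cmul k c) = frag_cmul k (f c)" for c c' k
      by (simp_all add: f_def linear x_mult_cmul J_cmul frag_cmul_diff_distrib2)
    show "Q (c + c') = Q c + Q c'" "Q (frag_cmul k c) = frag_cmul k (Q c)" for c c' k
      by (simp_all add: J_add J_cmul)
    show "f c \<in> cycles D i j" if "c \<in> cycles D1 (i - 2) (j - 4)" for c
      using that keys_f[of c "i - 2" "j - 4"] df[OF gen] by (auto simp: cycles_def f_def)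
    show "Q c \<in> cycles D i j" if "c \<in> cycles D1 (i + 2) (j + 4)" for c
      using that keys_Q[of c "i + 2" "j + 4"] boundary_blocks(5)[OF gen] by (auto simp: cycles_def)
    show "f c \<in> boundaries D i j" if c: "c \<in> boundaries D1 (i - 2) (j - 4)" for c
    proof -
      from c obtain c' where c': "Poly_Mapping.keys c' \<subseteq> generators D1 i (j - 4)" "c = d1 c'"
        by (auto simp: boundaries_def)
      then show ?thesis
        using keys_f[OF c'(1)] df[OF gen[OF c'(1)]] by (auto simp: boundaries_def intro!: image_eqI[of _ _ "f c'"])
    qed
    show "Q c \<in> boundaries D i j" if c: "c \<in> boundaries D1 (i + 2) (j + 4)" for c
    proof -
      from c obtain c' where c': "Poly_Mapping.keys c' \<subseteq> generators D1 (i + 4) (j + 4)" "c = d1 c'"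
        by (auto simp: boundaries_def add.assoc)
      have "Poly_Mapping.keys (Q c') \<subseteq> generators D (i + 2) j"
        using keys_Q[OF c'(1)] by (simp add: add.commute)
      then show ?thesis
        unfolding boundaries_def using boundary_blocks(5)[OF gen[OF c'(1)]] c'(2)
        by (intro image_eqI[of _ _ "Q c'"]) simp_all
    qed
    show "c + c' \<in> boundaries D i j" if "c \<in> boundaries D i j" "c' \<in> boundaries D i j" for c c'
      using that by (rule boundaries_add)
    show "(\<Sum>k<N1. frag_cmul (c k) (b1 k)) \<in> cycles D1 (i - 2) (j - 4)" for c
      using 1 by (intro cycles_lincomb) (auto simp: homology_basis_def)
    show "(\<Sum>k<N2. frag_cmul (c k) (b2 k)) \<in> cycles D1 (i + 2) (j + 4)" for c
      using 2 by (intro cycles_lincomb) (auto simp: homology_basis_def)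
  next
    fix z assume "z \<in> cycles D i j"
    then have zk: "Poly_Mapping.keys z \<subseteq> generators D i j" and dz: "d z = 0"
      by (auto simp: cycles_def)
    obtain c1 c2 c3 c4 c5 c6 where c:
      "Poly_Mapping.keys c1 \<subseteq> generators D1 (i - 2) j" "Poly_Mapping.keys c2 \<subseteq> generators D1 (i - 2) (j - 4)"
      "Poly_Mapping.keys c3 \<subseteq> generators D1 i j" "Poly_Mapping.keys c4 \<subseteq> generators D1 i j"
      "Poly_Mapping.keys c5 \<subseteq> generators D1 (i + 2) (j + 4)" "Poly_Mapping.keys c6 \<subseteq> generators D1 (i + 2) j"
      "z = P c1 + P' c2 + M c3 + N c4 + Q c5 + Q' c6"
      using block_decomposition[OF zk] by metis
    note cc = c(1-6)[THEN gen]
    have "P (d1 c1) + P' (d1 c2) + M (c1 + X c2 - d1 c3) + N (c1 + X c2 - d1 c4) +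
        Q (X c3 - X c4 + d1 c5) + Q' (c3 - c4 + d1 c6) = 0"
      using dz by (simp add: c(7) linear cc[THEN boundary_blocks(1)] cc[THEN boundary_blocks(2)]
          cc[THEN boundary_blocks(3)] cc[THEN boundary_blocks(4)] cc[THEN boundary_blocks(5)]
          cc[THEN boundary_blocks(6)] algebra_simps)
    note zero = block_independent[OF chd[OF cc(1)] chd[OF cc(2)] ch(2)[OF ch(1)[OF cc(1) chX[OF cc(2)]] chd[OF cc(3)]]
        ch(2)[OF ch(1)[OF cc(1) chX[OF cc(2)]] chd[OF cc(4)]]
        ch(1)[OF ch(2)[OF chX[OF cc(3)] chX[OF cc(4)]] chd[OF cc(5)]]
        ch(1)[OF ch(2)[OF cc(3) cc(4)] chd[OF cc(6)]] this]
    have c2: "c2 \<in> cycles D1 (i - 2) (j - 4)"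
      using c(2) zero(2) by (simp add: cycles_def)
    \<comment> \<open>The \<open>Q'\<close> component of \<open>d z = 0\<close> makes the mixed
      parts agree up to \<open>d1 c6\<close>, and the \<open>M\<close> component determines
      \<open>c1\<close>.\<close>
    have c4: "c4 = c3 + d1 c6" and c1: "c1 = d1 c3 - X c2"
      using zero(6,3) by (simp_all add: algebra_simps eq_diff_eq)
    have "d1 c5 = X (d1 c6)"
      using zero(5) by (simp add: c4 x_mult_add algebra_simps)
    then have "d1 (c5 - X c6) = 0"
      by (simp add: boundary_diff xd[OF cc(6)])
    moreover have "Poly_Mapping.keys (c5 - X c6) \<subseteq> generators D1 (i + 2) (j + 4)"
      using c(5) keys_x_mult[OF finite_arcs1 e_arc c(6)] by (rule keys_diff_subset)
    ultimately have c56: "c5 - X c6 \<in> cycles D1 (i + 2) (j + 4)"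
      by (simp add: cycles_def)
    \<comment> \<open>\<open>P c3\<close> accounts for the diagonal \<open>M c3 + N c3\<close>, and
      \<open>- N c6\<close> for \<open>Q' c6\<close>. The latter also produces
      \<open>N (d1 c6)\<close>, the defect of the mixed parts, and \<open>Q (X c6)\<close>, which is
      why \<open>c5\<close> is corrected to \<open>c5 - X c6\<close>.\<close>
    have "z - (f c2 + Q (c5 - X c6)) = d (P c3 - N c6)"
      by (simp add: c(7) f_def c1 c4 linear cc[THEN boundary_blocks(1)] cc[THEN boundary_blocks(4)] algebra_simps)
    moreover have "Poly_Mapping.keys (P c3 - N c6) \<subseteq> generators D (i + 2) j"
      using keys_J[OF _ _ _ c(3), of 1 1 "-1"] keys_MN(2)[OF c(6)]
      by (intro keys_diff_subset) (simp_all add: add.assoc)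
    ultimately have "z - (f c2 + Q (c5 - X c6)) \<in> boundaries D i j"
      by (auto simp: boundaries_def)
    with c2 c56 show "\<exists>u\<in>cycles D1 (i - 2) (j - 4). \<exists>v\<in>cycles D1 (i + 2) (j + 4). z - (f u + Q v) \<in> boundaries D i j"
      by blast
  next
    fix u v assume u: "u \<in> cycles D1 (i - 2) (j - 4)" and v: "v \<in> cycles D1 (i + 2) (j + 4)"
      and "f u + Q v \<in> boundaries D i j"
    then obtain c' where c': "Poly_Mapping.keys c' \<subseteq> generators D (i + 2) j" "f u + Q v = d c'"
      by (auto simp: boundaries_def)
    obtain c1 c2 c3 c4 c5 c6 where c:
      "Poly_Mapping.keys c1 \<subseteq> generators D1 i j" "Poly_Mapping.keys c2 \<subseteq> generators D1 i (j - 4)"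
      "Poly_Mapping.keys c3 \<subseteq> generators D1 (i + 2) j" "Poly_Mapping.keys c4 \<subseteq> generators D1 (i + 2) j"
      "Poly_Mapping.keys c5 \<subseteq> generators D1 (i + 4) (j + 4)" "Poly_Mapping.keys c6 \<subseteq> generators D1 (i + 4) j"
      "c' = P c1 + P' c2 + M c3 + N c4 + Q c5 + Q' c6"
      using block_decomposition[OF c'(1)] by (simp add: add.assoc) metis
    note cc = c(1-6)[THEN gen]
    have uc: "chain1 u" and vc: "chain1 v"
      using u v gen by (auto simp: cycles_def)
    have "P (d1 c1 + X u) + P' (d1 c2 - u) + M (c1 + X c2 - d1 c3) + N (c1 + X c2 - d1 c4) +
        Q (X c3 - X c4 + d1 c5 - v) + Q' (c3 - c4 + d1 c6) = 0"
      using c'(2) by (simp add: c(7) f_def linear cc[THEN boundary_blocks(1)] cc[THEN boundary_blocks(2)]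
          cc[THEN boundary_blocks(3)] cc[THEN boundary_blocks(4)] cc[THEN boundary_blocks(5)]
          cc[THEN boundary_blocks(6)] algebra_simps)
    note zero = block_independent[OF ch(1)[OF chd[OF cc(1)] chX[OF uc]] ch(2)[OF chd[OF cc(2)] uc]
        ch(2)[OF ch(1)[OF cc(1) chX[OF cc(2)]] chd[OF cc(3)]]
        ch(2)[OF ch(1)[OF cc(1) chX[OF cc(2)]] chd[OF cc(4)]]
        ch(2)[OF ch(1)[OF ch(2)[OF chX[OF cc(3)] chX[OF cc(4)]] chd[OF cc(5)]] vc]
        ch(1)[OF ch(2)[OF cc(3) cc(4)] chd[OF cc(6)]] this]
    have "u = d1 c2" using zero(2) by simp
    then have "u \<in> boundaries D1 (i - 2) (j - 4)"
      using c(2) by (auto simp: boundaries_def)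
    moreover have c4: "c4 = c3 + d1 c6" using zero(6) by (simp add: algebra_simps)
    \<comment> \<open>\<open>v\<close> exceeds \<open>d1 c5\<close> by \<open>X (c3 - c4)\<close>,
      that is, by \<open>- X (d1 c6)\<close>, and \<open>X\<close> commutes with
      \<open>d1\<close>.\<close>
    have "v = d1 (c5 - X c6)"
      using zero(5) by (simp add: c4 linear xd[OF cc(6)] algebra_simps)
    moreover have "Poly_Mapping.keys (c5 - X c6) \<subseteq> generators D1 (i + 4) (j + 4)"
      using c(5) keys_x_mult[OF finite_arcs1 e_arc c(6)] by (rule keys_diff_subset)
    ultimately show "u \<in> boundaries D1 (i - 2) (j - 4) \<and> v \<in> boundaries D1 (i + 2) (j + 4)"
      by (auto simp: boundaries_def add.assoc)
  qed
  then show ?thesis by blast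
qed

end

section \<open>Connected sums of Hopf links\<close>

lemma khovanov_homology_of_basis:
  assumes fin: "finite (crossings D)" "finite (arcs D)" and D: "x_linear_complex D"
    and basis: "homology_basis (cycles D i j) (boundaries D i j) n b"
  shows "is_free_abelian (khovanov_homology D i j)" "abelian_rank (khovanov_homology D i j) = n"
proof -
  let ?G = "free_Abelian_group (generators D i j)"
  have ker: "kernel (chain_group D i j) (chain_group D (i - 2) j) (differential D i j) = cycles D i j"
    by (auto simp: kernel_def chain_group_def cycles_def differential_eq_boundary[OF fin])
  have im: "differential D (i + 2) j ` carrier (chain_group D (i + 2) j) = boundaries D i j"
    unfolding boundaries_def chain_group_def
    by (intro image_cong) (auto simp: differential_eq_boundary[OF fin])
  have eq: "khovanov_homology D i j = subgroup_generated ?G (cycles D i j) Mod boundaries D i j"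
    unfolding khovanov_homology_def ker im by (simp add: chain_group_def)
  have Z: "subgroup (cycles D i j) ?G"
  proof (rule group.subgroupI)
    show "cycles D i j \<subseteq> carrier ?G"
      by (auto simp: cycles_def)
    have "0 \<in> cycles D i j" by (simp add: cycles_def)
    then show "cycles D i j \<noteq> {}" by blast
    fix c assume c: "c \<in> cycles D i j"
    then show "inv\<^bsub>?G\<^esub> c \<in> cycles D i j" by (simp add: cycles_def boundary_minus)
    fix c2 assume "c2 \<in> cycles D i j"
    with c show "c \<otimes>\<^bsub>?G\<^esub> c2 \<in> cycles D i j"
      by (simp add: cycles_def boundary_add keys_add_subset)
  qed simp
  have BZ: "boundaries D i j \<subseteq> cycles D i j"
  proof
    fix c assume "c \<in> boundaries D i j"
    then obtain c' where c': "Poly_Mapping.keys c' \<subseteq> generators D (i + 2) j" "c = boundary D c'"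
      by (auto simp: boundaries_def)
    moreover have "boundary D (boundary D c') = 0"
      using D order_trans[OF c'(1) generators_subset] by (simp add: x_linear_complex_def)
    ultimately show "c \<in> cycles D i j"
      using keys_boundary[OF fin(1) c'(1)] by (simp add: cycles_def)
  qed
  have B: "subgroup (boundaries D i j) ?G"
  proof (rule group.subgroupI)
    show "boundaries D i j \<subseteq> carrier ?G"
      using BZ by (auto simp: cycles_def)
    have "0 \<in> boundaries D i j"
      unfolding boundaries_def by (intro image_eqI[of _ _ 0]) simp_all
    then show "boundaries D i j \<noteq> {}" by blast
    fix c assume c: "c \<in> boundaries D i j"
    then obtain c' where c': "Poly_Mapping.keys c' \<subseteq> generators D (i + 2) j" "c = boundary D c'"
      by (auto simp: boundaries_def)
    then have "- c \<in> boundaries D i j"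
      unfolding boundaries_def by (intro image_eqI[of _ _ "- c'"]) (simp_all add: boundary_minus)
    moreover have "Poly_Mapping.keys c \<subseteq> generators D i j"
      using c BZ by (auto simp: cycles_def)
    ultimately show "inv\<^bsub>?G\<^esub> c \<in> boundaries D i j" by simp
    fix c2 assume "c2 \<in> boundaries D i j"
    with c show "c \<otimes>\<^bsub>?G\<^esub> c2 \<in> boundaries D i j"
      by (simp add: boundaries_add)
  qed simp
  \<comment> \<open>Room for a basis in the type of cosets: the singletons of the multiples of one
    generator are pairwise distinct.\<close>
  have inf: "infinite (UNIV :: (enhanced_state \<Rightarrow>\<^sub>0 int) set set)"
  proof
    assume "finite (UNIV :: (enhanced_state \<Rightarrow>\<^sub>0 int) set set)"
    then have "finite (range (\<lambda>n :: int. {frag_cmul n (frag_of undefined)} :: (enhanced_state \<Rightarrow>\<^sub>0 int) set))"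
      by (rule rev_finite_subset) simp
    moreover have "inj (\<lambda>n :: int. {frag_cmul n (frag_of undefined)} :: (enhanced_state \<Rightarrow>\<^sub>0 int) set)"
    proof (rule injI)
      fix m n :: int
      assume "{frag_cmul m (frag_of undefined)} = {frag_cmul n (frag_of undefined) :: enhanced_state \<Rightarrow>\<^sub>0 int}"
      then have "frag_cmul m (frag_of undefined) = (frag_cmul n (frag_of undefined) :: enhanced_state \<Rightarrow>\<^sub>0 int)"
        by (rule singleton_inject)
      from arg_cong[OF this, of "\<lambda>c. Poly_Mapping.lookup c undefined"] show "m = n" by simp
    qed
    ultimately show False
      using finite_imageD infinite_UNIV_int by blast
  qed
  note iso = homology_basis_iso[OF Z B BZ basis, folded eq]
  show "is_free_abelian (khovanov_homology D i j)"
    using inf iso(2) by (rule is_free_abelian_finite_rank)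
  show "abelian_rank (khovanov_homology D i j) = n"
    using iso by (rule abelian_rank_free)
qed

text \<open>Bases are required in all degrees at once, because a step at \<open>(i, j)\<close> draws
  on the degrees \<open>(i - 2, j - 4)\<close> and \<open>(i + 2, j + 4)\<close> of the smaller
  diagram.\<close>

definition hopf_sum_like :: "nat \<Rightarrow> diagram \<Rightarrow> bool" where
  "hopf_sum_like n D \<longleftrightarrow> finite (crossings D) \<and> finite (arcs D) \<and> edge D ` slots D \<subseteq> arcs D \<and>
     x_linear_complex D \<and>
     (\<forall>i j. \<exists>b. homology_basis (cycles D i j) (boundaries D i j) (hopf_betti n i j) b)"

context hopf_extension
begin

lemma slots_arcs: "edge D ` slots D \<subseteq> arcs D"
proof -
  let ?g = "\<lambda>u. u \<in> arcs D"
  have ef: "?g e \<longleftrightarrow> ?g f" using e_arc f_arc by (auto simp: arcs_eq)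
  have "edge D (c, k) \<in> arcs D" if "c \<in> crossings D" "k < 4" for c k
  proof (cases "c \<in> crossings D1")
    case True
    then have "edge D1 (c, k) \<in> arcs D1"
      using slots_arcs1 that(2) by (auto simp: slots_def)
    then show ?thesis
      unfolding edge_old[OF ef True that(2)] by (simp add: arcs_eq)
  next
    case False
    then have "c = p \<or> c = q" using that by (simp add: crossings_eq)
    moreover have "k = 0 \<or> k = 1 \<or> k = 2 \<or> k = 3" using that(2) by auto
    moreover have "{w, x, y, z} \<subseteq> arcs D" by (simp add: arcs_eq)
    then have "edge D (p, 0) \<in> arcs D" "edge D (p, 1) \<in> arcs D" "edge D (p, 2) \<in> arcs D" "edge D (p, 3) \<in> arcs D"
      "edge D (q, 0) \<in> arcs D" "edge D (q, 1) \<in> arcs D" "edge D (q, 2) \<in> arcs D" "edge D (q, 3) \<in> arcs D"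
      using edge_p[OF ef] edge_q[OF ef] by simp_all
    ultimately show ?thesis by (elim disjE) simp_all
  qed
  then show ?thesis by (auto simp: slots_def)
qed

lemma hopf_sum_like_extend:
  assumes "hopf_sum_like n D1"
  shows "hopf_sum_like (Suc n) D"
  unfolding hopf_sum_like_def
proof (intro conjI allI)
  show "finite (crossings D)" "finite (arcs D)" "edge D ` slots D \<subseteq> arcs D"
    by (rule finite_crossings finite_arcs slots_arcs)+
  have D1: "x_linear_complex D1" using assms by (simp add: hopf_sum_like_def)
  then show "x_linear_complex D" by (rule x_linear_complex_extend)
  fix i j
  have basis: "\<exists>b. homology_basis (cycles D1 k l) (boundaries D1 k l) (hopf_betti n k l) b" for k l
    using assms by (simp add: hopf_sum_like_def)
  obtain b1 where b1: "homology_basis (cycles D1 (i - 2) (j - 4)) (boundaries D1 (i - 2) (j - 4)) (hopf_betti n (i - 2) (j - 4)) b1"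
    using basis by blast
  obtain b2 where b2: "homology_basis (cycles D1 (i + 2) (j + 4)) (boundaries D1 (i + 2) (j + 4)) (hopf_betti n (i + 2) (j + 4)) b2"
    using basis by blast
  from homology_basis_extend[OF D1 b1 b2]
  show "\<exists>b. homology_basis (cycles D i j) (boundaries D i j) (hopf_betti (Suc n) i j) b" by simp
qed

end

section \<open>From the crossingless circle to connected sums of Hopf links\<close>

definition unknot :: "nat \<Rightarrow> diagram" where
  "unknot a = \<lparr>crossings = {}, arcs = {a}, edge = \<lambda>_. a\<rparr>"

text \<open>Without crossings \<open>d\<close> is zero, so homology is the chain group, generated by
  the two signs of the circle in degrees \<open>(0, 2)\<close> and \<open>(0, -2)\<close>.\<close>

lemma hopf_sum_like_unknot: "hopf_sum_like 0 (unknot a)"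
proof -
  let ?D = "unknot a"
  let ?S = "\<lambda>t :: int. (\<lambda>_. undefined :: int, \<lambda>C\<in>{{a}}. t)"
  have simps: "crossings ?D = {}" "arcs ?D = {a}" by (simp_all add: unknot_def)
  have circle: "circle_of ?D s a = {a}" for s
    by (rule circle_of_eqI) (auto simp: compatible_iff simps)
  have circles: "circles ?D s = {{a}}" for s
    by (simp add: circles_eq_image simps circle)
  have boundary: "boundary ?D c = 0" for c
    by (simp add: boundary_def simps frag_extend_eq_0)
  have S_in: "?S 1 \<in> enhanced_states ?D" "?S (-1) \<in> enhanced_states ?D"
    by (auto simp: enhanced_states_iff simps circles PiE_iff extensional_def)
  have deg: "sigma ?D S = 0" "tau ?D S = snd S {a}" for S
    by (simp_all add: sigma_def tau_def simps circles)
  have states: "enhanced_states ?D = {?S 1, ?S (-1)}"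
  proof (intro equalityI subsetI)
    fix S assume S: "S \<in> enhanced_states ?D"
    obtain s g where Sg: "S = (s, g)" by (cases S)
    have s: "s = (\<lambda>_. undefined)" and g: "g \<in> {{a}} \<rightarrow>\<^sub>E {1, -1}"
      using S by (simp_all add: Sg enhanced_states_iff simps circles)
    have g_eq: "g = (\<lambda>C\<in>{{a}}. g {a})"
    proof
      fix C show "g C = (\<lambda>C\<in>{{a}}. g {a}) C"
        using PiE_arb[OF g, of C] by (cases "C = {a}") simp_all
    qed
    have "g {a} \<in> {1, -1}" by (rule PiE_mem[OF g]) simp
    moreover have "S = ?S (g {a})"
      unfolding Sg s by (rule arg_cong[OF g_eq])
    ultimately show "S \<in> {?S 1, ?S (-1)}"
      by (elim insertE emptyE) (simp_all only: insert_iff simp_thms)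
  qed (use S_in in auto)
  \<comment> \<open>Here \<open>j\<close> is twice the sign of the only circle, so the sign is
    \<open>j div 2\<close>.\<close>
  have gens: "generators ?D i j = (if i = 0 \<and> \<bar>j\<bar> = 2 then {?S (j div 2)} else {})" for i j
  proof -
    have "j = 2 \<or> j = -2" if "\<bar>j\<bar> = 2" using that by arith
    then show ?thesis by (auto simp: generators_def states deg)
  qed
  have Z: "cycles ?D i j = {c. Poly_Mapping.keys c \<subseteq> generators ?D i j}" for i j
    by (simp add: cycles_def boundary)
  have B: "boundaries ?D i j = {0}" for i j
  proof -
    have "boundary ?D = (\<lambda>_. 0)" by (intro ext boundary)
    then show ?thesis
      unfolding boundaries_def by (simp only:) (rule image_constant[of 0], simp)
  qed
  have "\<exists>b. homology_basis (cycles ?D i j) (boundaries ?D i j) (hopf_betti 0 i j) b" for i j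
  proof (cases "i = 0 \<and> \<bar>j\<bar> = 2")
    case True
    let ?T = "?S (j div 2)"
    have single: "c = frag_cmul (Poly_Mapping.lookup c ?T) (frag_of ?T)" if "Poly_Mapping.keys c \<subseteq> {?T}" for c :: "enhanced_state \<Rightarrow>\<^sub>0 int"
    proof (rule poly_mapping_eqI)
      fix S
      show "Poly_Mapping.lookup c S = Poly_Mapping.lookup (frag_cmul (Poly_Mapping.lookup c ?T) (frag_of ?T)) S"
      proof (cases "S = ?T")
        case False
        then have "S \<notin> Poly_Mapping.keys c" using that by blast
        with False show ?thesis by (simp add: in_keys_iff)
      qed simp
    qed
    have gens_T: "generators ?D i j = {?T}" using True by (simp add: gens)
    have "homology_basis (cycles ?D i j) (boundaries ?D i j) (Suc 0) (\<lambda>_. frag_of ?T)"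
      unfolding homology_basis_def Z B gens_T
    proof (intro conjI ballI allI impI)
      fix z :: "enhanced_state \<Rightarrow>\<^sub>0 int" assume "z \<in> {c. Poly_Mapping.keys c \<subseteq> {?T}}"
      then have "frag_cmul (Poly_Mapping.lookup z ?T) (frag_of ?T) = z" by (intro single[symmetric]) simp
      then show "\<exists>c. z - (\<Sum>k<Suc 0. frag_cmul (c k) (frag_of ?T)) \<in> {0}"
        by (intro exI[of _ "\<lambda>_. Poly_Mapping.lookup z ?T"]) simp
    qed (simp_all add: image_subset_iff)
    with True show ?thesis by auto
  next
    case False
    then show ?thesis
      by (auto simp: homology_basis_def Z B gens)
  qed
  moreover have "x_linear_complex ?D"
    by (simp add: x_linear_complex_def boundary)
  ultimately show ?thesis
    by (simp add: hopf_sum_like_def simps slots_def)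
qed

lemma less_4_cases: "k < (4::nat) \<Longrightarrow> k = 0 \<or> k = 1 \<or> k = 2 \<or> k = 3"
  by auto

text \<open>The crossingless circle is taken to be the arc \<open>w\<close> of the Hopf link itself,
  so that \<open>e = f = w\<close> and the general extension step also yields the first Hopf
  link.\<close>

lemma hopf_sum_like_hopf:
  assumes "is_hopf_diagram D"
  shows "hopf_sum_like 1 D"
proof -
  from assms obtain p q w x y z where D: "p \<noteq> q" "distinct [w, x, y, z]"
    "crossings D = {p, q}" "arcs D = {w, x, y, z}"
    "edge D (p, 0) = w" "edge D (p, 1) = x" "edge D (p, 2) = y" "edge D (p, 3) = z"
    "edge D (q, 0) = z" "edge D (q, 1) = y" "edge D (q, 2) = x" "edge D (q, 3) = w"
    unfolding is_hopf_diagram_def by blast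
  interpret hopf_extension "unknot w" D p q w x y z w w
    by unfold_locales (use D in \<open>auto simp: unknot_def slots_def\<close>)
  show ?thesis
    using hopf_sum_like_extend[OF hopf_sum_like_unknot] by simp
qed

text \<open>Every arc of \<open>D1\<close> and of the Hopf diagram occurs at some position. This
  excludes sums along crossingless components and leaves the exchange of two labels; the conclusion
  passes the property on.\<close>

lemma hopf_sum_like_step:
  assumes D1: "hopf_sum_like n D1" "edge D1 ` slots D1 = arcs D1" and "is_hopf_diagram D2"
    and sum: "is_connected_sum D1 D2 D"
  shows "hopf_sum_like (Suc n) D \<and> edge D ` slots D = arcs D"
proof -
  from assms(3) obtain p q w x y z where D2: "p \<noteq> q" "distinct [w, x, y, z]"
    "crossings D2 = {p, q}" "arcs D2 = {w, x, y, z}"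
    "edge D2 (p, 0) = w" "edge D2 (p, 1) = x" "edge D2 (p, 2) = y" "edge D2 (p, 3) = z"
    "edge D2 (q, 0) = z" "edge D2 (q, 1) = y" "edge D2 (q, 2) = x" "edge D2 (q, 3) = w"
    unfolding is_hopf_diagram_def by blast
  have slots2: "slots D2 = {(p, 0), (p, 1), (p, 2), (p, 3), (q, 0), (q, 1), (q, 2), (q, 3)}"
    using less_4_cases by (auto simp: slots_def D2)
  have arcs2: "edge D2 ` slots D2 = arcs D2"
    using D2 by (auto simp: slots2)
  have disj: "crossings D1 \<inter> {p, q} = {}" "arcs D1 \<inter> {w, x, y, z} = {}"
    and crossings: "crossings D = crossings D1 \<union> {p, q}"
    using sum D2 by (auto simp: is_connected_sum_def)
  obtain u v where uv: "u \<in> slots D1" "v \<in> slots D2" and arcs: "arcs D = arcs D1 \<union> arcs D2"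
    and edge: "\<And>t. t \<in> slots D \<Longrightarrow> edge D t = disjoint_union_edge D1 D2 (transpose u v t)"
    using sum D1(2) arcs2 unfolding is_connected_sum_def by auto
  let ?e = "edge D1 u" and ?f = "edge D2 v"
  have slots: "slots D = slots D1 \<union> slots D2" and slots_disj: "slots D1 \<inter> slots D2 = {}"
    using disj by (auto simp: slots_def crossings D2)
  have edge1: "edge D t = (if t = u then ?f else edge D1 t)" if "t \<in> slots D1" for t
    using edge[of t] that uv slots slots_disj
    by (auto simp: disjoint_union_edge_def transpose_def)
  have edge2: "edge D t = (if t = v then ?e else edge D2 t)" if "t \<in> slots D2" for t
    using edge[of t] that uv slots slots_disj
    by (auto simp: disjoint_union_edge_def transpose_def)
  \<comment> \<open>Cutting \<open>f\<close> leaves two loose ends of the smoothed Hopf link, now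
    labelled \<open>e\<close> and \<open>f\<close>. The path that enters at one end must leave at
    the other, whatever the markers are; the eight positions of the cut are checked.\<close>
  have join: "g ?e \<longleftrightarrow> g ?f" if g: "compatible D s g" for s g
  proof -
    let ?h = "\<lambda>c k. g (edge D (c, k))"
    have eqs: "if s c = 1 then ?h c 0 = ?h c 1 \<and> ?h c 2 = ?h c 3 else ?h c 1 = ?h c 2 \<and> ?h c 3 = ?h c 0"
      if "c \<in> {p, q}" for c
      using g that unfolding compatible_iff crossings by blast
    have edges: "edge D (p, k) = (if v = (p, k) then ?e else edge D2 (p, k))"
      "edge D (q, k) = (if v = (q, k) then ?e else edge D2 (q, k))" if "k < 4" for k
      using edge2[of "(p, k)"] edge2[of "(q, k)"] that by (auto simp: slots_def D2(3))
    have Suc_0: "edge D2 (p, Suc 0) = x" "edge D2 (q, Suc 0) = y"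
      using D2(6,10) by simp_all
    have "v \<in> {(p, 0), (p, 1), (p, 2), (p, 3), (q, 0), (q, 1), (q, 2), (q, 3)}"
      using uv(2) by (simp only: slots2)
    then show ?thesis
      using eqs[of p] eqs[of q]
      by (elim insertE emptyE) (simp_all add: edges D2 D2(1)[symmetric] Suc_0 split: if_splits)
  qed
  interpret hopf_extension D1 D p q w x y z ?e ?f
  proof unfold_locales
    show "?e \<in> arcs D1" using D1(2) uv(1) by blast
    show "?f \<in> {w, x, y, z}" using arcs2 uv(2) D2(4) by blast
    show "g (edge D (c, k)) = g (edge D1 (c, k))" if "g ?e = g ?f" "c \<in> crossings D1" "k < 4" for g c k
      using edge1[of "(c, k)"] that by (auto simp: slots_def)
    have same: "g (edge D (c, k)) = g (edge D2 (c, k))" if "g ?e = g ?f" "c \<in> {p, q}" "k < 4" for g c k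
      using edge2[of "(c, k)"] that by (auto simp: slots_def D2(3))
    show "map (\<lambda>k. g (edge D (p, k))) [0, 1, 2, 3] = map g [w, x, y, z]"
      "map (\<lambda>k. g (edge D (q, k))) [0, 1, 2, 3] = map g [z, y, x, w]" if ef: "g ?e = g ?f" for g
      using same[OF ef, of p 0] same[OF ef, of p 1] same[OF ef, of p 2] same[OF ef, of p 3]
        same[OF ef, of q 0] same[OF ef, of q 1] same[OF ef, of q 2] same[OF ef, of q 3]
      by (simp_all only: list.map D2(5-12)) simp_all
    show "arcs D1 \<inter> {w, x, y, z} \<subseteq> {?e} \<inter> {?f}" using disj by simp
    show "compatible D s g \<Longrightarrow> g ?e = g ?f" for s g by (rule join)
  qed (use D1 D2 disj crossings arcs in \<open>auto simp: hopf_sum_like_def\<close>)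
  have "arcs D \<subseteq> edge D ` slots D"
  proof
    fix a assume "a \<in> arcs D"
    then consider t where "t \<in> slots D1" "a = edge D1 t" | t where "t \<in> slots D2" "a = edge D2 t"
      using arcs D1(2) arcs2 by blast
    then show "a \<in> edge D ` slots D"
    proof cases
      case 1
      \<comment> \<open>The label removed from \<open>u\<close> survives at
        \<open>v\<close>.\<close>
      then have "a = edge D (if t = u then v else t)" using edge1 edge2 uv by auto
      then show ?thesis using 1 uv slots by auto
    next
      case 2
      then have "a = edge D (if t = v then u else t)" using edge1 edge2 uv by auto
      then show ?thesis using 2 uv slots by auto
    qed
  qed
  then show ?thesis
    using hopf_sum_like_extend[OF D1(1)] slots_arcs by blast
qed

lemma hopf_sum_like_hopf_sum:
  "is_hopf_sum n D \<Longrightarrow> hopf_sum_like n D \<and> edge D ` slots D = arcs D"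
proof (induction rule: is_hopf_sum.induct)
  case (one D)
  then obtain p q w x y z where D: "crossings D = {p, q}" "arcs D = {w, x, y, z}"
    "edge D (p, 0) = w" "edge D (p, 1) = x" "edge D (p, 2) = y" "edge D (p, 3) = z"
    unfolding is_hopf_diagram_def by blast
  have "(p, k) \<in> slots D" if "k < 4" for k using that by (simp add: slots_def D)
  then have "edge D (p, 0) \<in> edge D ` slots D" "edge D (p, 1) \<in> edge D ` slots D"
    "edge D (p, 2) \<in> edge D ` slots D" "edge D (p, 3) \<in> edge D ` slots D"
    by simp_all
  then have "arcs D \<subseteq> edge D ` slots D"
    by (simp only: D insert_subset empty_subsetI simp_thms)
  moreover have hopf: "hopf_sum_like 1 D"
    using one by (rule hopf_sum_like_hopf)
  then have "edge D ` slots D \<subseteq> arcs D"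
    unfolding hopf_sum_like_def by (elim conjE)
  ultimately show ?case
    using hopf by (intro conjI equalityI)
next
  case (step n D1 D2 D)
  show ?case
    using step.IH[THEN conjunct1] step.IH[THEN conjunct2] step.hyps(2,3) by (rule hopf_sum_like_step)
qed

theorem corollaryX6p6:
  fixes n :: nat and D :: diagram
  assumes "is_hopf_sum n D"
  shows "(\<forall>i j. is_free_abelian (khovanov_homology D i j)) \<and>
    khovanov_polynomial D =
      (laurent_monom 0 2 + laurent_monom 0 (-2)) *
      (laurent_monom 2 4 + laurent_monom (-2) (-4)) ^ n"
proof -
  have D: "hopf_sum_like n D"
    using hopf_sum_like_hopf_sum[OF assms] ..
  then have fin: "finite (crossings D)" "finite (arcs D)" and lin: "x_linear_complex D"
    by (simp_all only: hopf_sum_like_def)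
  have homology: "is_free_abelian (khovanov_homology D i j)"
    "abelian_rank (khovanov_homology D i j) = hopf_betti n i j" for i j
  proof -
    obtain b where "homology_basis (cycles D i j) (boundaries D i j) (hopf_betti n i j) b"
      using D unfolding hopf_sum_like_def by (elim conjE allE exE)
    then show "is_free_abelian (khovanov_homology D i j)"
      "abelian_rank (khovanov_homology D i j) = hopf_betti n i j"
      by (rule khovanov_homology_of_basis[OF fin lin])+
  qed
  have "khovanov_polynomial D =
      (\<Sum>(i, j) | hopf_betti n i j \<noteq> 0. of_nat (hopf_betti n i j) * laurent_monom i j)"
    by (simp only: khovanov_polynomial_def homology(2))
  also have "\<dots> = (laurent_monom 0 2 + laurent_monom 0 (-2)) *
      (laurent_monom 2 4 + laurent_monom (-2) (-4)) ^ n"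
    by (rule laurent_expansion[OF lookup_hopf_polynomial])
  finally show ?thesis
    using homology(1) by blast
qed

end
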